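(* For any reflection expressions $\underline{t}$ and $\underline{t}'$ and any elements $x,y,z,w\in W$, the graded $R$-bimodule $$\operatorname{Hom}_{R\text{-bim}}^\bullet\big(R_x\otimes_R R(\underline{t})\otimes_R R_y,\;R_z\otimes_R R(\underline{t}')\otimes_R R_w\big)$$ is reflexive as a left $R$-module and as a right $R$-module.
   Context: Let $(W,S)$ be a Coxeter system and $T$ the set of its reflections ($W$-conjugates of elements of $S$). Let $\Bbbk$ be a field of characteristic different from $2$ and $V$ a finite-dimensional $\Bbbk$-vector space on which $W$ acts linearly and faithfully (on the left) so that every $s\in S$ acts by a reflection: there are $\alpha_s\in V$, $\alpha_s^\vee\in V^*$ with $\alpha_s^\vee(\alpha_s)=2$ and $sv=v-\alpha_s^\vee(v)\alpha_s$ for all $v\in V$. Then every $t\in T$ also acts by a reflection; fix for each $t\in T$ a root $\alpha_t\in V$ and coroot $\alpha_t^\vee\in V^*$ with $\alpha_t^\vee(\alpha_t)=2$ and $tv=v-\alpha_t^\vee(v)\alpha_t$. Assume the GKM-condition: if $\alpha_t$ and $\alpha_{t'}$ are proportional, then $t=t'$. $\operatorname{Sym}(V)$ is graded with $V$ in degree $2$. Fix a $W$-invariant multiplicative subset $\boldsymbol\sigma\subset\operatorname{Sym}(V)$ consisting of homogeneous elements and containing no element divisible by any root $\alpha_t$, $t\in T$. Put $R=\boldsymbol\sigma^{-1}\operatorname{Sym}(V)$, a graded ring with a $W$-action. For $t\in T$, $R^t$ is the subring of $t$-invariants. For $w\in W$, the twisted bimodule $R_w$ is $R$ as an abelian group,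 with left action $r\cdot m=rm$ and right action $m\cdot r=m\,(wr)$. A reflection expression is a finite sequence $\underline{t}=(t_1,\ldots,t_n)$ of elements of $T$; its Bott-Samelson bimodule is $R(\underline{t})=R\otimes_{R^{t_1}}R\otimes_{R^{t_2}}\cdots\otimes_{R^{t_n}}R$ (and $R(\underline\emptyset)=R$), with $R$ acting on the left on the first factor and on the right on the last factor. For graded bimodules $M,N$, $\operatorname{Hom}^\bullet_{R\text{-bim}}(M,N)$ is the direct sum over $d\in\mathbb Z$ of the groups of bimodule homomorphisms $\phi$ with $\phi(M_i)\subset N_{i+d}$ for all $i$; the left and right actions on it are $(r\phi)(m)=r\phi(m)$, $(\phi r)(m)=\phi(m)r$. For a graded left or right $R$-module $M$, its graded dual is $M^\vee=\operatorname{Hom}_R^\bullet(M,R)$ (direct sum of homomorphisms of all degrees), again a left or right module respectively; $M$ is reflexive if the natural evaluation map $M\to M^{\vee\vee}$ is an isomorphism. *)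

theory Defs
  imports Complex_Main "HOL-Algebra.QuotRing" "HOL-Algebra.Module" "HOL-Algebra.Divisibility"
    "HOL-Algebra.Group_Action" "HOL-Algebra.Free_Abelian_Groups" "HOL-Library.Multiset"
begin

section \<open>Coxeter systems and reflections\<close>

text \<open>The entry \<open>0\<close> of a Coxeter matrix stands for \<open>\<infinity>\<close>: the corresponding word
  \<open>(st)\<^sup>0\<close> is empty and imposes no relation.\<close>

definition coxeter_matrix :: "'w set \<Rightarrow> ('w \<Rightarrow> 'w \<Rightarrow> nat) \<Rightarrow> bool" where
  "coxeter_matrix S m \<longleftrightarrow>
     (\<forall>s\<in>S. m s s = 1) \<and> (\<forall>s\<in>S. \<forall>t\<in>S. m s t = m t s \<and> (s \<noteq> t \<longrightarrow> m s t \<noteq> 1))"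

text \<open>\<open>coxeter_step\<close> deletes one factor \<open>(st)\<^bsup>m s t\<^esup>\<close> from a word.  The relations include
  \<open>ss = 1\<close> (the case \<open>s = t\<close>), so that every generator is its own inverse and positive words
  suffice: the classes of words in \<open>S\<close> under the equivalence relation generated by these steps
  form the group with presentation \<open>\<langle>S | (st)\<^bsup>m s t\<^esup> = 1\<rangle>\<close>.\<close>

inductive coxeter_step :: "'w set \<Rightarrow> ('w \<Rightarrow> 'w \<Rightarrow> nat) \<Rightarrow> 'w list \<Rightarrow> 'w list \<Rightarrow> bool"
  for S m where
  "\<lbrakk>s \<in> S; t \<in> S\<rbrakk> \<Longrightarrow> coxeter_step S m (u @ concat (replicate (m s t) [s, t]) @ v) (u @ v)"

definition word_value :: "('w, 'b) monoid_scheme \<Rightarrow> 'w list \<Rightarrow> 'w" where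
  "word_value W u = foldr (\<otimes>\<^bsub>W\<^esub>) u \<one>\<^bsub>W\<^esub>"

definition coxeter_system :: "('w, 'b) monoid_scheme \<Rightarrow> 'w set \<Rightarrow> bool" where
  "coxeter_system W S \<longleftrightarrow>
     group W \<and> S \<subseteq> carrier W \<and> generate W S = carrier W \<and>
     (\<exists>m. coxeter_matrix S m \<and>
        (\<forall>u v. set u \<subseteq> S \<and> set v \<subseteq> S \<longrightarrow>
           (word_value W u = word_value W v \<longleftrightarrow> (symclp (coxeter_step S m))\<^sup>*\<^sup>* u v)))"

definition reflections :: "('w, 'b) monoid_scheme \<Rightarrow> 'w set \<Rightarrow> 'w set" where
  "reflections W S = {w \<otimes>\<^bsub>W\<^esub> s \<otimes>\<^bsub>W\<^esub> inv\<^bsub>W\<^esub> w | w s. w \<in> carrier W \<and> s \<in> S}"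

text \<open>The linear endomorphism \<open>f\<close> is the reflection with root \<open>a\<close> and coroot \<open>c\<close>.\<close>

definition reflection_with ::
    "('k::field \<Rightarrow> 'v::ab_group_add \<Rightarrow> 'v) \<Rightarrow> ('v \<Rightarrow> 'v) \<Rightarrow> 'v \<Rightarrow> ('v \<Rightarrow> 'k) \<Rightarrow> bool" where
  "reflection_with scale f a c \<longleftrightarrow>
     Vector_Spaces.linear scale (*) c \<and> c a = 2 \<and> (\<forall>v. f v = v - scale (c v) a)"


section \<open>Symmetric algebras and localization\<close>

record 'a graded_ring = "'a ring" +
  homog :: "int \<Rightarrow> 'a set"

definition poly_alg :: "('v multiset \<Rightarrow>\<^sub>0 'k::field) ring" where
  "poly_alg = \<lparr>carrier = UNIV, monoid.mult = (*), one = 1, ring.zero = 0, add = (+)\<rparr>"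

text \<open>The symmetric algebra of \<open>V\<close> is the free commutative algebra with one variable
  \<open>X\<^sub>v\<close> for every vector \<open>v\<close>, modulo the relations making \<open>v \<mapsto> X\<^sub>v\<close> linear.\<close>

definition sym_ideal ::
    "('k::field \<Rightarrow> 'v::ab_group_add \<Rightarrow> 'v) \<Rightarrow> ('v multiset \<Rightarrow>\<^sub>0 'k) set" where
  "sym_ideal scale = Idl\<^bsub>poly_alg\<^esub>
     ({Poly_Mapping.single {#v + w#} 1 - Poly_Mapping.single {#v#} 1
         - Poly_Mapping.single {#w#} 1 | v w. True} \<union>
      {Poly_Mapping.single {#scale c v#} 1 - Poly_Mapping.single {#v#} c | c v. True})"

definition sym_class ::
    "('k::field \<Rightarrow> 'v::ab_group_add \<Rightarrow> 'v) \<Rightarrow> ('v multiset \<Rightarrow>\<^sub>0 'k) \<Rightarrow> ('v multiset \<Rightarrow>\<^sub>0 'k) set" where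
  "sym_class scale p = sym_ideal scale +>\<^bsub>poly_alg\<^esub> p"

definition sym_alg ::
    "('k::field \<Rightarrow> 'v::ab_group_add \<Rightarrow> 'v) \<Rightarrow> ('v multiset \<Rightarrow>\<^sub>0 'k) set graded_ring" where
  "sym_alg scale = ring.extend (poly_alg Quot sym_ideal scale)
     (graded_ring.fields
        (\<lambda>d. sym_class scale ` {p. \<forall>m\<in>Poly_Mapping.keys p. 2 * int (size m) = d}))"

definition sym_vec ::
    "('k::field \<Rightarrow> 'v::ab_group_add \<Rightarrow> 'v) \<Rightarrow> 'v \<Rightarrow> ('v multiset \<Rightarrow>\<^sub>0 'k) set" where
  "sym_vec scale v = sym_class scale (Poly_Mapping.single {#v#} 1)"

definition poly_map ::
    "('v \<Rightarrow> 'v) \<Rightarrow> ('v multiset \<Rightarrow>\<^sub>0 'k::field) \<Rightarrow> ('v multiset \<Rightarrow>\<^sub>0 'k)" where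
  "poly_map f p =
     (\<Sum>m\<in>Poly_Mapping.keys p. Poly_Mapping.single (image_mset f m) (Poly_Mapping.lookup p m))"

text \<open>In this and similar definitions below, the union is over representatives of a class; it
  is that of any one representative when the map on representatives is compatible with the
  relation.\<close>

definition sym_map ::
    "('k::field \<Rightarrow> 'v::ab_group_add \<Rightarrow> 'v) \<Rightarrow> ('v \<Rightarrow> 'v) \<Rightarrow>
     ('v multiset \<Rightarrow>\<^sub>0 'k) set \<Rightarrow> ('v multiset \<Rightarrow>\<^sub>0 'k) set" where
  "sym_map scale f A = (\<Union>p\<in>A. sym_class scale (poly_map f p))"

definition loc_rel :: "('a, 'b) ring_scheme \<Rightarrow> 'a set \<Rightarrow> (('a \<times> 'a) \<times> ('a \<times> 'a)) set" where
  "loc_rel A S = {((a, s), (b, t)). a \<in> carrier A \<and> b \<in> carrier A \<and> s \<in> S \<and> t \<in> S \<and>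
     (\<exists>u\<in>S. u \<otimes>\<^bsub>A\<^esub> (a \<otimes>\<^bsub>A\<^esub> t) = u \<otimes>\<^bsub>A\<^esub> (b \<otimes>\<^bsub>A\<^esub> s))}"

definition loc_frac :: "('a, 'b) ring_scheme \<Rightarrow> 'a set \<Rightarrow> 'a \<Rightarrow> 'a \<Rightarrow> ('a \<times> 'a) set" where
  "loc_frac A S a s = loc_rel A S `` {(a, s)}"

definition localization :: "('a, 'b) graded_ring_scheme \<Rightarrow> 'a set \<Rightarrow> ('a \<times> 'a) set graded_ring" where
  "localization A S =
     \<lparr>carrier = (carrier A \<times> S) // loc_rel A S,
      monoid.mult = (\<lambda>X Y. \<Union>(a, s)\<in>X. \<Union>(b, t)\<in>Y. loc_frac A S (a \<otimes>\<^bsub>A\<^esub> b) (s \<otimes>\<^bsub>A\<^esub> t)),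
      one = loc_frac A S \<one>\<^bsub>A\<^esub> \<one>\<^bsub>A\<^esub>,
      ring.zero = loc_frac A S \<zero>\<^bsub>A\<^esub> \<one>\<^bsub>A\<^esub>,
      add = (\<lambda>X Y. \<Union>(a, s)\<in>X. \<Union>(b, t)\<in>Y.
               loc_frac A S (a \<otimes>\<^bsub>A\<^esub> t \<oplus>\<^bsub>A\<^esub> b \<otimes>\<^bsub>A\<^esub> s) (s \<otimes>\<^bsub>A\<^esub> t)),
      homog = (\<lambda>d. {loc_frac A S a s | a s i j.
               a \<in> homog A i \<and> s \<in> S \<and> s \<in> homog A j \<and> i - j = d})\<rparr>"

definition localization_map ::
    "('a, 'b) ring_scheme \<Rightarrow> 'a set \<Rightarrow> ('a \<Rightarrow> 'a) \<Rightarrow> ('a \<times> 'a) set \<Rightarrow> ('a \<times> 'a) set" where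
  "localization_map A S f X = (\<Union>(a, s)\<in>X. loc_frac A S (f a) (f s))"

type_synonym ('v, 'k) loc_sym = "(('v multiset \<Rightarrow>\<^sub>0 'k) set \<times> ('v multiset \<Rightarrow>\<^sub>0 'k) set) set"

definition loc_sym ::
    "('k::field \<Rightarrow> 'v::ab_group_add \<Rightarrow> 'v) \<Rightarrow> ('v multiset \<Rightarrow>\<^sub>0 'k) set set \<Rightarrow>
     ('v, 'k) loc_sym graded_ring" where
  "loc_sym scale \<sigma> = localization (sym_alg scale) \<sigma>"

definition loc_sym_act ::
    "('k::field \<Rightarrow> 'v::ab_group_add \<Rightarrow> 'v) \<Rightarrow> ('v multiset \<Rightarrow>\<^sub>0 'k) set set \<Rightarrow>
     ('w \<Rightarrow> 'v \<Rightarrow> 'v) \<Rightarrow> 'w \<Rightarrow> ('v, 'k) loc_sym \<Rightarrow> ('v, 'k) loc_sym" where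
  "loc_sym_act scale \<sigma> \<rho> w = localization_map (sym_alg scale) \<sigma> (sym_map scale (\<rho> w))"


section \<open>Graded modules and bimodules over a commutative graded ring\<close>

text \<open>As in the library's record of modules, \<open>mult\<close> and \<open>one\<close> are present but meaningless.\<close>

record ('a, 'm) graded_module = "('a, 'm) module" +
  grade :: "int \<Rightarrow> 'm set"

record ('a, 'm) graded_bimodule = "('a, 'm) graded_module" +
  rsmult :: "'m \<Rightarrow> 'a \<Rightarrow> 'm"

text \<open>A bimodule is used as a left module as it stands; \<open>right_module\<close> is its underlying right
  module.  The ring being commutative, right modules are written as modules too.\<close>

definition right_module ::
    "('a, 'm, 'z) graded_bimodule_scheme \<Rightarrow> ('a, 'm) graded_module" where
  "right_module M = \<lparr>carrier = carrier M, monoid.mult = monoid.mult M, one = one M,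
     ring.zero = ring.zero M, add = add M,
     smult = (\<lambda>r m. rsmult M m r), grade = grade M\<rparr>"

definition self_module :: "('a, 'z) graded_ring_scheme \<Rightarrow> ('a, 'a) graded_module" where
  "self_module R = \<lparr>carrier = carrier R, monoid.mult = monoid.mult R, one = one R,
     ring.zero = ring.zero R, add = add R,
     smult = monoid.mult R, grade = homog R\<rparr>"

definition module_hom ::
    "('a, 'y) ring_scheme \<Rightarrow> ('a, 'm, 'z) module_scheme \<Rightarrow> ('a, 'n, 'u) module_scheme \<Rightarrow>
     ('m \<Rightarrow> 'n) set" where
  "module_hom R M N = {\<phi> \<in> carrier M \<rightarrow>\<^sub>E carrier N.
     (\<forall>m\<in>carrier M. \<forall>n\<in>carrier M. \<phi> (m \<oplus>\<^bsub>M\<^esub> n) = \<phi> m \<oplus>\<^bsub>N\<^esub> \<phi> n) \<and>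
     (\<forall>r\<in>carrier R. \<forall>m\<in>carrier M. \<phi> (r \<odot>\<^bsub>M\<^esub> m) = r \<odot>\<^bsub>N\<^esub> \<phi> m)}"

definition bimodule_hom ::
    "('a, 'y) ring_scheme \<Rightarrow> ('a, 'm, 'z) graded_bimodule_scheme \<Rightarrow>
     ('a, 'n, 'u) graded_bimodule_scheme \<Rightarrow> ('m \<Rightarrow> 'n) set" where
  "bimodule_hom R M N = {\<phi> \<in> module_hom R M N.
     \<forall>r\<in>carrier R. \<forall>m\<in>carrier M. \<phi> (rsmult M m r) = rsmult N (\<phi> m) r}"

definition deg_part ::
    "('m \<Rightarrow> 'n) set \<Rightarrow> ('a, 'm, 'z) graded_module_scheme \<Rightarrow> ('a, 'n, 'u) graded_module_scheme \<Rightarrow>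
     int \<Rightarrow> ('m \<Rightarrow> 'n) set" where
  "deg_part H M N d = {\<phi> \<in> H. \<forall>i. \<phi> ` grade M i \<subseteq> grade N (i + d)}"

text \<open>The direct sum of the groups of homomorphisms of the various degrees is formed inside the
  group of all homomorphisms: for graded \<open>M\<close> and \<open>N\<close> the sum of these subgroups is direct.\<close>

definition deg_sum ::
    "('m \<Rightarrow> 'n) set \<Rightarrow> ('a, 'm, 'z) graded_module_scheme \<Rightarrow> ('a, 'n, 'u) graded_module_scheme \<Rightarrow>
     ('m \<Rightarrow> 'n) set" where
  "deg_sum H M N = {\<phi>. \<exists>D f. finite D \<and> (\<forall>d\<in>D. f d \<in> deg_part H M N d) \<and>
     \<phi> = (\<lambda>m\<in>carrier M. \<Oplus>\<^bsub>N\<^esub>d\<in>D. f d m)}"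

definition hom_bimodule ::
    "('a, 'y) ring_scheme \<Rightarrow> ('a, 'm, 'z) graded_bimodule_scheme \<Rightarrow>
     ('a, 'n, 'u) graded_bimodule_scheme \<Rightarrow> ('a, 'm \<Rightarrow> 'n) graded_bimodule" where
  "hom_bimodule R M N =
     \<lparr>carrier = deg_sum (bimodule_hom R M N) M N, monoid.mult = undefined, one = undefined,
      ring.zero = (\<lambda>m\<in>carrier M. \<zero>\<^bsub>N\<^esub>),
      add = (\<lambda>\<phi> \<psi>. \<lambda>m\<in>carrier M. \<phi> m \<oplus>\<^bsub>N\<^esub> \<psi> m),
      smult = (\<lambda>r \<phi>. \<lambda>m\<in>carrier M. r \<odot>\<^bsub>N\<^esub> \<phi> m),
      grade = deg_part (bimodule_hom R M N) M N,
      rsmult = (\<lambda>\<phi> r. \<lambda>m\<in>carrier M. rsmult N (\<phi> m) r)\<rparr>"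

definition dual ::
    "('a, 'y) graded_ring_scheme \<Rightarrow> ('a, 'm, 'z) graded_module_scheme \<Rightarrow>
     ('a, 'm \<Rightarrow> 'a) graded_module" where
  "dual R M =
     \<lparr>carrier = deg_sum (module_hom R M (self_module R)) M (self_module R),
      monoid.mult = undefined, one = undefined,
      ring.zero = (\<lambda>m\<in>carrier M. \<zero>\<^bsub>R\<^esub>),
      add = (\<lambda>\<phi> \<psi>. \<lambda>m\<in>carrier M. \<phi> m \<oplus>\<^bsub>R\<^esub> \<psi> m),
      smult = (\<lambda>r \<phi>. \<lambda>m\<in>carrier M. r \<otimes>\<^bsub>R\<^esub> \<phi> m),
      grade = deg_part (module_hom R M (self_module R)) M (self_module R)\<rparr>"

definition evaluation ::
    "('a, 'y) graded_ring_scheme \<Rightarrow> ('a, 'm, 'z) graded_module_scheme \<Rightarrow>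
     'm \<Rightarrow> ('m \<Rightarrow> 'a) \<Rightarrow> 'a" where
  "evaluation R M = (\<lambda>m\<in>carrier M. \<lambda>\<phi>\<in>carrier (dual R M). \<phi> m)"

definition graded_iso ::
    "('a, 'y) ring_scheme \<Rightarrow> ('a, 'm, 'z) graded_module_scheme \<Rightarrow>
     ('a, 'n, 'u) graded_module_scheme \<Rightarrow> ('m \<Rightarrow> 'n) \<Rightarrow> bool" where
  "graded_iso R M N \<phi> \<longleftrightarrow>
     \<phi> \<in> module_hom R M N \<and> bij_betw \<phi> (carrier M) (carrier N) \<and>
     (\<forall>i. \<phi> ` grade M i = grade N i)"

definition reflexive ::
    "('a, 'y) graded_ring_scheme \<Rightarrow> ('a, 'm, 'z) graded_module_scheme \<Rightarrow> bool" where
  "reflexive R M \<longleftrightarrow> graded_iso R M (dual R (dual R M)) (evaluation R M)"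


section \<open>Tensor products\<close>

definition presented_group :: "'x set \<Rightarrow> ('x \<Rightarrow>\<^sub>0 int) set \<Rightarrow> ('x \<Rightarrow>\<^sub>0 int) set monoid" where
  "presented_group X rels = free_Abelian_group X Mod generate (free_Abelian_group X) rels"

definition presented_class :: "'x set \<Rightarrow> ('x \<Rightarrow>\<^sub>0 int) set \<Rightarrow> ('x \<Rightarrow>\<^sub>0 int) \<Rightarrow> ('x \<Rightarrow>\<^sub>0 int) set" where
  "presented_class X rels c =
     generate (free_Abelian_group X) rels #>\<^bsub>free_Abelian_group X\<^esub> c"

definition presented_map ::
    "'x set \<Rightarrow> ('x \<Rightarrow>\<^sub>0 int) set \<Rightarrow> ('x \<Rightarrow> 'x) \<Rightarrow> ('x \<Rightarrow>\<^sub>0 int) set \<Rightarrow> ('x \<Rightarrow>\<^sub>0 int) set" where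
  "presented_map X rels f A =
     (\<Union>c\<in>A. presented_class X rels (frag_extend (\<lambda>x. frag_of (f x)) c))"

text \<open>The abelian group with generators \<open>X\<close> and relators \<open>rels\<close>, with the actions induced
  by the left and right actions \<open>l\<close> and \<open>r\<close> on \<open>X\<close>, and graded by letting \<open>x\<close> be
  homogeneous of degree \<open>d\<close> whenever \<open>h x d\<close>.\<close>

definition presented_bimodule ::
    "'x set \<Rightarrow> ('x \<Rightarrow>\<^sub>0 int) set \<Rightarrow> ('a \<Rightarrow> 'x \<Rightarrow> 'x) \<Rightarrow> ('x \<Rightarrow> 'a \<Rightarrow> 'x) \<Rightarrow> ('x \<Rightarrow> int \<Rightarrow> bool) \<Rightarrow>
     ('a, ('x \<Rightarrow>\<^sub>0 int) set) graded_bimodule" where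
  "presented_bimodule X rels l r h =
     \<lparr>carrier = carrier (presented_group X rels), monoid.mult = undefined, one = undefined,
      ring.zero = one (presented_group X rels),
      add = monoid.mult (presented_group X rels),
      smult = (\<lambda>a. presented_map X rels (l a)),
      grade = (\<lambda>d. generate (presented_group X rels)
                 {presented_class X rels (frag_of x) | x. x \<in> X \<and> h x d}),
      rsmult = (\<lambda>A a. presented_map X rels (\<lambda>x. r x a) A)\<rparr>"

definition tensor_rels ::
    "('a, 'y) ring_scheme \<Rightarrow> ('a, 'm, 'z) graded_bimodule_scheme \<Rightarrow>
     ('a, 'n, 'u) graded_bimodule_scheme \<Rightarrow> ('m \<times> 'n \<Rightarrow>\<^sub>0 int) set" where
  "tensor_rels R M N =
     {frag_of (m \<oplus>\<^bsub>M\<^esub> m', n) - frag_of (m, n) - frag_of (m', n) | m m' n.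
        m \<in> carrier M \<and> m' \<in> carrier M \<and> n \<in> carrier N} \<union>
     {frag_of (m, n \<oplus>\<^bsub>N\<^esub> n') - frag_of (m, n) - frag_of (m, n') | m n n'.
        m \<in> carrier M \<and> n \<in> carrier N \<and> n' \<in> carrier N} \<union>
     {frag_of (rsmult M m r, n) - frag_of (m, r \<odot>\<^bsub>N\<^esub> n) | m r n.
        m \<in> carrier M \<and> r \<in> carrier R \<and> n \<in> carrier N}"

definition tensor ::
    "('a, 'y) ring_scheme \<Rightarrow> ('a, 'm, 'z) graded_bimodule_scheme \<Rightarrow>
     ('a, 'n, 'u) graded_bimodule_scheme \<Rightarrow> ('a, ('m \<times> 'n \<Rightarrow>\<^sub>0 int) set) graded_bimodule" where
  "tensor R M N = presented_bimodule (carrier M \<times> carrier N) (tensor_rels R M N)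
     (\<lambda>r (m, n). (r \<odot>\<^bsub>M\<^esub> m, n)) (\<lambda>(m, n) r. (m, rsmult N n r))
     (\<lambda>(m, n) d. \<exists>i j. m \<in> grade M i \<and> n \<in> grade N j \<and> i + j = d)"


section \<open>Twisted bimodules and Bott-Samelson bimodules\<close>

definition twisted ::
    "('a, 'y) graded_ring_scheme \<Rightarrow> ('w \<Rightarrow> 'a \<Rightarrow> 'a) \<Rightarrow> 'w \<Rightarrow> ('a, 'a) graded_bimodule" where
  "twisted R act w = \<lparr>carrier = carrier R, monoid.mult = monoid.mult R, one = one R,
     ring.zero = ring.zero R, add = add R,
     smult = monoid.mult R, grade = homog R, rsmult = (\<lambda>m r. m \<otimes>\<^bsub>R\<^esub> act w r)\<rparr>"

text \<open>The iterated tensor product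
  \<open>R \<otimes> R \<otimes> \<dots> \<otimes> R\<close> over the invariant rings of \<open>t\<^sub>1, \<dots>, t\<^sub>n\<close> is presented in one step, with
  generators the lists \<open>[r\<^sub>0, \<dots>, r\<^sub>n]\<close> standing for \<open>r\<^sub>0 \<otimes> \<dots> \<otimes> r\<^sub>n\<close>; forming it by \<open>n\<close> binary
  tensor products would make its type depend on \<open>n\<close>.  For \<open>n = 0\<close> it is \<open>R\<close>, in the guise
  of the abelian group generated by the elements of \<open>R\<close> modulo additivity.\<close>

definition bs_gens :: "('a, 'y) ring_scheme \<Rightarrow> 'w list \<Rightarrow> 'a list set" where
  "bs_gens R ts = {rs. length rs = Suc (length ts) \<and> set rs \<subseteq> carrier R}"

definition bs_rels ::
    "('a, 'y) ring_scheme \<Rightarrow> ('w \<Rightarrow> 'a \<Rightarrow> 'a) \<Rightarrow> 'w list \<Rightarrow> ('a list \<Rightarrow>\<^sub>0 int) set" where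
  "bs_rels R act ts =
     {frag_of (rs[i := a \<oplus>\<^bsub>R\<^esub> b]) - frag_of (rs[i := a]) - frag_of (rs[i := b]) | rs i a b.
        rs \<in> bs_gens R ts \<and> i < length rs \<and> a \<in> carrier R \<and> b \<in> carrier R} \<union>
     {frag_of (rs[i := rs ! i \<otimes>\<^bsub>R\<^esub> a]) - frag_of (rs[Suc i := a \<otimes>\<^bsub>R\<^esub> rs ! Suc i]) | rs i a.
        rs \<in> bs_gens R ts \<and> i < length ts \<and> a \<in> invariants (carrier R) act (ts ! i)}"

definition bott_samelson ::
    "('a, 'y) graded_ring_scheme \<Rightarrow> ('w \<Rightarrow> 'a \<Rightarrow> 'a) \<Rightarrow> 'w list \<Rightarrow>
     ('a, ('a list \<Rightarrow>\<^sub>0 int) set) graded_bimodule" where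
  "bott_samelson R act ts = presented_bimodule (bs_gens R ts) (bs_rels R act ts)
     (\<lambda>a rs. rs[0 := a \<otimes>\<^bsub>R\<^esub> rs ! 0])
     (\<lambda>rs a. rs[length ts := rs ! length ts \<otimes>\<^bsub>R\<^esub> a])
     (\<lambda>rs d. \<exists>ds. list_all2 (\<lambda>r e. r \<in> homog R e) rs ds \<and> sum_list ds = d)"

definition twisted_bott_samelson ::
    "('a, 'y) graded_ring_scheme \<Rightarrow> ('w \<Rightarrow> 'a \<Rightarrow> 'a) \<Rightarrow> 'w \<Rightarrow> 'w list \<Rightarrow> 'w \<Rightarrow>
     ('a, (('a \<times> ('a list \<Rightarrow>\<^sub>0 int) set \<Rightarrow>\<^sub>0 int) set \<times> 'a \<Rightarrow>\<^sub>0 int) set) graded_bimodule" where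
  "twisted_bott_samelson R act x ts y =
     tensor R (tensor R (twisted R act x) (bott_samelson R act ts)) (twisted R act y)"

end

theory Submission
  imports Defs "HOL-Library.Multiset_Order"
begin

text \<open>
  The proof rests on two facts.  Both sides of the Hom are finitely generated graded projective
  modules over \<open>R\<close>, from the left and from the right; and Hom between such bimodules is reflexive
  because \<open>R\<close> has no zero divisors.

  For the first fact, let \<open>t\<close> be a reflection with root \<open>\<alpha>\<close>.  The difference of a polynomial and its
  image under \<open>t\<close> is divisible by \<open>\<alpha>\<close> (\<open>poly_map_reflection_divisible\<close>), and this passes to
  fractions.  As \<open>2\<close> is invertible, \<open>r = (r + t r) / 2 + \<alpha> \<cdot> (r - t r) / (2 \<alpha>)\<close> exhibits \<open>R\<close> as a
  module over the \<open>t\<close>-invariants with the basis \<open>1, \<alpha>\<close> (\<open>reflection_dual_basis\<close>).  Splitting the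
  factors of \<open>r\<^sub>0 \<otimes> \<dots> \<otimes> r\<^sub>n\<close> one after the other in this way gives a homogeneous dual basis of a
  Bott-Samelson bimodule as a left module, and by reversing the expression also as a right module
  (\<open>bott_samelson_biprojective\<close>).  Twisted bimodules are free of rank one, and dual bases pass to
  tensor products (\<open>tensor_biprojective\<close>).

  For the second fact (\<open>hom_bimodule_reflexive\<close>), let \<open>H\<close> be the graded Hom from \<open>M\<close> to \<open>N\<close>, seen as
  a module from one side, and let \<open>\<xi>\<close> be an element of its double dual.  For \<open>m\<close> in \<open>M\<close> and a functional
  \<open>l\<close> on \<open>N\<close> the matrix coefficient \<open>\<phi> \<mapsto> l (\<phi> m)\<close> lies in the dual of \<open>H\<close>.  The values of \<open>\<xi>\<close> on
  these form, for fixed \<open>m\<close>, a functional on the dual of the projective module \<open>N\<close>, so they are the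
  values \<open>l (\<Phi> m)\<close> at a point \<open>\<Phi> m\<close> of \<open>N\<close>.  The map \<open>\<Phi>\<close> is a bimodule homomorphism, because an
  action on \<open>N\<close> can be absorbed into \<open>l\<close>.  Evaluation at \<open>\<Phi>\<close> agrees with \<open>\<xi>\<close> on matrix coefficients.
  If \<open>R\<close> is the zero ring, all values are zero and nothing remains to be shown.  Otherwise, finitely
  many matrix coefficients separate the points of \<open>H\<close>, so over the fraction field they span the dual
  of \<open>H\<close>: every functional has a nonzero multiple that is a combination of matrix coefficients
  (\<open>rational_dependence\<close>).  As \<open>R\<close> has no zero divisors, \<open>\<xi>\<close> is evaluation at \<open>\<Phi>\<close>.

  That \<open>R\<close> has no zero divisors is inherited from the symmetric algebra, which embeds into a
  polynomial ring once a basis of the vector space is chosen (\<open>coordinate_embedding\<close>).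
\<close>

section \<open>Graded modules over a graded coefficient ring\<close>

lemma additive_finsum:
  assumes M: "abelian_group M" and N: "abelian_group N"
    and closed: "\<And>a. a \<in> carrier M \<Longrightarrow> g a \<in> carrier N"
    and add: "\<And>a b. \<lbrakk>a \<in> carrier M; b \<in> carrier M\<rbrakk> \<Longrightarrow> g (a \<oplus>\<^bsub>M\<^esub> b) = g a \<oplus>\<^bsub>N\<^esub> g b"
    and f: "f \<in> J \<rightarrow> carrier M"
  shows "g (\<Oplus>\<^bsub>M\<^esub>j\<in>J. f j) = (\<Oplus>\<^bsub>N\<^esub>j\<in>J. g (f j))"
proof -
  interpret M: abelian_group M by fact
  interpret N: abelian_group N by fact
  have "g \<zero>\<^bsub>M\<^esub> \<oplus>\<^bsub>N\<^esub> g \<zero>\<^bsub>M\<^esub> = g \<zero>\<^bsub>M\<^esub>"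
    using add[of "\<zero>\<^bsub>M\<^esub>" "\<zero>\<^bsub>M\<^esub>"] by simp
  then have zero: "g \<zero>\<^bsub>M\<^esub> = \<zero>\<^bsub>N\<^esub>"
    using closed[OF M.zero_closed] N.add.r_cancel_one' by metis
  show ?thesis
    using f
  proof (induction J rule: infinite_finite_induct)
    case (insert j J)
    then have "f j \<in> carrier M" "f \<in> J \<rightarrow> carrier M" by auto
    moreover from this have "g (f j) \<in> carrier N" "(\<lambda>j. g (f j)) \<in> J \<rightarrow> carrier N"
      using closed by auto
    ultimately show ?case
      using insert by (simp add: add)
  qed (simp_all add: zero)
qed

text \<open>Membership says that a decomposition into homogeneous elements exists.  Building the sums one
  summand at a time gives inductions whose steps add one homogeneous element.\<close>

inductive_set homog_sums :: "('a, 'm, 'z) graded_module_scheme \<Rightarrow> 'm set"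
  for M :: "('a, 'm, 'z) graded_module_scheme" where
  zero: "\<zero>\<^bsub>M\<^esub> \<in> homog_sums M"
| add: "\<lbrakk>a \<in> grade M d; b \<in> homog_sums M\<rbrakk> \<Longrightarrow> a \<oplus>\<^bsub>M\<^esub> b \<in> homog_sums M"

text \<open>The multiplicative set at which the symmetric algebra is localized may contain zero when there
  are no reflections.  The localization is the zero ring then, so absence of zero divisors is
  stated in a form that holds in the zero ring as well.\<close>

locale graded_coefficients = cring R
  for R :: "('a, 'y) graded_ring_scheme" (structure) +
  assumes integral: "\<lbrakk>a \<in> carrier R; b \<in> carrier R; a \<otimes> b = \<zero>\<rbrakk> \<Longrightarrow> a = \<zero> \<or> b = \<zero>"
    and homog_carrier: "a \<in> homog R d \<Longrightarrow> a \<in> carrier R"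
    and zero_homog: "\<zero> \<in> homog R d"
    and one_homog: "\<one> \<in> homog R 0"
    and add_homog: "\<lbrakk>a \<in> homog R d; b \<in> homog R d\<rbrakk> \<Longrightarrow> a \<oplus> b \<in> homog R d"
    and neg_homog: "a \<in> homog R d \<Longrightarrow> \<ominus> a \<in> homog R d"
    and mult_homog: "\<lbrakk>a \<in> homog R d; b \<in> homog R e\<rbrakk> \<Longrightarrow> a \<otimes> b \<in> homog R (d + e)"
    and homog_decomposition: "carrier R \<subseteq> homog_sums (self_module R)"

locale graded_mod = graded_coefficients R + module R M
  for R :: "('a, 'y) graded_ring_scheme" (structure)
    and M :: "('a, 'm, 'z) graded_module_scheme" +
  assumes grade_carrier: "m \<in> grade M d \<Longrightarrow> m \<in> carrier M"
    and zero_grade: "\<zero>\<^bsub>M\<^esub> \<in> grade M d"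
    and add_grade: "\<lbrakk>m \<in> grade M d; n \<in> grade M d\<rbrakk> \<Longrightarrow> m \<oplus>\<^bsub>M\<^esub> n \<in> grade M d"
    and smult_grade: "\<lbrakk>a \<in> homog R d; m \<in> grade M e\<rbrakk> \<Longrightarrow> a \<odot>\<^bsub>M\<^esub> m \<in> grade M (d + e)"

lemma self_module_simps [simp]:
  "carrier (self_module R) = carrier R" "ring.zero (self_module R) = ring.zero R"
  "add (self_module R) = add R" "smult (self_module R) = monoid.mult R"
  "grade (self_module R) = homog R"
  by (simp_all add: self_module_def)

context graded_coefficients
begin

lemma self_graded_mod: "graded_mod R (self_module R)"
proof -
  have "abelian_group (self_module R)"
    by (rule abelian_groupI) (auto simp: a_ac intro: l_neg a_inv_closed)
  then have "module R (self_module R)"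
    by (intro moduleI) (auto simp: l_distr r_distr m_assoc is_cring)
  then show ?thesis
    by (intro graded_mod.intro graded_mod_axioms.intro graded_coefficients_axioms)
      (auto simp: zero_homog add_homog mult_homog homog_carrier)
qed

lemma homog_induct [consumes 1, case_names zero add]:
  assumes "a \<in> carrier R" and "P \<zero>"
    and step: "\<And>a b d. \<lbrakk>a \<in> homog R d; b \<in> carrier R; P b\<rbrakk> \<Longrightarrow> P (a \<oplus> b)"
  shows "P a"
proof -
  have "a \<in> homog_sums (self_module R)"
    using assms homog_decomposition by auto
  then have "a \<in> carrier R \<and> P a"
    by induction (use assms(2) step homog_carrier in auto)
  then show ?thesis ..
qed

lemma self_finsum [simp]: "finsum (self_module R) = finsum R"
  by (intro ext) (simp add: finsum_def finprod_def)

end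

lemma (in graded_mod) homog_sums_carrier: "m \<in> homog_sums M \<Longrightarrow> m \<in> carrier M"
  by (induction rule: homog_sums.induct) (use grade_carrier in auto)

lemma (in graded_mod) homog_sums_add:
  "m \<in> homog_sums M \<Longrightarrow> n \<in> homog_sums M \<Longrightarrow> m \<oplus>\<^bsub>M\<^esub> n \<in> homog_sums M"
proof (induction rule: homog_sums.induct)
  case (add a d b)
  then have "a \<in> carrier M" "b \<in> carrier M" "n \<in> carrier M"
    using grade_carrier homog_sums_carrier by auto
  then show ?case
    using add homog_sums.add[of a M d "b \<oplus>\<^bsub>M\<^esub> n"] by (simp add: M.a_assoc)
qed (simp add: homog_sums_carrier)

lemma (in graded_mod) homog_sums_finsum:
  "f \<in> J \<rightarrow> homog_sums M \<Longrightarrow> (\<Oplus>\<^bsub>M\<^esub>j\<in>J. f j) \<in> homog_sums M"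
proof (induction J rule: infinite_finite_induct)
  case (insert j J)
  then have "f j \<in> homog_sums M" "(\<Oplus>\<^bsub>M\<^esub>j\<in>J. f j) \<in> homog_sums M" by auto
  moreover have "f \<in> insert j J \<rightarrow> carrier M"
    using insert homog_sums_carrier by auto
  ultimately show ?case
    using insert homog_sums_add by (simp add: Pi_def)
qed (simp_all add: homog_sums.zero)

lemma (in graded_mod) homog_sums_smult:
  assumes "a \<in> carrier R" and "m \<in> grade M d"
  shows "a \<odot>\<^bsub>M\<^esub> m \<in> homog_sums M"
  using assms(1)
proof (induction rule: homog_induct)
  case zero
  show ?case using assms grade_carrier[of m d] by (simp add: homog_sums.zero)
next
  case (add a b e)
  moreover from this have "a \<odot>\<^bsub>M\<^esub> m \<in> grade M (e + d)"
    using assms smult_grade by simp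
  moreover have "m \<in> carrier M" "a \<in> carrier R"
    using add assms grade_carrier homog_carrier by auto
  ultimately show ?case
    by (simp add: smult_l_distr homog_sums.add)
qed

text \<open>A dual basis in the sense of the dual basis lemma, with homogeneous members: its existence says
  that the module is graded, finitely generated and projective.  The functional \<open>\<nu> j\<close> has
  degree \<open>e j\<close>, hence the generator \<open>f j\<close> has degree \<open>- e j\<close>.\<close>

definition homog_dual_basis ::
    "('a, 'y) graded_ring_scheme \<Rightarrow> ('a, 'm, 'z) graded_module_scheme \<Rightarrow> 'j set \<Rightarrow> ('j \<Rightarrow> 'm) \<Rightarrow>
     ('j \<Rightarrow> 'm \<Rightarrow> 'a) \<Rightarrow> ('j \<Rightarrow> int) \<Rightarrow> bool" where
  "homog_dual_basis R M J f \<nu> e \<longleftrightarrow> finite J \<and>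
     (\<forall>j\<in>J. f j \<in> grade M (- e j) \<and>
            \<nu> j \<in> deg_part (module_hom R M (self_module R)) M (self_module R) (e j)) \<and>
     (\<forall>m\<in>carrier M. m = (\<Oplus>\<^bsub>M\<^esub>j\<in>J. \<nu> j m \<odot>\<^bsub>M\<^esub> f j))"

locale module_with_dual_basis = graded_mod R M
  for R :: "('a, 'y) graded_ring_scheme" (structure)
    and M :: "('a, 'm, 'z) graded_module_scheme" +
  fixes J :: "'j set" and f \<nu> e
  assumes dual_basis: "homog_dual_basis R M J f \<nu> e"
begin

lemma finite_index: "finite J"
  and basis_grade: "j \<in> J \<Longrightarrow> f j \<in> grade M (- e j)"
  and functional_deg: "j \<in> J \<Longrightarrow> \<nu> j \<in> deg_part (module_hom R M (self_module R)) M (self_module R) (e j)"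
  and expand: "m \<in> carrier M \<Longrightarrow> (\<Oplus>\<^bsub>M\<^esub>j\<in>J. \<nu> j m \<odot>\<^bsub>M\<^esub> f j) = m"
  using dual_basis by (auto simp: homog_dual_basis_def)

lemma functional_hom: "j \<in> J \<Longrightarrow> \<nu> j \<in> module_hom R M (self_module R)"
  using functional_deg by (auto simp: deg_part_def)

lemma functional_closed: "j \<in> J \<Longrightarrow> m \<in> carrier M \<Longrightarrow> \<nu> j m \<in> carrier R"
  using functional_hom by (fastforce simp: module_hom_def)

lemma basis_carrier: "j \<in> J \<Longrightarrow> f j \<in> carrier M"
  using basis_grade grade_carrier by blast

lemma all_homog_sums: "m \<in> carrier M \<Longrightarrow> m \<in> homog_sums M"
  using homog_sums_finsum[of "\<lambda>j. \<nu> j m \<odot>\<^bsub>M\<^esub> f j" J]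
  by (auto simp: expand intro: homog_sums_smult functional_closed basis_grade)

lemma functionals_separate:
  assumes "m \<in> carrier M" "n \<in> carrier M" "\<And>j. j \<in> J \<Longrightarrow> \<nu> j m = \<nu> j n"
  shows "m = n"
proof -
  have "(\<Oplus>\<^bsub>M\<^esub>j\<in>J. \<nu> j m \<odot>\<^bsub>M\<^esub> f j) = (\<Oplus>\<^bsub>M\<^esub>j\<in>J. \<nu> j n \<odot>\<^bsub>M\<^esub> f j)"
    by (rule M.finsum_cong') (use assms functional_closed basis_carrier in auto)
  then show ?thesis using assms expand by simp
qed

lemma hom_expand:
  assumes "module R N" and "g \<in> module_hom R M N" and m: "m \<in> carrier M"
  shows "g m = (\<Oplus>\<^bsub>N\<^esub>j\<in>J. \<nu> j m \<odot>\<^bsub>N\<^esub> g (f j))"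
proof -
  interpret N: module R N by fact
  have g: "\<And>a. a \<in> carrier M \<Longrightarrow> g a \<in> carrier N"
    "\<And>a b. \<lbrakk>a \<in> carrier M; b \<in> carrier M\<rbrakk> \<Longrightarrow> g (a \<oplus>\<^bsub>M\<^esub> b) = g a \<oplus>\<^bsub>N\<^esub> g b"
    "\<And>r a. \<lbrakk>r \<in> carrier R; a \<in> carrier M\<rbrakk> \<Longrightarrow> g (r \<odot>\<^bsub>M\<^esub> a) = r \<odot>\<^bsub>N\<^esub> g a"
    using assms by (auto simp: module_hom_def)
  have "g m = g (\<Oplus>\<^bsub>M\<^esub>j\<in>J. \<nu> j m \<odot>\<^bsub>M\<^esub> f j)"
    using m by (simp add: expand)
  also have "\<dots> = (\<Oplus>\<^bsub>N\<^esub>j\<in>J. g (\<nu> j m \<odot>\<^bsub>M\<^esub> f j))"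
    by (rule additive_finsum)
      (use m g functional_closed basis_carrier M.abelian_group_axioms N.M.abelian_group_axioms in auto)
  also have "\<dots> = (\<Oplus>\<^bsub>N\<^esub>j\<in>J. \<nu> j m \<odot>\<^bsub>N\<^esub> g (f j))"
    by (rule N.M.finsum_cong') (use m g functional_closed basis_carrier in auto)
  finally show ?thesis .
qed

end

section \<open>Reflexivity of graded Hom modules\<close>

text \<open>Bimodule homomorphisms seen from one side: maps that are linear for one of the two actions and
  commute with a family of operators, the ring elements acting from the other side.  Exchanging
  the two actions gives the same bimodule homomorphisms with the other module structure, and an
  empty family of operators gives dual modules.\<close>

definition commuting_homs ::
    "('a, 'y) ring_scheme \<Rightarrow> ('a, 'm, 'z) module_scheme \<Rightarrow> ('a, 'n, 'u) module_scheme \<Rightarrow>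
     ('i \<Rightarrow> 'm \<Rightarrow> 'm) \<Rightarrow> ('i \<Rightarrow> 'n \<Rightarrow> 'n) \<Rightarrow> 'i set \<Rightarrow> ('m \<Rightarrow> 'n) set" where
  "commuting_homs R M N A B I =
     {\<phi> \<in> module_hom R M N. \<forall>i\<in>I. \<forall>m\<in>carrier M. \<phi> (A i m) = B i (\<phi> m)}"

text \<open>The graded Hom module is described by its components, so that one development covers the
  bimodule of homomorphisms, its right module and all graded duals.\<close>

locale hom_space = graded_coefficients R + M: graded_mod R M + N: graded_mod R N
  for R :: "('a, 'y) graded_ring_scheme" (structure)
    and M :: "('a, 'm, 'z) graded_module_scheme"
    and N :: "('a, 'n, 'u) graded_module_scheme"
    and A :: "'i \<Rightarrow> 'm \<Rightarrow> 'm" and B :: "'i \<Rightarrow> 'n \<Rightarrow> 'n" and I :: "'i set"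
    and H :: "('a, 'm \<Rightarrow> 'n, 'v) graded_module_scheme" +
  assumes A_closed: "\<lbrakk>i \<in> I; m \<in> carrier M\<rbrakk> \<Longrightarrow> A i m \<in> carrier M"
    and B_closed: "\<lbrakk>i \<in> I; n \<in> carrier N\<rbrakk> \<Longrightarrow> B i n \<in> carrier N"
    and B_add: "\<lbrakk>i \<in> I; n \<in> carrier N; n' \<in> carrier N\<rbrakk> \<Longrightarrow> B i (n \<oplus>\<^bsub>N\<^esub> n') = B i n \<oplus>\<^bsub>N\<^esub> B i n'"
    and B_smult: "\<lbrakk>i \<in> I; r \<in> carrier R; n \<in> carrier N\<rbrakk> \<Longrightarrow> B i (r \<odot>\<^bsub>N\<^esub> n) = r \<odot>\<^bsub>N\<^esub> B i n"
    and H_carrier: "carrier H = deg_sum (commuting_homs R M N A B I) M N"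
    and H_zero: "\<zero>\<^bsub>H\<^esub> = (\<lambda>m\<in>carrier M. \<zero>\<^bsub>N\<^esub>)"
    and H_add: "\<phi> \<oplus>\<^bsub>H\<^esub> \<psi> = (\<lambda>m\<in>carrier M. \<phi> m \<oplus>\<^bsub>N\<^esub> \<psi> m)"
    and H_smult: "r \<odot>\<^bsub>H\<^esub> \<phi> = (\<lambda>m\<in>carrier M. r \<odot>\<^bsub>N\<^esub> \<phi> m)"
    and H_grade: "grade H d = deg_part (commuting_homs R M N A B I) M N d"
begin

abbreviation "homs \<equiv> commuting_homs R M N A B I"

lemma homs_iff:
  "\<phi> \<in> homs \<longleftrightarrow> \<phi> \<in> extensional (carrier M) \<and> (\<forall>m\<in>carrier M. \<phi> m \<in> carrier N) \<and>
    (\<forall>m\<in>carrier M. \<forall>n\<in>carrier M. \<phi> (m \<oplus>\<^bsub>M\<^esub> n) = \<phi> m \<oplus>\<^bsub>N\<^esub> \<phi> n) \<and>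
    (\<forall>r\<in>carrier R. \<forall>m\<in>carrier M. \<phi> (r \<odot>\<^bsub>M\<^esub> m) = r \<odot>\<^bsub>N\<^esub> \<phi> m) \<and>
    (\<forall>i\<in>I. \<forall>m\<in>carrier M. \<phi> (A i m) = B i (\<phi> m))"
  by (auto simp: commuting_homs_def module_hom_def PiE_def)

lemma B_zero: "i \<in> I \<Longrightarrow> B i \<zero>\<^bsub>N\<^esub> = \<zero>\<^bsub>N\<^esub>"
  using B_smult[of i \<zero> "\<zero>\<^bsub>N\<^esub>"] B_closed[of i "\<zero>\<^bsub>N\<^esub>"] by simp

lemma H_eval [simp]:
  assumes "m \<in> carrier M"
  shows "\<zero>\<^bsub>H\<^esub> m = \<zero>\<^bsub>N\<^esub>" "(\<phi> \<oplus>\<^bsub>H\<^esub> \<psi>) m = \<phi> m \<oplus>\<^bsub>N\<^esub> \<psi> m" "(r \<odot>\<^bsub>H\<^esub> \<phi>) m = r \<odot>\<^bsub>N\<^esub> \<phi> m"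
  using assms by (simp_all add: H_zero H_add H_smult)

lemma homs_zero: "\<zero>\<^bsub>H\<^esub> \<in> homs"
  by (auto simp: homs_iff A_closed B_zero) (simp add: H_zero)

lemma homs_add: "\<lbrakk>\<phi> \<in> homs; \<psi> \<in> homs\<rbrakk> \<Longrightarrow> \<phi> \<oplus>\<^bsub>H\<^esub> \<psi> \<in> homs"
  by (auto simp: homs_iff A_closed B_add N.M.a_ac N.smult_r_distr) (simp add: H_add)

lemma homs_smult: "\<lbrakk>r \<in> carrier R; \<phi> \<in> homs\<rbrakk> \<Longrightarrow> r \<odot>\<^bsub>H\<^esub> \<phi> \<in> homs"
  by (auto simp: homs_iff A_closed B_smult N.smult_r_distr N.smult_assoc1[symmetric] m_comm)
    (simp add: H_smult)

lemma part_iff: "\<phi> \<in> grade H d \<longleftrightarrow> \<phi> \<in> homs \<and> (\<forall>i. \<forall>m\<in>grade M i. \<phi> m \<in> grade N (i + d))"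
  by (auto simp: H_grade deg_part_def)

lemma part_zero: "\<zero>\<^bsub>H\<^esub> \<in> grade H d"
  by (auto simp: part_iff homs_zero N.zero_grade dest: M.grade_carrier)

lemma part_add: "\<lbrakk>\<phi> \<in> grade H d; \<psi> \<in> grade H d\<rbrakk> \<Longrightarrow> \<phi> \<oplus>\<^bsub>H\<^esub> \<psi> \<in> grade H d"
  using M.grade_carrier by (fastforce simp: part_iff homs_add N.add_grade)

lemma part_smult:
  assumes "r \<in> homog R e" "\<phi> \<in> grade H d"
  shows "r \<odot>\<^bsub>H\<^esub> \<phi> \<in> grade H (e + d)"
proof -
  have "r \<odot>\<^bsub>N\<^esub> \<phi> m \<in> grade N (i + (e + d))" if "m \<in> grade M i" for i m
  proof -
    have "\<phi> m \<in> grade N (i + d)"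
      using that assms(2) by (auto simp: part_iff)
    then have "r \<odot>\<^bsub>N\<^esub> \<phi> m \<in> grade N (e + (i + d))"
      using N.smult_grade assms(1) by blast
    then show ?thesis by (simp add: ac_simps)
  qed
  then show ?thesis
    using assms by (auto simp: part_iff homs_smult homog_carrier M.grade_carrier)
qed

lemma H_iff:
  "\<phi> \<in> carrier H \<longleftrightarrow> (\<exists>D f. finite D \<and> (\<forall>d\<in>D. f d \<in> grade H d) \<and>
     \<phi> = (\<lambda>m\<in>carrier M. \<Oplus>\<^bsub>N\<^esub>d\<in>D. f d m))"
  by (auto simp: H_carrier deg_sum_def H_grade)

lemma H_zero_closed: "\<zero>\<^bsub>H\<^esub> \<in> carrier H"
  unfolding H_iff by (rule exI[of _ "{}"]) (simp add: H_zero)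

lemma homs_value: "\<phi> \<in> homs \<Longrightarrow> m \<in> carrier M \<Longrightarrow> \<phi> m \<in> carrier N"
  by (simp add: homs_iff)

lemma H_add_part_closed:
  assumes "g \<in> grade H d" "\<phi> \<in> carrier H"
  shows "g \<oplus>\<^bsub>H\<^esub> \<phi> \<in> carrier H"
proof -
  obtain D f where D: "finite D" "\<And>d. d \<in> D \<Longrightarrow> f d \<in> grade H d"
    and \<phi>: "\<phi> = (\<lambda>m\<in>carrier M. \<Oplus>\<^bsub>N\<^esub>d\<in>D. f d m)"
    using assms(2) unfolding H_iff by blast
  have val: "\<And>d m. d \<in> D \<Longrightarrow> m \<in> carrier M \<Longrightarrow> f d m \<in> carrier N" "\<And>m. m \<in> carrier M \<Longrightarrow> g m \<in> carrier N"
    using D assms(1) homs_value by (auto simp: part_iff)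
  \<comment> \<open>\<open>g\<close> is merged with the summand of the same degree, if there is one.\<close>
  define f' where "f' = (\<lambda>e. if e = d then g \<oplus>\<^bsub>H\<^esub> (if d \<in> D then f d else \<zero>\<^bsub>H\<^esub>) else f e)"
  have f': "f' e \<in> grade H e" if "e \<in> insert d D" for e
    using that D(2) assms(1) by (auto simp: f'_def part_add part_zero)
  have "g m \<oplus>\<^bsub>N\<^esub> (\<Oplus>\<^bsub>N\<^esub>e\<in>D. f e m) = (\<Oplus>\<^bsub>N\<^esub>e\<in>insert d D. f' e m)" if m: "m \<in> carrier M" for m
  proof -
    have rest: "(\<Oplus>\<^bsub>N\<^esub>e\<in>D - {d}. f' e m) = (\<Oplus>\<^bsub>N\<^esub>e\<in>D - {d}. f e m)"
      by (rule N.M.finsum_cong') (use val m in \<open>auto simp: f'_def\<close>)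
    have f'd: "f' d m = g m \<oplus>\<^bsub>N\<^esub> (if d \<in> D then f d m else \<zero>\<^bsub>N\<^esub>)"
      using m by (simp add: f'_def)
    have "(\<Oplus>\<^bsub>N\<^esub>e\<in>insert d D. f' e m) = f' d m \<oplus>\<^bsub>N\<^esub> (\<Oplus>\<^bsub>N\<^esub>e\<in>D - {d}. f' e m)"
      using D(1) f' m homs_value N.M.finsum_insert[of "D - {d}" d "\<lambda>e. f' e m"]
      by (auto simp: part_iff)
    also have "\<dots> = g m \<oplus>\<^bsub>N\<^esub> (\<Oplus>\<^bsub>N\<^esub>e\<in>D. f e m)"
    proof (cases "d \<in> D")
      case True
      then have "(\<Oplus>\<^bsub>N\<^esub>e\<in>D. f e m) = f d m \<oplus>\<^bsub>N\<^esub> (\<Oplus>\<^bsub>N\<^esub>e\<in>D - {d}. f e m)"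
        using D(1) val m N.M.finsum_insert[of "D - {d}" d "\<lambda>e. f e m"] by (auto simp: insert_absorb)
      then show ?thesis
        using True val m by (simp add: f'd rest N.M.a_assoc Pi_def)
    next
      case False
      then show ?thesis
        using val m rest by (simp add: f'd)
    qed
    finally show ?thesis by simp
  qed
  then have "g \<oplus>\<^bsub>H\<^esub> \<phi> = (\<lambda>m\<in>carrier M. \<Oplus>\<^bsub>N\<^esub>e\<in>insert d D. f' e m)"
    by (auto simp: H_add \<phi>)
  then show ?thesis
    unfolding H_iff using f' D(1) by (intro exI[of _ "insert d D"] exI[of _ f']) auto
qed

lemma H_induct [consumes 1, case_names zero add]:
  assumes "\<phi> \<in> carrier H" and "P \<zero>\<^bsub>H\<^esub>"
    and step: "\<And>g \<psi> d. \<lbrakk>g \<in> grade H d; \<psi> \<in> carrier H; P \<psi>\<rbrakk> \<Longrightarrow> P (g \<oplus>\<^bsub>H\<^esub> \<psi>)"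
  shows "P \<phi>"
proof -
  obtain D f where D: "finite D" "\<forall>d\<in>D. f d \<in> grade H d"
    and \<phi>: "\<phi> = (\<lambda>m\<in>carrier M. \<Oplus>\<^bsub>N\<^esub>d\<in>D. f d m)"
    using assms(1) unfolding H_iff by blast
  have "P (\<lambda>m\<in>carrier M. \<Oplus>\<^bsub>N\<^esub>d\<in>D. f d m)"
    using D
  proof (induction D)
    case empty
    then show ?case using assms(2) by (simp add: H_zero restrict_def)
  next
    case (insert d D)
    then have "(\<lambda>m\<in>carrier M. \<Oplus>\<^bsub>N\<^esub>d\<in>D. f d m) \<in> carrier H"
      unfolding H_iff by blast
    moreover have "(\<lambda>m\<in>carrier M. \<Oplus>\<^bsub>N\<^esub>d\<in>insert d D. f d m)
        = f d \<oplus>\<^bsub>H\<^esub> (\<lambda>m\<in>carrier M. \<Oplus>\<^bsub>N\<^esub>d\<in>D. f d m)"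
      unfolding H_add using insert homs_value
      by (intro restrict_ext) (auto simp: part_iff)
    moreover have "P (\<lambda>m\<in>carrier M. \<Oplus>\<^bsub>N\<^esub>d\<in>D. f d m)"
      using insert by blast
    ultimately show ?case
      using step[of "f d" d] insert.prems by (metis insertI1)
  qed
  then show ?thesis by (simp add: \<phi>)
qed

lemma H_homs: "\<phi> \<in> carrier H \<Longrightarrow> \<phi> \<in> homs"
  by (induction rule: H_induct) (auto simp: homs_zero homs_add part_iff)

lemma H_value: "\<phi> \<in> carrier H \<Longrightarrow> m \<in> carrier M \<Longrightarrow> \<phi> m \<in> carrier N"
  using H_homs homs_value by blast

lemma H_eqI:
  assumes "\<phi> \<in> extensional (carrier M)" "\<psi> \<in> extensional (carrier M)"
    and "\<And>m. m \<in> carrier M \<Longrightarrow> \<phi> m = \<psi> m"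
  shows "\<phi> = \<psi>"
  using assms by (rule extensionalityI)

lemma H_extensional [simp]:
  "\<zero>\<^bsub>H\<^esub> \<in> extensional (carrier M)" "\<phi> \<oplus>\<^bsub>H\<^esub> \<psi> \<in> extensional (carrier M)"
  "r \<odot>\<^bsub>H\<^esub> \<phi> \<in> extensional (carrier M)" "\<psi> \<in> carrier H \<Longrightarrow> \<psi> \<in> extensional (carrier M)"
  using H_homs by (auto simp: H_zero H_add H_smult homs_iff)

lemma part_H: "g \<in> grade H d \<Longrightarrow> g \<in> carrier H"
proof -
  assume g: "g \<in> grade H d"
  then have "g \<oplus>\<^bsub>H\<^esub> \<zero>\<^bsub>H\<^esub> = g"
    by (intro H_eqI) (auto simp: part_iff homs_iff)
  then show ?thesis
    using H_add_part_closed[OF g H_zero_closed] by simp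
qed

lemma H_add_closed: "\<lbrakk>\<phi> \<in> carrier H; \<psi> \<in> carrier H\<rbrakk> \<Longrightarrow> \<phi> \<oplus>\<^bsub>H\<^esub> \<psi> \<in> carrier H"
proof (induction rule: H_induct)
  case zero
  then have "\<zero>\<^bsub>H\<^esub> \<oplus>\<^bsub>H\<^esub> \<psi> = \<psi>"
    by (intro H_eqI) (auto simp: H_value)
  then show ?case using zero by simp
next
  case (add g \<phi> d)
  then have "g \<oplus>\<^bsub>H\<^esub> \<phi> \<oplus>\<^bsub>H\<^esub> \<psi> = g \<oplus>\<^bsub>H\<^esub> (\<phi> \<oplus>\<^bsub>H\<^esub> \<psi>)"
    by (intro H_eqI) (auto simp: N.M.a_assoc H_value part_H)
  then show ?case using add H_add_part_closed by simp
qed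

lemma H_smult_closed:
  assumes "r \<in> carrier R" "\<phi> \<in> carrier H"
  shows "r \<odot>\<^bsub>H\<^esub> \<phi> \<in> carrier H"
  using assms(2)
proof (induction rule: H_induct)
  case zero
  have "r \<odot>\<^bsub>H\<^esub> \<zero>\<^bsub>H\<^esub> = \<zero>\<^bsub>H\<^esub>"
    by (intro H_eqI) (auto simp: assms)
  then show ?case by (simp add: H_zero_closed)
next
  case (add g \<phi> d)
  have "r \<odot>\<^bsub>H\<^esub> g \<in> carrier H"
    using assms(1)
  proof (induction rule: homog_induct)
    case zero
    have "\<zero> \<odot>\<^bsub>H\<^esub> g = \<zero>\<^bsub>H\<^esub>"
      by (intro H_eqI) (use add H_value part_H in auto)
    then show ?case by (simp add: H_zero_closed)
  next
    case (add a b e)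
    have "(a \<oplus> b) \<odot>\<^bsub>H\<^esub> g = a \<odot>\<^bsub>H\<^esub> g \<oplus>\<^bsub>H\<^esub> b \<odot>\<^bsub>H\<^esub> g"
      by (intro H_eqI) (use add \<open>g \<in> grade H d\<close> H_value part_H homog_carrier N.smult_l_distr in auto)
    then show ?case
      using add H_add_closed[OF part_H[OF part_smult[OF _ \<open>g \<in> grade H d\<close>]]] by simp
  qed
  moreover have "r \<odot>\<^bsub>H\<^esub> (g \<oplus>\<^bsub>H\<^esub> \<phi>) = r \<odot>\<^bsub>H\<^esub> g \<oplus>\<^bsub>H\<^esub> r \<odot>\<^bsub>H\<^esub> \<phi>"
    by (intro H_eqI) (use add assms H_value part_H N.smult_r_distr in auto)
  ultimately show ?case
    using add H_add_closed by simp
qed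

lemma H_graded_mod: "graded_mod R H"
proof -
  have "abelian_group H"
  proof (rule abelian_groupI)
    \<comment> \<open>Negatives are multiples by \<open>-1\<close>, so closure under scalars yields them.\<close>
    show "\<exists>\<psi>\<in>carrier H. \<psi> \<oplus>\<^bsub>H\<^esub> \<phi> = \<zero>\<^bsub>H\<^esub>" if \<phi>: "\<phi> \<in> carrier H" for \<phi>
    proof
      show "(\<ominus> \<one>) \<odot>\<^bsub>H\<^esub> \<phi> \<in> carrier H" using \<phi> H_smult_closed by simp
      show "(\<ominus> \<one>) \<odot>\<^bsub>H\<^esub> \<phi> \<oplus>\<^bsub>H\<^esub> \<phi> = \<zero>\<^bsub>H\<^esub>"
        by (intro H_eqI) (use \<phi> H_value N.smult_l_minus N.M.l_neg in auto)
    qed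
    show "\<phi> \<oplus>\<^bsub>H\<^esub> \<psi> \<oplus>\<^bsub>H\<^esub> \<chi> = \<phi> \<oplus>\<^bsub>H\<^esub> (\<psi> \<oplus>\<^bsub>H\<^esub> \<chi>)"
      if "\<phi> \<in> carrier H" "\<psi> \<in> carrier H" "\<chi> \<in> carrier H" for \<phi> \<psi> \<chi>
      by (intro H_eqI) (use that H_value in \<open>auto simp: N.M.a_assoc\<close>)
    show "\<phi> \<oplus>\<^bsub>H\<^esub> \<psi> = \<psi> \<oplus>\<^bsub>H\<^esub> \<phi>" if "\<phi> \<in> carrier H" "\<psi> \<in> carrier H" for \<phi> \<psi>
      by (intro H_eqI) (use that H_value in \<open>auto simp: N.M.a_comm\<close>)
    show "\<zero>\<^bsub>H\<^esub> \<oplus>\<^bsub>H\<^esub> \<phi> = \<phi>" if "\<phi> \<in> carrier H" for \<phi>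
      by (intro H_eqI) (use that H_value in auto)
  qed (auto simp: H_add_closed H_zero_closed)
  then have "module R H"
  proof (rule moduleI[OF is_cring])
    show "(a \<oplus> b) \<odot>\<^bsub>H\<^esub> \<phi> = a \<odot>\<^bsub>H\<^esub> \<phi> \<oplus>\<^bsub>H\<^esub> b \<odot>\<^bsub>H\<^esub> \<phi>"
      if "a \<in> carrier R" "b \<in> carrier R" "\<phi> \<in> carrier H" for a b \<phi>
      by (intro H_eqI) (use that H_value N.smult_l_distr in auto)
    show "a \<odot>\<^bsub>H\<^esub> (\<phi> \<oplus>\<^bsub>H\<^esub> \<psi>) = a \<odot>\<^bsub>H\<^esub> \<phi> \<oplus>\<^bsub>H\<^esub> a \<odot>\<^bsub>H\<^esub> \<psi>"
      if "a \<in> carrier R" "\<phi> \<in> carrier H" "\<psi> \<in> carrier H" for a \<phi> \<psi>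
      by (intro H_eqI) (use that H_value N.smult_r_distr in auto)
    show "a \<otimes> b \<odot>\<^bsub>H\<^esub> \<phi> = a \<odot>\<^bsub>H\<^esub> (b \<odot>\<^bsub>H\<^esub> \<phi>)"
      if "a \<in> carrier R" "b \<in> carrier R" "\<phi> \<in> carrier H" for a b \<phi>
      by (intro H_eqI) (use that H_value N.smult_assoc1 in auto)
    show "\<one> \<odot>\<^bsub>H\<^esub> \<phi> = \<phi>" if "\<phi> \<in> carrier H" for \<phi>
      by (intro H_eqI) (use that H_value in auto)
  qed (auto simp: H_smult_closed)
  then show ?thesis
    by (intro graded_mod.intro graded_mod_axioms.intro graded_coefficients_axioms)
      (auto simp: part_zero part_add part_smult dest: part_H)
qed

lemma H_finsum_eval:
  assumes "f \<in> J \<rightarrow> carrier H" "m \<in> carrier M"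
  shows "(\<Oplus>\<^bsub>H\<^esub>j\<in>J. f j) m = (\<Oplus>\<^bsub>N\<^esub>j\<in>J. f j m)"
proof -
  interpret H: graded_mod R H by (rule H_graded_mod)
  show ?thesis
    by (rule additive_finsum[where g = "\<lambda>\<phi>. \<phi> m"])
      (use assms H_value H.M.abelian_group_axioms N.M.abelian_group_axioms in auto)
qed

end

lemma (in graded_mod) dual_hom_space:
  "hom_space R M (self_module R) (\<lambda>_ :: unit. id) (\<lambda>_. id) {} (dual R M)"
proof -
  interpret S: graded_mod R "self_module R" by (rule self_graded_mod)
  show ?thesis
    by unfold_locales (simp_all add: dual_def commuting_homs_def)
qed

lemma module_hom_self_iff:
  "\<phi> \<in> module_hom R M (self_module R) \<longleftrightarrow> \<phi> \<in> extensional (carrier M) \<and>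
    (\<forall>m\<in>carrier M. \<phi> m \<in> carrier R) \<and>
    (\<forall>m\<in>carrier M. \<forall>n\<in>carrier M. \<phi> (m \<oplus>\<^bsub>M\<^esub> n) = \<phi> m \<oplus>\<^bsub>R\<^esub> \<phi> n) \<and>
    (\<forall>r\<in>carrier R. \<forall>m\<in>carrier M. \<phi> (r \<odot>\<^bsub>M\<^esub> m) = r \<otimes>\<^bsub>R\<^esub> \<phi> m)"
  by (auto simp: module_hom_def PiE_def)

lemma (in graded_mod) grade_finsum:
  "(\<And>j. j \<in> J \<Longrightarrow> f j \<in> grade M d) \<Longrightarrow> (\<Oplus>\<^bsub>M\<^esub>j\<in>J. f j) \<in> grade M d"
proof (induction J rule: infinite_finite_induct)
  case (insert j J)
  then have "f j \<in> carrier M" "f \<in> J \<rightarrow> carrier M" "(\<Oplus>\<^bsub>M\<^esub>j\<in>J. f j) \<in> grade M d"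
    using grade_carrier by blast+
  then show ?case
    using insert by (simp add: add_grade)
qed (simp_all add: zero_grade)

context graded_coefficients
begin

text \<open>Linear forms need not be extensional, in contrast to the members of \<^const>\<open>module_hom\<close>;
  this allows to combine them pointwise.\<close>

definition linear_form :: "('a, 'h, 'z) module_scheme \<Rightarrow> ('h \<Rightarrow> 'a) \<Rightarrow> bool" where
  "linear_form H l \<longleftrightarrow> (\<forall>h\<in>carrier H. l h \<in> carrier R) \<and>
    (\<forall>h\<in>carrier H. \<forall>k\<in>carrier H. l (h \<oplus>\<^bsub>H\<^esub> k) = l h \<oplus> l k) \<and>
    (\<forall>r\<in>carrier R. \<forall>h\<in>carrier H. l (r \<odot>\<^bsub>H\<^esub> h) = r \<otimes> l h)"

lemma diff_zero_imp_eq: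
  assumes "x \<ominus> y = \<zero>" "x \<in> carrier R" "y \<in> carrier R"
  shows "x = y"
proof -
  have "x = (x \<ominus> y) \<oplus> y"
    using assms(2,3) by algebra
  then show ?thesis using assms by simp
qed

text \<open>Over the fraction field this is the fact that a functional which vanishes on the common kernel
  of finitely many functionals is a linear combination of them; \<open>r\<close> clears the denominators.
  In the inductive step, if \<open>l\<close> does not vanish on the common kernel of the \<open>\<mu> j\<close> with
  \<open>j \<in> J\<close>, it is nonzero at some \<open>h0\<close> of this kernel, and so is \<open>\<mu> k\<close>.  Then
  \<open>\<mu> k h0 \<cdot> l - l h0 \<cdot> \<mu> k\<close> does vanish on this kernel: subtract from \<open>\<mu> k h0 \<cdot> h\<close> the
  multiple \<open>\<mu> k h \<cdot> h0\<close>, which makes \<open>\<mu> k\<close> vanish too.\<close>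

lemma rational_dependence:
  assumes H: "module R H" and nontrivial: "\<one> \<noteq> \<zero>" and "finite J"
    and "\<And>j. j \<in> J \<Longrightarrow> linear_form H (\<mu> j)" and "linear_form H l"
    and "\<And>h. \<lbrakk>h \<in> carrier H; \<And>j. j \<in> J \<Longrightarrow> \<mu> j h = \<zero>\<rbrakk> \<Longrightarrow> l h = \<zero>"
  shows "\<exists>r\<in>carrier R. r \<noteq> \<zero> \<and> (\<exists>c\<in>J \<rightarrow> carrier R. \<forall>h\<in>carrier H. r \<otimes> l h = (\<Oplus>j\<in>J. c j \<otimes> \<mu> j h))"
  using assms(3-)
proof (induction J arbitrary: l)
  case empty
  then show ?case
    using nontrivial by (intro bexI[of _ \<one>]) auto
next
  case (insert k J)
  interpret H: module R H by fact
  have \<mu>: "\<mu> j h \<in> carrier R" if "j \<in> insert k J" "h \<in> carrier H" for j h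
    using insert.prems(1) that by (auto simp: linear_form_def)
  show ?case
  proof (cases "\<forall>h\<in>carrier H. (\<forall>j\<in>J. \<mu> j h = \<zero>) \<longrightarrow> l h = \<zero>")
    case True
    have "\<exists>r\<in>carrier R. r \<noteq> \<zero> \<and>
        (\<exists>c\<in>J \<rightarrow> carrier R. \<forall>h\<in>carrier H. r \<otimes> l h = (\<Oplus>j\<in>J. c j \<otimes> \<mu> j h))"
      by (rule insert.IH) (use insert.prems True in auto)
    then obtain r c where r: "r \<in> carrier R" "r \<noteq> \<zero>" and c: "c \<in> J \<rightarrow> carrier R"
      and eq: "\<And>h. h \<in> carrier H \<Longrightarrow> r \<otimes> l h = (\<Oplus>j\<in>J. c j \<otimes> \<mu> j h)"
      by blast
    have "r \<otimes> l h = (\<Oplus>j\<in>insert k J. (c(k := \<zero>)) j \<otimes> \<mu> j h)" if h: "h \<in> carrier H" for h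
    proof -
      have "(\<Oplus>j\<in>J. (c(k := \<zero>)) j \<otimes> \<mu> j h) = (\<Oplus>j\<in>J. c j \<otimes> \<mu> j h)"
        by (rule finsum_cong') (use c \<mu> h insert.hyps in auto)
      then show ?thesis
        using eq[OF h] c \<mu> h insert.hyps by (simp add: Pi_def)
    qed
    then show ?thesis
      using r c by (intro bexI[of _ r] conjI bexI[of _ "c(k := \<zero>)"]) auto
  next
    case False
    then obtain h0 where h0: "h0 \<in> carrier H" "\<And>j. j \<in> J \<Longrightarrow> \<mu> j h0 = \<zero>" "l h0 \<noteq> \<zero>"
      by auto
    have lin: "l h \<in> carrier R" "\<And>h'. h' \<in> carrier H \<Longrightarrow> l (h \<oplus>\<^bsub>H\<^esub> h') = l h \<oplus> l h'"
      "\<And>r. r \<in> carrier R \<Longrightarrow> l (r \<odot>\<^bsub>H\<^esub> h) = r \<otimes> l h" if "h \<in> carrier H" for h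
      using insert.prems(2) that by (auto simp: linear_form_def)
    have \<mu>_lin: "\<And>h'. h' \<in> carrier H \<Longrightarrow> \<mu> j (h \<oplus>\<^bsub>H\<^esub> h') = \<mu> j h \<oplus> \<mu> j h'"
      "\<And>r. r \<in> carrier R \<Longrightarrow> \<mu> j (r \<odot>\<^bsub>H\<^esub> h) = r \<otimes> \<mu> j h"
      if "j \<in> insert k J" "h \<in> carrier H" for j h
      using insert.prems(1) that by (auto simp: linear_form_def)
    define s where "s = \<mu> k h0"
    define t where "t = l h0"
    have s: "s \<in> carrier R" and t: "t \<in> carrier R"
      using \<mu> h0 lin by (auto simp: s_def t_def)
    have "s \<noteq> \<zero>"
      using insert.prems(3)[OF h0(1)] h0 by (auto simp: s_def)
    define l' where "l' = (\<lambda>h. s \<otimes> l h \<ominus> t \<otimes> \<mu> k h)"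
    have l': "linear_form H l'"
      unfolding linear_form_def
    proof (intro conjI ballI)
      fix h assume h: "h \<in> carrier H"
      note closed = s t lin(1)[OF h] \<mu>[OF insertI1 h]
      show "l' h \<in> carrier R"
        using closed by (simp add: l'_def)
      show "l' (h \<oplus>\<^bsub>H\<^esub> h') = l' h \<oplus> l' h'" if h': "h' \<in> carrier H" for h'
      proof -
        have "s \<otimes> (l h \<oplus> l h') \<ominus> t \<otimes> (\<mu> k h \<oplus> \<mu> k h')
            = s \<otimes> l h \<ominus> t \<otimes> \<mu> k h \<oplus> (s \<otimes> l h' \<ominus> t \<otimes> \<mu> k h')"
          using closed lin(1)[OF h'] \<mu>[OF insertI1 h'] by algebra
        then show ?thesis using h h' by (simp add: l'_def lin \<mu>_lin)
      qed
    next
      fix r h assume r: "r \<in> carrier R" and h: "h \<in> carrier H"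
      have "s \<otimes> (r \<otimes> l h) \<ominus> t \<otimes> (r \<otimes> \<mu> k h) = r \<otimes> (s \<otimes> l h \<ominus> t \<otimes> \<mu> k h)"
        using s t r lin(1)[OF h] \<mu>[OF insertI1 h] by algebra
      then show "l' (r \<odot>\<^bsub>H\<^esub> h) = r \<otimes> l' h" using h r by (simp add: l'_def lin \<mu>_lin)
    qed
    have l'_zero: "l' h = \<zero>" if h: "h \<in> carrier H" and zero: "\<And>j. j \<in> J \<Longrightarrow> \<mu> j h = \<zero>" for h
    proof -
      have "l (s \<odot>\<^bsub>H\<^esub> h \<oplus>\<^bsub>H\<^esub> (\<ominus> \<mu> k h) \<odot>\<^bsub>H\<^esub> h0) = \<zero>"
      proof (rule insert.prems(3))
        fix j assume j: "j \<in> insert k J"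
        show "\<mu> j (s \<odot>\<^bsub>H\<^esub> h \<oplus>\<^bsub>H\<^esub> (\<ominus> \<mu> k h) \<odot>\<^bsub>H\<^esub> h0) = \<zero>"
        proof (cases "j = k")
          case True
          have "s \<otimes> \<mu> k h \<oplus> (\<ominus> \<mu> k h) \<otimes> s = \<zero>"
            using s \<mu>[OF insertI1 h] by algebra
          then show ?thesis
            using True h h0(1) s \<mu> by (simp add: \<mu>_lin s_def)
        next
          case False
          then show ?thesis
            using j h h0 s \<mu> zero by (simp add: \<mu>_lin)
        qed
      qed (use h h0 s \<mu> in auto)
      then have "s \<otimes> l h \<oplus> (\<ominus> \<mu> k h) \<otimes> t = \<zero>"
        using h h0(1) s \<mu> by (simp add: lin t_def)
      moreover have "s \<otimes> l h \<ominus> t \<otimes> \<mu> k h = s \<otimes> l h \<oplus> (\<ominus> \<mu> k h) \<otimes> t"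
        using s t lin(1)[OF h] \<mu>[OF insertI1 h] by algebra
      ultimately show ?thesis by (simp add: l'_def)
    qed
    have "\<exists>r\<in>carrier R. r \<noteq> \<zero> \<and>
        (\<exists>c\<in>J \<rightarrow> carrier R. \<forall>h\<in>carrier H. r \<otimes> l' h = (\<Oplus>j\<in>J. c j \<otimes> \<mu> j h))"
      by (rule insert.IH[OF _ l' l'_zero]) (use insert.prems(1) in auto)
    then obtain r c where r: "r \<in> carrier R" "r \<noteq> \<zero>" and c: "c \<in> J \<rightarrow> carrier R"
      and eq: "\<And>h. h \<in> carrier H \<Longrightarrow> r \<otimes> l' h = (\<Oplus>j\<in>J. c j \<otimes> \<mu> j h)"
      by blast
    have "(r \<otimes> s) \<otimes> l h = (\<Oplus>j\<in>insert k J. (c(k := r \<otimes> t)) j \<otimes> \<mu> j h)" if h: "h \<in> carrier H" for h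
    proof -
      have "(\<Oplus>j\<in>J. (c(k := r \<otimes> t)) j \<otimes> \<mu> j h) = (\<Oplus>j\<in>J. c j \<otimes> \<mu> j h)"
        by (rule finsum_cong') (use c \<mu> h insert.hyps in auto)
      then have "(\<Oplus>j\<in>insert k J. (c(k := r \<otimes> t)) j \<otimes> \<mu> j h) = r \<otimes> t \<otimes> \<mu> k h \<oplus> r \<otimes> l' h"
        using eq[OF h] c \<mu> h r t insert.hyps by (simp add: Pi_def)
      also have "\<dots> = (r \<otimes> s) \<otimes> l h"
        using r s t h lin(1)[OF h] \<mu>[OF insertI1 h] unfolding l'_def by algebra
      finally show ?thesis by simp
    qed
    moreover have "r \<otimes> s \<noteq> \<zero>"
      using integral r s \<open>s \<noteq> \<zero>\<close> by blast
    ultimately show ?thesis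
      using r c s t by (intro bexI[of _ "r \<otimes> s"] conjI bexI[of _ "c(k := r \<otimes> t)"]) auto
  qed
qed

end

text \<open>Under these hypotheses evaluation is inverted explicitly.  An element \<open>\<xi>\<close> of the double dual
  of \<open>H\<close> is applied to the matrix coefficients \<open>\<phi> \<mapsto> l (\<phi> m)\<close>; for fixed \<open>m\<close> this is a
  functional of \<open>l\<close>, and since \<open>N\<close> is finitely generated and projective it is evaluation at an
  element of \<open>N\<close>, the value at \<open>m\<close> of the homomorphism that corresponds to \<open>\<xi>\<close>.\<close>

locale hom_space_dual_bases = hom_space R M N A B I H +
    M: module_with_dual_basis R M J a \<alpha> p + N: module_with_dual_basis R N K b \<beta> q
  for R :: "('a, 'y) graded_ring_scheme" (structure)
    and M :: "('a, 'm, 'z) graded_module_scheme"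
    and N :: "('a, 'n, 'u) graded_module_scheme"
    and A :: "'i \<Rightarrow> 'm \<Rightarrow> 'm" and B :: "'i \<Rightarrow> 'n \<Rightarrow> 'n" and I :: "'i set"
    and H :: "('a, 'm \<Rightarrow> 'n, 'v) graded_module_scheme"
    and J :: "'j set" and a \<alpha> p and K :: "'k set" and b \<beta> q
begin

sublocale H: graded_mod R H by (rule H_graded_mod)

sublocale D: hom_space R H "self_module R" "\<lambda>_ :: unit. id" "\<lambda>_. id" "{}" "dual R H"
  by (rule H.dual_hom_space)

sublocale D: graded_mod R "dual R H" by (rule D.H_graded_mod)

sublocale DD: hom_space R "dual R H" "self_module R" "\<lambda>_ :: unit. id" "\<lambda>_. id" "{}" "dual R (dual R H)"
  by (rule D.dual_hom_space)

sublocale DD: graded_mod R "dual R (dual R H)" by (rule DD.H_graded_mod)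

text \<open>The matrix coefficients of the homomorphisms in \<open>H\<close>.\<close>

definition pairing :: "'m \<Rightarrow> ('n \<Rightarrow> 'a) \<Rightarrow> ('m \<Rightarrow> 'n) \<Rightarrow> 'a" where
  "pairing m l = (\<lambda>\<phi>\<in>carrier H. l (\<phi> m))"

lemma dual_props:
  assumes "l \<in> carrier (dual R H)"
  shows "\<phi> \<in> carrier H \<Longrightarrow> l \<phi> \<in> carrier R"
    "\<lbrakk>\<phi> \<in> carrier H; \<psi> \<in> carrier H\<rbrakk> \<Longrightarrow> l (\<phi> \<oplus>\<^bsub>H\<^esub> \<psi>) = l \<phi> \<oplus> l \<psi>"
    "\<lbrakk>r \<in> carrier R; \<phi> \<in> carrier H\<rbrakk> \<Longrightarrow> l (r \<odot>\<^bsub>H\<^esub> \<phi>) = r \<otimes> l \<phi>"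
    "l \<zero>\<^bsub>H\<^esub> = \<zero>"
proof -
  show props: "\<phi> \<in> carrier H \<Longrightarrow> l \<phi> \<in> carrier R"
    "\<lbrakk>\<phi> \<in> carrier H; \<psi> \<in> carrier H\<rbrakk> \<Longrightarrow> l (\<phi> \<oplus>\<^bsub>H\<^esub> \<psi>) = l \<phi> \<oplus> l \<psi>"
    "\<lbrakk>r \<in> carrier R; \<phi> \<in> carrier H\<rbrakk> \<Longrightarrow> l (r \<odot>\<^bsub>H\<^esub> \<phi>) = r \<otimes> l \<phi>" for \<phi> \<psi> r
    using D.H_homs[OF assms] by (auto simp: D.homs_iff)
  have "l (\<zero> \<odot>\<^bsub>H\<^esub> \<zero>\<^bsub>H\<^esub>) = \<zero> \<otimes> l \<zero>\<^bsub>H\<^esub>"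
    using H_zero_closed by (intro props(3)) auto
  moreover have "\<zero> \<odot>\<^bsub>H\<^esub> \<zero>\<^bsub>H\<^esub> = \<zero>\<^bsub>H\<^esub>"
    using H_zero_closed by (rule H.smult_l_null)
  ultimately show "l \<zero>\<^bsub>H\<^esub> = \<zero>"
    using props(1)[OF H_zero_closed] by simp
qed

lemma functional_props:
  assumes "l \<in> module_hom R N (self_module R)"
  shows "n \<in> carrier N \<Longrightarrow> l n \<in> carrier R"
    "\<lbrakk>n \<in> carrier N; n' \<in> carrier N\<rbrakk> \<Longrightarrow> l (n \<oplus>\<^bsub>N\<^esub> n') = l n \<oplus> l n'"
    "\<lbrakk>r \<in> carrier R; n \<in> carrier N\<rbrakk> \<Longrightarrow> l (r \<odot>\<^bsub>N\<^esub> n) = r \<otimes> l n"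
    "l \<zero>\<^bsub>N\<^esub> = \<zero>"
proof -
  show props: "n \<in> carrier N \<Longrightarrow> l n \<in> carrier R"
    "\<lbrakk>n \<in> carrier N; n' \<in> carrier N\<rbrakk> \<Longrightarrow> l (n \<oplus>\<^bsub>N\<^esub> n') = l n \<oplus> l n'"
    "\<lbrakk>r \<in> carrier R; n \<in> carrier N\<rbrakk> \<Longrightarrow> l (r \<odot>\<^bsub>N\<^esub> n) = r \<otimes> l n" for n n' r
    using assms by (auto simp: module_hom_self_iff)
  show "l \<zero>\<^bsub>N\<^esub> = \<zero>"
    using props(3)[of \<zero> "\<zero>\<^bsub>N\<^esub>"] props(1)[of "\<zero>\<^bsub>N\<^esub>"] by simp
qed

lemma pairing_hom:
  assumes "m \<in> carrier M" "l \<in> module_hom R N (self_module R)"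
  shows "pairing m l \<in> module_hom R H (self_module R)"
  using assms by (simp add: module_hom_self_iff pairing_def H_value H.M.add.m_closed)

lemma pairing_grade:
  assumes m: "m \<in> grade M i" and k: "k \<in> K"
  shows "pairing m (\<beta> k) \<in> grade (dual R H) (i + q k)"
proof -
  have "\<beta> k (\<phi> m) \<in> homog R (j + (i + q k))" if "\<phi> \<in> grade H j" for \<phi> j
  proof -
    have "\<phi> m \<in> grade N (i + j)" using that m by (auto simp: part_iff)
    then have "\<beta> k (\<phi> m) \<in> homog R (i + j + q k)"
      using N.functional_deg[OF k] by (auto simp: deg_part_def)
    then show ?thesis by (simp add: ac_simps)
  qed
  then show ?thesis
    using pairing_hom[OF M.grade_carrier[OF m] N.functional_hom[OF k]]
    by (auto simp: D.part_iff commuting_homs_def pairing_def part_H)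
qed

lemma pairing_add:
  assumes "m \<in> carrier M" "m' \<in> carrier M" "l \<in> module_hom R N (self_module R)"
  shows "pairing (m \<oplus>\<^bsub>M\<^esub> m') l = pairing m l \<oplus>\<^bsub>dual R H\<^esub> pairing m' l"
proof (rule D.H_eqI)
  fix \<phi> assume \<phi>: "\<phi> \<in> carrier H"
  then show "pairing (m \<oplus>\<^bsub>M\<^esub> m') l \<phi> = (pairing m l \<oplus>\<^bsub>dual R H\<^esub> pairing m' l) \<phi>"
    using assms(1,2) H_homs[OF \<phi>]
    by (simp add: pairing_def functional_props[OF assms(3)] homs_iff)
qed (simp_all add: pairing_def)

lemma pairing_smult:
  assumes "m \<in> carrier M" "r \<in> carrier R" "l \<in> module_hom R N (self_module R)"
  shows "pairing (r \<odot>\<^bsub>M\<^esub> m) l = r \<odot>\<^bsub>dual R H\<^esub> pairing m l"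
proof (rule D.H_eqI)
  fix \<phi> assume \<phi>: "\<phi> \<in> carrier H"
  then show "pairing (r \<odot>\<^bsub>M\<^esub> m) l \<phi> = (r \<odot>\<^bsub>dual R H\<^esub> pairing m l) \<phi>"
    using assms(1,2) H_homs[OF \<phi>]
    by (simp add: pairing_def functional_props[OF assms(3)] homs_iff)
qed (simp_all add: pairing_def)

lemma pairing_basis_dual:
  assumes m: "m \<in> carrier M" and k: "k \<in> K"
  shows "pairing m (\<beta> k) \<in> carrier (dual R H)"
  using M.all_homog_sums[OF m]
proof induction
  case zero
  have "pairing \<zero>\<^bsub>M\<^esub> (\<beta> k) = \<zero> \<odot>\<^bsub>dual R H\<^esub> pairing \<zero>\<^bsub>M\<^esub> (\<beta> k)"
    using pairing_smult[of "\<zero>\<^bsub>M\<^esub>" \<zero> "\<beta> k"] N.functional_hom[OF k] by simp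
  also have "\<dots> = \<zero>\<^bsub>dual R H\<^esub>"
    using pairing_hom[OF _ N.functional_hom[OF k], of "\<zero>\<^bsub>M\<^esub>"]
    by (intro D.H_eqI) (auto simp: module_hom_self_iff)
  finally show ?case using D.H_zero_closed by simp
next
  case (add m d m')
  then have "m \<in> carrier M" "m' \<in> carrier M"
    by (auto intro: M.grade_carrier M.homog_sums_carrier)
  then show ?case
    using add pairing_add N.functional_hom[OF k] D.H_add_closed D.part_H[OF pairing_grade[OF _ k]]
    by simp
qed

text \<open>This reduces arbitrary functionals on \<open>N\<close> to those of the dual basis, whose matrix coefficients
  are sums of homogeneous ones.\<close>

lemma pairing_expand:
  assumes m: "m \<in> carrier M" and l: "l \<in> module_hom R N (self_module R)"
  shows "pairing m l = (\<Oplus>\<^bsub>dual R H\<^esub>k\<in>K. l (b k) \<odot>\<^bsub>dual R H\<^esub> pairing m (\<beta> k))"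
proof (rule D.H_eqI)
  have terms: "(\<lambda>k. l (b k) \<odot>\<^bsub>dual R H\<^esub> pairing m (\<beta> k)) \<in> K \<rightarrow> carrier (dual R H)"
    using m l N.basis_carrier pairing_basis_dual D.H_smult_closed functional_props by auto
  then show "(\<Oplus>\<^bsub>dual R H\<^esub>k\<in>K. l (b k) \<odot>\<^bsub>dual R H\<^esub> pairing m (\<beta> k)) \<in> extensional (carrier H)"
    by simp
  show "pairing m l \<in> extensional (carrier H)"
    by (simp add: pairing_def)
  fix \<phi> assume \<phi>: "\<phi> \<in> carrier H"
  have "(\<Oplus>\<^bsub>dual R H\<^esub>k\<in>K. l (b k) \<odot>\<^bsub>dual R H\<^esub> pairing m (\<beta> k)) \<phi> = (\<Oplus>k\<in>K. l (b k) \<otimes> \<beta> k (\<phi> m))"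
    using D.H_finsum_eval[OF terms \<phi>] \<phi> m
    by (simp add: pairing_def)
  also have "\<dots> = (\<Oplus>k\<in>K. \<beta> k (\<phi> m) \<otimes> l (b k))"
    by (rule finsum_cong')
      (use \<phi> m l H_value N.functional_closed N.basis_carrier functional_props(1)[OF l] in \<open>auto simp: m_comm\<close>)
  also have "\<dots> = l (\<phi> m)"
    using N.hom_expand[OF D.N.module_axioms l H_value[OF \<phi> m]] by simp
  finally show "pairing m l \<phi> = (\<Oplus>\<^bsub>dual R H\<^esub>k\<in>K. l (b k) \<odot>\<^bsub>dual R H\<^esub> pairing m (\<beta> k)) \<phi>"
    using \<phi> by (simp add: pairing_def)
qed

lemma pairing_dual:
  assumes "m \<in> carrier M" "l \<in> module_hom R N (self_module R)"
  shows "pairing m l \<in> carrier (dual R H)"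
  unfolding pairing_expand[OF assms]
  using assms N.basis_carrier pairing_basis_dual functional_props
  by (intro D.M.finsum_closed) auto

text \<open>If \<open>\<xi>\<close> is evaluation at \<open>\<phi>\<close>, this is the expansion of \<open>\<phi> m\<close> in the dual basis of \<open>N\<close>.\<close>

definition recover :: "((('m \<Rightarrow> 'n) \<Rightarrow> 'a) \<Rightarrow> 'a) \<Rightarrow> 'm \<Rightarrow> 'n" where
  "recover \<xi> = (\<lambda>m\<in>carrier M. \<Oplus>\<^bsub>N\<^esub>k\<in>K. \<xi> (pairing m (\<beta> k)) \<odot>\<^bsub>N\<^esub> b k)"

context
  fixes \<xi> assumes \<xi>: "\<xi> \<in> carrier (dual R (dual R H))"
begin

lemma \<xi>_props:
  "\<eta> \<in> carrier (dual R H) \<Longrightarrow> \<xi> \<eta> \<in> carrier R"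
  "\<lbrakk>\<eta> \<in> carrier (dual R H); \<kappa> \<in> carrier (dual R H)\<rbrakk> \<Longrightarrow> \<xi> (\<eta> \<oplus>\<^bsub>dual R H\<^esub> \<kappa>) = \<xi> \<eta> \<oplus> \<xi> \<kappa>"
  "\<lbrakk>r \<in> carrier R; \<eta> \<in> carrier (dual R H)\<rbrakk> \<Longrightarrow> \<xi> (r \<odot>\<^bsub>dual R H\<^esub> \<eta>) = r \<otimes> \<xi> \<eta>"
  using DD.H_homs[OF \<xi>] by (auto simp: DD.homs_iff)

lemma \<xi>_finsum:
  assumes "f \<in> L \<rightarrow> carrier (dual R H)"
  shows "\<xi> (\<Oplus>\<^bsub>dual R H\<^esub>j\<in>L. f j) = (\<Oplus>j\<in>L. \<xi> (f j))"
  using D.M.abelian_group_axioms abelian_group_axioms \<xi>_props(1,2) assms by (rule additive_finsum)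

lemma recover_closed: "m \<in> carrier M \<Longrightarrow> recover \<xi> m \<in> carrier N"
  using pairing_basis_dual \<xi>_props N.basis_carrier
  by (auto simp: recover_def intro!: N.M.finsum_closed)

text \<open>Since functionals separate the points of \<open>N\<close>, this identity determines \<open>recover \<xi> m\<close>; that
  \<open>recover \<xi>\<close> is linear and commutes with the operators follows from it.\<close>

lemma functional_recover:
  assumes m: "m \<in> carrier M" and l: "l \<in> module_hom R N (self_module R)"
  shows "l (recover \<xi> m) = \<xi> (pairing m l)"
proof -
  have "l (recover \<xi> m) = (\<Oplus>k\<in>K. l (\<xi> (pairing m (\<beta> k)) \<odot>\<^bsub>N\<^esub> b k))"
    unfolding recover_def using m
    by (simp, intro additive_finsum)
      (use m l \<xi>_props functional_props pairing_basis_dual N.basis_carrier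
        N.M.abelian_group_axioms abelian_group_axioms in auto)
  also have "\<dots> = (\<Oplus>k\<in>K. \<xi> (l (b k) \<odot>\<^bsub>dual R H\<^esub> pairing m (\<beta> k)))"
    by (rule finsum_cong')
      (use m \<xi>_props pairing_basis_dual N.basis_carrier in \<open>auto simp: functional_props[OF l] m_comm\<close>)
  also have "\<dots> = \<xi> (pairing m l)"
    unfolding pairing_expand[OF m l]
    by (rule \<xi>_finsum[symmetric])
      (use m l functional_props pairing_basis_dual N.basis_carrier in auto)
  finally show ?thesis .
qed

lemma recover_homs: "recover \<xi> \<in> homs"
proof -
  have \<beta>: "\<beta> k \<in> module_hom R N (self_module R)" if "k \<in> K" for k
    using that by (rule N.functional_hom)
  have "recover \<xi> (m \<oplus>\<^bsub>M\<^esub> m') = recover \<xi> m \<oplus>\<^bsub>N\<^esub> recover \<xi> m'"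
    if "m \<in> carrier M" "m' \<in> carrier M" for m m'
    by (rule N.functionals_separate)
      (use that in \<open>auto simp: recover_closed functional_recover functional_props[OF \<beta>] \<beta> pairing_add
        \<xi>_props pairing_dual\<close>)
  moreover have "recover \<xi> (r \<odot>\<^bsub>M\<^esub> m) = r \<odot>\<^bsub>N\<^esub> recover \<xi> m"
    if "m \<in> carrier M" "r \<in> carrier R" for m r
    by (rule N.functionals_separate)
      (use that in \<open>auto simp: recover_closed functional_recover functional_props[OF \<beta>] \<beta> pairing_smult
        \<xi>_props pairing_dual\<close>)
  moreover have "recover \<xi> (A i m) = B i (recover \<xi> m)" if "i \<in> I" "m \<in> carrier M" for i m
  proof (rule N.functionals_separate)
    fix k assume k: "k \<in> K"
    \<comment> \<open>The operator on \<open>N\<close> is absorbed into the functional, which leaves the identity for \<open>l\<close>.\<close>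
    define l where "l = (\<lambda>n\<in>carrier N. \<beta> k (B i n))"
    have l: "l \<in> module_hom R N (self_module R)"
      unfolding module_hom_self_iff l_def
      using that by (auto simp: B_closed B_add B_smult functional_props[OF \<beta>[OF k]])
    have "pairing (A i m) (\<beta> k) = pairing m l"
      using that H_homs by (auto simp: pairing_def l_def homs_iff fun_eq_iff)
    then have "\<beta> k (recover \<xi> (A i m)) = l (recover \<xi> m)"
      using that l \<beta>[OF k] by (simp add: functional_recover A_closed)
    then show "\<beta> k (recover \<xi> (A i m)) = \<beta> k (B i (recover \<xi> m))"
      using that by (simp add: l_def recover_closed)
  qed (use that recover_closed A_closed B_closed in auto)
  moreover have "recover \<xi> \<in> extensional (carrier M)"
    by (simp add: recover_def)
  ultimately show ?thesis
    by (simp add: homs_iff recover_closed)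
qed

lemma recover_grade:
  assumes "\<xi> \<in> grade (dual R (dual R H)) d"
  shows "recover \<xi> \<in> grade H d"
proof -
  have "recover \<xi> m \<in> grade N (i + d)" if m: "m \<in> grade M i" for i m
  proof -
    have "\<xi> (pairing m (\<beta> k)) \<odot>\<^bsub>N\<^esub> b k \<in> grade N (i + d)" if k: "k \<in> K" for k
    proof -
      have "\<xi> (pairing m (\<beta> k)) \<in> homog R (i + q k + d)"
        using assms pairing_grade[OF m k] by (auto simp: DD.part_iff)
      from N.smult_grade[OF this N.basis_grade[OF k]] show ?thesis
        by (simp add: algebra_simps)
    qed
    then show ?thesis
      using M.grade_carrier[OF m] by (simp add: recover_def N.grade_finsum)
  qed
  then show ?thesis
    by (simp add: part_iff recover_homs)
qed

text \<open>For a matrix coefficient \<open>l\<close> this is \<open>functional_recover\<close>.  The matrix coefficients of the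
  generators of \<open>M\<close> and the basic functionals on \<open>N\<close> separate the points of \<open>H\<close>, so a nonzero
  multiple of any \<open>l\<close> is a combination of them, and the multiplier can be cancelled.\<close>

lemma evaluation_recover:
  assumes recover: "recover \<xi> \<in> carrier H" and l: "l \<in> carrier (dual R H)"
  shows "\<xi> l = l (recover \<xi>)"
proof (cases "\<one> = \<zero>")
  case True
  have "x = \<zero>" if "x \<in> carrier R" for x
    using that l_one[OF that] True by simp
  then show ?thesis
    using \<xi>_props(1)[OF l] dual_props(1)[OF l recover] by metis
next
  case False
  define \<mu> where "\<mu> = (\<lambda>(j, k). pairing (a j) (\<beta> k))"
  have \<mu>: "\<mu> x \<in> carrier (dual R H)" if "x \<in> J \<times> K" for x
    using that pairing_basis_dual M.basis_carrier by (auto simp: \<mu>_def)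
  have linear: "linear_form H l'" if "l' \<in> carrier (dual R H)" for l'
    using D.H_homs[OF that] by (auto simp: linear_form_def D.homs_iff)
  have l_zero: "l \<phi> = \<zero>" if \<phi>: "\<phi> \<in> carrier H" and zero: "\<And>x. x \<in> J \<times> K \<Longrightarrow> \<mu> x \<phi> = \<zero>" for \<phi>
  proof -
    have "\<phi> (a j) = \<zero>\<^bsub>N\<^esub>" if j: "j \<in> J" for j
    proof (rule N.functionals_separate)
      show "\<beta> k (\<phi> (a j)) = \<beta> k \<zero>\<^bsub>N\<^esub>" if k: "k \<in> K" for k
        using zero[of "(j, k)"] j k \<phi> functional_props(4)[OF N.functional_hom[OF k]]
        by (simp add: \<mu>_def pairing_def)
    qed (use j \<phi> M.basis_carrier H_value in auto)
    moreover have "\<phi> \<in> module_hom R M N"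
      using H_homs[OF \<phi>] by (simp add: commuting_homs_def)
    ultimately have "\<phi> m = \<zero>\<^bsub>N\<^esub>" if "m \<in> carrier M" for m
      using M.hom_expand[OF N.module_axioms _ that, of \<phi>] that M.functional_closed
      by (simp add: N.M.finsum_zero cong: N.M.finsum_cong)
    then have "\<phi> = \<zero>\<^bsub>H\<^esub>"
      using \<phi> by (intro H_eqI) auto
    then show ?thesis
      using dual_props(4)[OF l] by simp
  qed
  have "\<exists>r\<in>carrier R. r \<noteq> \<zero> \<and>
      (\<exists>c\<in>J \<times> K \<rightarrow> carrier R. \<forall>\<phi>\<in>carrier H. r \<otimes> l \<phi> = (\<Oplus>x\<in>J \<times> K. c x \<otimes> \<mu> x \<phi>))"
    by (rule rational_dependence[OF H.module_axioms False _ linear[OF \<mu>] linear[OF l] l_zero])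
      (auto simp: M.finite_index N.finite_index)
  then obtain r c where r: "r \<in> carrier R" "r \<noteq> \<zero>" and c: "c \<in> J \<times> K \<rightarrow> carrier R"
    and eq: "\<And>\<phi>. \<phi> \<in> carrier H \<Longrightarrow> r \<otimes> l \<phi> = (\<Oplus>x\<in>J \<times> K. c x \<otimes> \<mu> x \<phi>)"
    by (elim bexE conjE) simp
  have terms: "(\<lambda>x. c x \<odot>\<^bsub>dual R H\<^esub> \<mu> x) \<in> J \<times> K \<rightarrow> carrier (dual R H)"
    using c \<mu> D.H_smult_closed by auto
  have "r \<odot>\<^bsub>dual R H\<^esub> l = (\<Oplus>\<^bsub>dual R H\<^esub>x\<in>J \<times> K. c x \<odot>\<^bsub>dual R H\<^esub> \<mu> x)"
  proof (rule D.H_eqI)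
    fix \<phi> assume \<phi>: "\<phi> \<in> carrier H"
    show "(r \<odot>\<^bsub>dual R H\<^esub> l) \<phi> = (\<Oplus>\<^bsub>dual R H\<^esub>x\<in>J \<times> K. c x \<odot>\<^bsub>dual R H\<^esub> \<mu> x) \<phi>"
      using eq[OF \<phi>] \<phi> by (simp add: D.H_finsum_eval[OF terms \<phi>])
  next
    show "(\<Oplus>\<^bsub>dual R H\<^esub>x\<in>J \<times> K. c x \<odot>\<^bsub>dual R H\<^esub> \<mu> x) \<in> extensional (carrier H)"
      using terms by (intro D.H_extensional(4) D.M.finsum_closed)
  qed simp
  then have "r \<otimes> \<xi> l = (\<Oplus>x\<in>J \<times> K. \<xi> (c x \<odot>\<^bsub>dual R H\<^esub> \<mu> x))"
    using \<xi>_finsum[OF terms] \<xi>_props(3)[OF r(1) l] by simp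
  also have "\<dots> = (\<Oplus>x\<in>J \<times> K. c x \<otimes> \<mu> x (recover \<xi>))"
  proof (rule finsum_cong')
    show "\<xi> (c x \<odot>\<^bsub>dual R H\<^esub> \<mu> x) = c x \<otimes> \<mu> x (recover \<xi>)" if x: "x \<in> J \<times> K" for x
    proof -
      have "\<xi> (c x \<odot>\<^bsub>dual R H\<^esub> \<mu> x) = c x \<otimes> \<xi> (\<mu> x)"
        using \<mu>[OF x] c x by (intro \<xi>_props(3)) auto
      moreover have "\<xi> (\<mu> x) = \<mu> x (recover \<xi>)"
      proof -
        obtain j k where x: "x = (j, k)" "j \<in> J" "k \<in> K" using x by auto
        show ?thesis
          using functional_recover[OF M.basis_carrier[OF x(2)] N.functional_hom[OF x(3)]] recover
          by (simp add: \<mu>_def x(1) pairing_def)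
      qed
      ultimately show ?thesis by simp
    qed
  next
    show "(\<lambda>x. c x \<otimes> \<mu> x (recover \<xi>)) \<in> J \<times> K \<rightarrow> carrier R"
      using c dual_props(1)[OF \<mu> recover] by (intro Pi_I m_closed) auto
  qed simp
  also have "\<dots> = r \<otimes> l (recover \<xi>)"
    using eq[OF recover] by simp
  finally have "r \<otimes> (\<xi> l \<ominus> l (recover \<xi>)) = \<zero>"
    using r \<xi>_props(1)[OF l] D.H_value[OF l recover] by (simp add: r_distr a_minus_def r_minus r_neg)
  then have "\<xi> l \<ominus> l (recover \<xi>) = \<zero>"
    using integral[of r "\<xi> l \<ominus> l (recover \<xi>)"] r \<xi>_props(1)[OF l] D.H_value[OF l recover] by auto
  then show ?thesis
    using \<xi>_props(1)[OF l] dual_props(1)[OF l recover] by (rule diff_zero_imp_eq)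
qed

end

lemma evaluation_grade:
  assumes \<phi>: "\<phi> \<in> grade H d"
  shows "evaluation R H \<phi> \<in> grade (dual R (dual R H)) d"
proof -
  have "l \<phi> \<in> homog R (i + d)" if "l \<in> grade (dual R H) i" for i l
    using that \<phi> by (auto simp: D.part_iff add.commute)
  moreover have "l \<phi> \<in> carrier R" if "l \<in> carrier (dual R H)" for l
    using D.H_value[OF that part_H[OF \<phi>]] by simp
  ultimately show ?thesis
    using part_H[OF \<phi>]
    by (simp add: DD.part_iff DD.homs_iff evaluation_def D.part_H D.H_add_closed D.H_smult_closed)
qed

lemma evaluation_add:
  assumes "\<phi> \<in> carrier H" "\<psi> \<in> carrier H"
  shows "evaluation R H (\<phi> \<oplus>\<^bsub>H\<^esub> \<psi>) = evaluation R H \<phi> \<oplus>\<^bsub>dual R (dual R H)\<^esub> evaluation R H \<psi>"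
proof (rule DD.H_eqI)
  fix l assume "l \<in> carrier (dual R H)"
  then show "evaluation R H (\<phi> \<oplus>\<^bsub>H\<^esub> \<psi>) l
      = (evaluation R H \<phi> \<oplus>\<^bsub>dual R (dual R H)\<^esub> evaluation R H \<psi>) l"
    using assms H_add_closed by (simp add: evaluation_def dual_props(2))
qed (use assms H_add_closed in \<open>simp_all add: evaluation_def\<close>)

lemma evaluation_smult:
  assumes "\<phi> \<in> carrier H" "r \<in> carrier R"
  shows "evaluation R H (r \<odot>\<^bsub>H\<^esub> \<phi>) = r \<odot>\<^bsub>dual R (dual R H)\<^esub> evaluation R H \<phi>"
proof (rule DD.H_eqI)
  fix l assume "l \<in> carrier (dual R H)"
  then show "evaluation R H (r \<odot>\<^bsub>H\<^esub> \<phi>) l = (r \<odot>\<^bsub>dual R (dual R H)\<^esub> evaluation R H \<phi>) l"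
    using assms H_smult_closed by (simp add: evaluation_def dual_props(3))
qed (use assms H_smult_closed in \<open>simp_all add: evaluation_def\<close>)

lemma evaluation_zero: "evaluation R H \<zero>\<^bsub>H\<^esub> = \<zero>\<^bsub>dual R (dual R H)\<^esub>"
proof (rule DD.H_eqI)
  fix l assume "l \<in> carrier (dual R H)"
  then show "evaluation R H \<zero>\<^bsub>H\<^esub> l = \<zero>\<^bsub>dual R (dual R H)\<^esub> l"
    using H_zero_closed by (simp add: evaluation_def dual_props(4))
qed (use H_zero_closed in \<open>simp_all add: evaluation_def\<close>)

lemma evaluation_closed:
  "\<phi> \<in> carrier H \<Longrightarrow> evaluation R H \<phi> \<in> carrier (dual R (dual R H))"
proof (induction rule: H_induct)
  case zero
  then show ?case by (simp only: evaluation_zero DD.H_zero_closed)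
next
  case (add g \<psi> d)
  then show ?case
    using DD.H_add_part_closed[OF evaluation_grade] evaluation_add[OF part_H] by metis
qed

lemma evaluation_inj: "inj_on (evaluation R H) (carrier H)"
proof
  fix \<phi> \<psi> assume \<phi>: "\<phi> \<in> carrier H" and \<psi>: "\<psi> \<in> carrier H" and eq: "evaluation R H \<phi> = evaluation R H \<psi>"
  show "\<phi> = \<psi>"
  proof (rule H_eqI)
    fix m assume m: "m \<in> carrier M"
    show "\<phi> m = \<psi> m"
    proof (rule N.functionals_separate)
      fix k assume k: "k \<in> K"
      show "\<beta> k (\<phi> m) = \<beta> k (\<psi> m)"
        using fun_cong[OF eq, of "pairing m (\<beta> k)"] pairing_basis_dual[OF m k] \<phi> \<psi>
        by (simp add: evaluation_def pairing_def)
    qed (use \<phi> \<psi> m H_value in auto)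
  qed (use \<phi> \<psi> in auto)
qed

lemma evaluation_recover_eq:
  assumes "\<xi> \<in> grade (dual R (dual R H)) d"
  shows "\<xi> = evaluation R H (recover \<xi>)"
proof (rule DD.H_eqI)
  have \<xi>: "\<xi> \<in> carrier (dual R (dual R H))" and recover: "recover \<xi> \<in> carrier H"
    using DD.part_H[OF assms] part_H[OF recover_grade[OF DD.part_H[OF assms] assms]] by simp_all
  from \<xi> show "\<xi> \<in> extensional (carrier (dual R H))" by simp
  show "evaluation R H (recover \<xi>) \<in> extensional (carrier (dual R H))"
    using recover by (simp add: evaluation_def)
  fix l assume "l \<in> carrier (dual R H)"
  then show "\<xi> l = evaluation R H (recover \<xi>) l"
    using evaluation_recover[OF \<xi> recover] recover by (simp add: evaluation_def)
qed

text \<open>Applying \<open>recover\<close> to the homogeneous components of an element of the double dual ensures that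
  the preimage is a sum of homogeneous homomorphisms.\<close>

lemma evaluation_surj:
  "\<xi> \<in> carrier (dual R (dual R H)) \<Longrightarrow> \<xi> \<in> evaluation R H ` carrier H"
proof (induction rule: DD.H_induct)
  case zero
  then show ?case using evaluation_zero H_zero_closed by (metis imageI)
next
  case (add g \<psi> d)
  then obtain \<phi> where "\<phi> \<in> carrier H" "\<psi> = evaluation R H \<phi>" by auto
  moreover have "recover g \<in> carrier H" "g = evaluation R H (recover g)"
    using part_H[OF recover_grade[OF DD.part_H[OF add.hyps(1)] add.hyps(1)]]
      evaluation_recover_eq[OF add.hyps(1)] by simp_all
  ultimately have "evaluation R H (recover g \<oplus>\<^bsub>H\<^esub> \<phi>) = g \<oplus>\<^bsub>dual R (dual R H)\<^esub> \<psi>"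
    and "recover g \<oplus>\<^bsub>H\<^esub> \<phi> \<in> carrier H"
    using evaluation_add[of "recover g" \<phi>] H_add_closed by simp_all
  then show ?case by (metis imageI)
qed

theorem reflexive_hom: "reflexive R H"
proof -
  have "evaluation R H \<in> extensional (carrier H)"
    by (simp add: evaluation_def)
  then have "evaluation R H \<in> module_hom R H (dual R (dual R H))"
    by (simp add: module_hom_def PiE_def Pi_def evaluation_closed evaluation_add evaluation_smult)
  moreover have "bij_betw (evaluation R H) (carrier H) (carrier (dual R (dual R H)))"
    unfolding bij_betw_def
    by (intro conjI evaluation_inj subset_antisym subsetI evaluation_surj)
      (auto simp: evaluation_closed)
  moreover have "evaluation R H ` grade H d = grade (dual R (dual R H)) d" for d
  proof (intro subset_antisym subsetI)
    fix \<xi> assume \<xi>: "\<xi> \<in> grade (dual R (dual R H)) d"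
    show "\<xi> \<in> evaluation R H ` grade H d"
      using evaluation_recover_eq[OF \<xi>] recover_grade[OF DD.part_H[OF \<xi>] \<xi>] by (rule image_eqI)
  qed (auto simp: evaluation_grade)
  ultimately show ?thesis
    by (simp add: reflexive_def graded_iso_def)
qed

end

section \<open>Abelian groups and modules given by generators and relations\<close>

text \<open>A triple in \<open>T3\<close> stands for the relation \<open>x = y + z\<close>, a pair in \<open>T2\<close> for \<open>x = y\<close>.  Tensor
  products and Bott-Samelson bimodules have relations of these two kinds.\<close>

definition relators :: "('x \<times> 'x \<times> 'x) set \<Rightarrow> ('x \<times> 'x) set \<Rightarrow> ('x \<Rightarrow>\<^sub>0 int) set" where
  "relators T3 T2 = {frag_of x - frag_of y - frag_of z | x y z. (x, y, z) \<in> T3} \<union>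
     {frag_of x - frag_of y | x y. (x, y) \<in> T2}"

text \<open>The maps on generators that extend to homomorphisms of the presented group.\<close>

definition compatible ::
    "'x set \<Rightarrow> ('x \<times> 'x \<times> 'x) set \<Rightarrow> ('x \<times> 'x) set \<Rightarrow> ('g, 'z) ring_scheme \<Rightarrow> ('x \<Rightarrow> 'g) \<Rightarrow> bool" where
  "compatible X T3 T2 G f \<longleftrightarrow> (\<forall>x\<in>X. f x \<in> carrier G) \<and>
     (\<forall>x y z. (x, y, z) \<in> T3 \<longrightarrow> f x = f y \<oplus>\<^bsub>G\<^esub> f z) \<and> (\<forall>x y. (x, y) \<in> T2 \<longrightarrow> f x = f y)"

definition presented_module ::
    "'x set \<Rightarrow> ('x \<Rightarrow>\<^sub>0 int) set \<Rightarrow> ('a \<Rightarrow> 'x \<Rightarrow> 'x) \<Rightarrow> ('x \<Rightarrow> int \<Rightarrow> bool) \<Rightarrow>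
     ('a, ('x \<Rightarrow>\<^sub>0 int) set) graded_module" where
  "presented_module X rels l h =
     \<lparr>carrier = carrier (presented_group X rels), monoid.mult = undefined, one = undefined,
      ring.zero = one (presented_group X rels), add = monoid.mult (presented_group X rels),
      smult = (\<lambda>a. presented_map X rels (l a)),
      grade = (\<lambda>d. generate (presented_group X rels)
                 {presented_class X rels (frag_of x) | x. x \<in> X \<and> h x d})\<rparr>"

locale presentation =
  fixes X :: "'x set" and T3 :: "('x \<times> 'x \<times> 'x) set" and T2 :: "('x \<times> 'x) set"
    and l :: "'a \<Rightarrow> 'x \<Rightarrow> 'x" and h :: "'x \<Rightarrow> int \<Rightarrow> bool"
  assumes T3: "(x, y, z) \<in> T3 \<Longrightarrow> x \<in> X \<and> y \<in> X \<and> z \<in> X"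
    and T2: "(x, y) \<in> T2 \<Longrightarrow> x \<in> X \<and> y \<in> X"
begin

abbreviation "rels \<equiv> relators T3 T2"
abbreviation "FA \<equiv> free_Abelian_group X"
abbreviation "P \<equiv> presented_module X rels l h"
abbreviation "cls \<equiv> presented_class X rels"

definition gen :: "'x \<Rightarrow> ('x \<Rightarrow>\<^sub>0 int) set" where
  "gen x = presented_class X rels (frag_of x)"

lemma rels_subgroup: "subgroup (generate FA rels) FA"
proof (rule group.generate_is_subgroup)
  show "rels \<subseteq> carrier FA"
    using T3 T2 by (auto simp: relators_def dest!: subsetD[OF keys_diff])
qed simp

lemma rels_normal: "generate FA rels \<lhd> FA"
  using rels_subgroup comm_group.normal_iff_subgroup[OF abelian_free_Abelian_group] by blast

lemma P_abelian: "abelian_group P"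
proof -
  interpret Q: comm_group "presented_group X rels"
    unfolding presented_group_def
    by (rule comm_group.abelian_FactGroup[OF abelian_free_Abelian_group rels_subgroup])
  show ?thesis
    by (rule abelian_groupI)
      (auto simp: presented_module_def Q.m_ac intro: bexI[of _ "inv\<^bsub>presented_group X rels\<^esub> _"])
qed

sublocale P: abelian_group P by (rule P_abelian)

lemma P_carrier: "carrier P = cls ` carrier FA"
  by (simp add: presented_module_def presented_group_def carrier_FactGroup presented_class_def)

lemma cls_add: "\<lbrakk>c \<in> carrier FA; d \<in> carrier FA\<rbrakk> \<Longrightarrow> cls (c + d) = cls c \<oplus>\<^bsub>P\<^esub> cls d"
  using normal.rcos_sum[OF rels_normal, of c d]
  by (simp add: presented_module_def presented_group_def presented_class_def)

lemma cls_zero: "cls 0 = \<zero>\<^bsub>P\<^esub>"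
proof -
  have "generate FA rels #>\<^bsub>FA\<^esub> \<one>\<^bsub>FA\<^esub> = generate FA rels"
    using rels_subgroup by (intro group.coset_mult_one subgroup.subset) auto
  then show ?thesis
    by (simp add: presented_module_def presented_group_def presented_class_def)
qed

lemma cls_closed: "c \<in> carrier FA \<Longrightarrow> cls c \<in> carrier P"
  by (simp add: P_carrier del: carrier_free_Abelian_group_iff)

lemma cls_diff:
  assumes "c \<in> carrier FA" "d \<in> carrier FA"
  shows "cls (c - d) = cls c \<ominus>\<^bsub>P\<^esub> cls d"
proof -
  have cd: "c - d \<in> carrier FA"
    using assms keys_diff[of c d] by auto
  then have "cls c = cls (c - d) \<oplus>\<^bsub>P\<^esub> cls d"
    using cls_add[OF cd assms(2)] by simp
  then show ?thesis
    using cls_closed[OF cd] cls_closed[OF assms(2)]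
    by (simp add: P.minus_eq P.a_assoc P.r_neg)
qed

lemma cls_self: "c \<in> carrier FA \<Longrightarrow> c \<in> cls c"
  unfolding presented_class_def by (rule group.rcos_self) (auto simp: rels_subgroup)

lemma gen_closed: "x \<in> X \<Longrightarrow> gen x \<in> carrier P"
  by (simp add: gen_def cls_closed)

lemma presented_induct [consumes 1, case_names zero gen diff]:
  assumes "A \<in> carrier P" and "Q \<zero>\<^bsub>P\<^esub>" and "\<And>x. x \<in> X \<Longrightarrow> Q (gen x)"
    and "\<And>A B. \<lbrakk>A \<in> carrier P; B \<in> carrier P; Q A; Q B\<rbrakk> \<Longrightarrow> Q (A \<ominus>\<^bsub>P\<^esub> B)"
  shows "Q A"
proof -
  obtain c where c: "Poly_Mapping.keys c \<subseteq> X" and A: "A = cls c"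
    using assms(1) by (auto simp: P_carrier)
  have "Q (cls c)"
  proof (rule free_Abelian_group_induct[OF c])
    fix c d
    assume "Poly_Mapping.keys c \<subseteq> X" "Poly_Mapping.keys d \<subseteq> X" "Q (cls c)" "Q (cls d)"
    then show "Q (cls (c - d))"
      using assms(4)[of "cls c" "cls d"] by (simp add: cls_diff cls_closed)
  qed (use assms(2,3) in \<open>simp_all add: cls_zero gen_def\<close>)
  then show ?thesis by (simp add: A)
qed

lemma cls_rel:
  assumes "r \<in> rels" shows "cls r = \<zero>\<^bsub>P\<^esub>"
proof -
  have "r \<in> generate FA rels" using assms by (rule generate.incl)
  then have "generate FA rels #>\<^bsub>FA\<^esub> r = generate FA rels"
    using rels_subgroup by (intro group.coset_join2 subgroup.mem_carrier[OF rels_subgroup]) auto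
  then show ?thesis
    by (simp add: presented_class_def presented_module_def presented_group_def)
qed

lemma gen_compatible: "compatible X T3 T2 P gen"
  unfolding compatible_def
proof (intro conjI ballI allI impI gen_closed)
  fix x y z assume T: "(x, y, z) \<in> T3"
  then have "x \<in> X" "y \<in> X" "z \<in> X" using T3 by auto
  moreover from this have "frag_of x - frag_of y \<in> carrier FA"
    using keys_diff[of "frag_of x" "frag_of y"] by auto
  moreover have "cls (frag_of x - frag_of y - frag_of z) = \<zero>\<^bsub>P\<^esub>"
    by (rule cls_rel) (use T in \<open>auto simp: relators_def\<close>)
  ultimately have "gen x \<ominus>\<^bsub>P\<^esub> gen y \<ominus>\<^bsub>P\<^esub> gen z = \<zero>\<^bsub>P\<^esub>" and closed: "gen x \<in> carrier P" "gen y \<in> carrier P" "gen z \<in> carrier P"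
    by (simp_all add: cls_diff gen_def cls_closed)
  then have "gen x \<ominus>\<^bsub>P\<^esub> gen y \<ominus>\<^bsub>P\<^esub> gen z \<oplus>\<^bsub>P\<^esub> gen z \<oplus>\<^bsub>P\<^esub> gen y = gen z \<oplus>\<^bsub>P\<^esub> gen y"
    by simp
  moreover have "gen x \<ominus>\<^bsub>P\<^esub> gen y \<ominus>\<^bsub>P\<^esub> gen z \<oplus>\<^bsub>P\<^esub> gen z \<oplus>\<^bsub>P\<^esub> gen y = gen x"
    using closed by (simp add: P.minus_eq P.a_assoc P.l_neg)
  ultimately show "gen x = gen y \<oplus>\<^bsub>P\<^esub> gen z"
    using closed by (simp add: P.a_comm)
next
  fix x y assume T: "(x, y) \<in> T2"
  then have xy: "x \<in> X" "y \<in> X" using T2 by auto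
  moreover have "cls (frag_of x - frag_of y) = \<zero>\<^bsub>P\<^esub>"
    by (rule cls_rel) (use T in \<open>auto simp: relators_def\<close>)
  ultimately have "gen x \<ominus>\<^bsub>P\<^esub> gen y = \<zero>\<^bsub>P\<^esub>" and closed: "gen x \<in> carrier P" "gen y \<in> carrier P"
    by (simp_all add: cls_diff gen_def cls_closed)
  then have "gen x \<ominus>\<^bsub>P\<^esub> gen y \<oplus>\<^bsub>P\<^esub> gen y = gen y" by simp
  then show "gen x = gen y"
    using closed by (simp add: P.minus_eq P.a_assoc P.l_neg)
qed

text \<open>All functionals on tensor products and Bott-Samelson bimodules are obtained from this
  universal property.\<close>

lemma universal:
  assumes G: "abelian_group G" and f: "compatible X T3 T2 G f"
  shows "\<exists>g. (\<forall>A\<in>carrier P. g A \<in> carrier G) \<and>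
    (\<forall>A\<in>carrier P. \<forall>B\<in>carrier P. g (A \<oplus>\<^bsub>P\<^esub> B) = g A \<oplus>\<^bsub>G\<^esub> g B) \<and> (\<forall>x\<in>X. g (gen x) = f x)"
proof -
  interpret G: abelian_group G by fact
  have "f ` X \<subseteq> carrier (add_monoid G)"
    using f by (auto simp: compatible_def)
  then obtain u where u: "u \<in> hom FA (add_monoid G)" and u_of: "\<And>x. x \<in> X \<Longrightarrow> u (frag_of x) = f x"
    using comm_group.free_Abelian_group_universal[OF G.a_comm_group] by blast
  interpret u: group_hom FA "add_monoid G" u
    using u by (intro group_hom.intro group_hom_axioms.intro G.a_group) simp_all
  have u_diff: "u (c - d) = u c \<ominus>\<^bsub>G\<^esub> u d" if "c \<in> carrier FA" "d \<in> carrier FA" for c d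
  proof -
    have "u (c \<otimes>\<^bsub>FA\<^esub> inv\<^bsub>FA\<^esub> d) = u c \<otimes>\<^bsub>add_monoid G\<^esub> inv\<^bsub>add_monoid G\<^esub> (u d)"
      using that by (simp del: carrier_free_Abelian_group_iff mult_free_Abelian_group inv_free_Abelian_group)
    then show ?thesis
      using that by (simp add: a_minus_def a_inv_def)
  qed
  have fr: "frag_of x - frag_of y \<in> carrier FA" if "x \<in> X" "y \<in> X" for x y
    using that keys_diff[of "frag_of x" "frag_of y"] by auto
  have "rels \<subseteq> kernel FA (add_monoid G) u"
  proof
    fix r assume "r \<in> rels"
    then consider x y z where "r = frag_of x - frag_of y - frag_of z" "(x, y, z) \<in> T3"
      | x y where "r = frag_of x - frag_of y" "(x, y) \<in> T2"
      by (auto simp: relators_def)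
    then show "r \<in> kernel FA (add_monoid G) u"
    proof cases
      case 1
      then have xyz: "x \<in> X" "y \<in> X" "z \<in> X" and eq: "f x = f y \<oplus>\<^bsub>G\<^esub> f z"
        using T3 f by (auto simp: compatible_def)
      then have closed: "f y \<in> carrier G" "f z \<in> carrier G"
        using f by (auto simp: compatible_def)
      have "u r = f x \<ominus>\<^bsub>G\<^esub> f y \<ominus>\<^bsub>G\<^esub> f z"
        using xyz fr by (simp add: 1 u_diff u_of del: carrier_free_Abelian_group_iff)
      also have "\<dots> = \<zero>\<^bsub>G\<^esub>"
      proof -
        have "f x \<ominus>\<^bsub>G\<^esub> f y = f z"
          using closed by (simp only: eq G.a_comm[of "f y"]) (simp add: G.minus_eq G.a_assoc G.r_neg)
        then show ?thesis
          using closed by (simp add: G.minus_eq G.r_neg)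
      qed
      finally show ?thesis
        using fr[OF xyz(1,2)] xyz keys_diff[of "frag_of x - frag_of y" "frag_of z"]
        by (auto simp: kernel_def 1)
    next
      case 2
      then have xy: "x \<in> X" "y \<in> X" and eq: "f x = f y"
        using T2 f by (auto simp: compatible_def)
      then have closed: "f y \<in> carrier G"
        using f by (auto simp: compatible_def)
      have "u r = \<zero>\<^bsub>G\<^esub>"
        using xy closed eq by (simp add: 2 u_diff u_of G.minus_eq G.r_neg)
      then show ?thesis
        using fr[OF xy] by (auto simp: kernel_def 2)
    qed
  qed
  then have "generate FA rels \<subseteq> kernel FA (add_monoid G) u"
    by (intro group.generate_subgroup_incl u.subgroup_kernel) auto
  then obtain g where g: "g \<in> hom (FA Mod generate FA rels) (add_monoid G)"
    and g_cls: "\<And>c. c \<in> carrier FA \<Longrightarrow> g (generate FA rels #>\<^bsub>FA\<^esub> c) = u c"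
    using u.FactGroup_universal_kernel[OF rels_normal] by blast
  have "g (gen x) = f x" if "x \<in> X" for x
    using that g_cls[of "frag_of x"] by (simp add: gen_def presented_class_def u_of)
  then show ?thesis
    using g by (intro exI[of _ g]) (simp add: hom_def Pi_def presented_module_def presented_group_def)
qed

lemma additive_zero_diff:
  assumes G: "abelian_group G"
    and g: "\<And>A. A \<in> carrier P \<Longrightarrow> g A \<in> carrier G"
      "\<And>A B. \<lbrakk>A \<in> carrier P; B \<in> carrier P\<rbrakk> \<Longrightarrow> g (A \<oplus>\<^bsub>P\<^esub> B) = g A \<oplus>\<^bsub>G\<^esub> g B"
  shows "g \<zero>\<^bsub>P\<^esub> = \<zero>\<^bsub>G\<^esub>" and "A \<in> carrier P \<Longrightarrow> g (\<ominus>\<^bsub>P\<^esub> A) = \<ominus>\<^bsub>G\<^esub> g A"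
    and "\<lbrakk>A \<in> carrier P; B \<in> carrier P\<rbrakk> \<Longrightarrow> g (A \<ominus>\<^bsub>P\<^esub> B) = g A \<ominus>\<^bsub>G\<^esub> g B"
proof -
  interpret G: abelian_group G by fact
  show zero: "g \<zero>\<^bsub>P\<^esub> = \<zero>\<^bsub>G\<^esub>"
    using g(2)[of "\<zero>\<^bsub>P\<^esub>" "\<zero>\<^bsub>P\<^esub>"] g(1)[of "\<zero>\<^bsub>P\<^esub>"] G.add.r_cancel_one' by fastforce
  show neg: "g (\<ominus>\<^bsub>P\<^esub> A) = \<ominus>\<^bsub>G\<^esub> g A" if "A \<in> carrier P" for A
  proof -
    have "g (\<ominus>\<^bsub>P\<^esub> A) \<oplus>\<^bsub>G\<^esub> g A = \<zero>\<^bsub>G\<^esub>"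
      using g(2)[of "\<ominus>\<^bsub>P\<^esub> A" A] that by (simp add: P.l_neg zero)
    then show ?thesis
      using that g(1) by (intro G.minus_equality[symmetric]) auto
  qed
  show "g (A \<ominus>\<^bsub>P\<^esub> B) = g A \<ominus>\<^bsub>G\<^esub> g B" if "A \<in> carrier P" "B \<in> carrier P"
    using that g(2)[of A "\<ominus>\<^bsub>P\<^esub> B"] by (simp add: P.minus_eq G.minus_eq neg)
qed

text \<open>The homomorphism induced by \<open>f\<close> takes the same value on all representatives of a class, so the
  union in the definition of \<^const>\<open>presented_map\<close> collapses to that value.\<close>

lemma additive_eq:
  assumes G: "abelian_group G"
    and g: "\<And>A. A \<in> carrier P \<Longrightarrow> g A \<in> carrier G" "\<And>A B. \<lbrakk>A \<in> carrier P; B \<in> carrier P\<rbrakk> \<Longrightarrow> g (A \<oplus>\<^bsub>P\<^esub> B) = g A \<oplus>\<^bsub>G\<^esub> g B"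
    and g': "\<And>A. A \<in> carrier P \<Longrightarrow> g' A \<in> carrier G" "\<And>A B. \<lbrakk>A \<in> carrier P; B \<in> carrier P\<rbrakk> \<Longrightarrow> g' (A \<oplus>\<^bsub>P\<^esub> B) = g' A \<oplus>\<^bsub>G\<^esub> g' B"
    and eq: "\<And>x. x \<in> X \<Longrightarrow> g (gen x) = g' (gen x)"
    and A: "A \<in> carrier P"
  shows "g A = g' A"
proof -
  show ?thesis
    using A
  proof (induction rule: presented_induct)
    case zero
    show ?case by (simp only: additive_zero_diff(1)[OF G g] additive_zero_diff(1)[OF G g'])
  next
    case (diff A B)
    then show ?case
      by (simp only: additive_zero_diff(3)[OF G g] additive_zero_diff(3)[OF G g'])
  qed (rule eq)
qed

end

context presentation
begin

lemma presented_map: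
  assumes fX: "\<And>x. x \<in> X \<Longrightarrow> f x \<in> X" and f: "compatible X T3 T2 P (\<lambda>x. gen (f x))"
  shows "A \<in> carrier P \<Longrightarrow> presented_map X rels f A \<in> carrier P"
    and "\<lbrakk>A \<in> carrier P; B \<in> carrier P\<rbrakk> \<Longrightarrow>
      presented_map X rels f (A \<oplus>\<^bsub>P\<^esub> B) = presented_map X rels f A \<oplus>\<^bsub>P\<^esub> presented_map X rels f B"
    and "x \<in> X \<Longrightarrow> presented_map X rels f (gen x) = gen (f x)"
proof -
  obtain g where g: "\<And>A. A \<in> carrier P \<Longrightarrow> g A \<in> carrier P"
    and g_add: "\<And>A B. \<lbrakk>A \<in> carrier P; B \<in> carrier P\<rbrakk> \<Longrightarrow> g (A \<oplus>\<^bsub>P\<^esub> B) = g A \<oplus>\<^bsub>P\<^esub> g B"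
    and g_gen: "\<And>x. x \<in> X \<Longrightarrow> g (gen x) = gen (f x)"
    using universal[OF P_abelian f] by blast
  let ?F = "frag_extend (\<lambda>x. frag_of (f x))"
  have F_closed: "?F c \<in> carrier FA" if "c \<in> carrier FA" for c
  proof -
    have "Poly_Mapping.keys (?F c) \<subseteq> f ` Poly_Mapping.keys c"
      using keys_frag_extend[of "\<lambda>x. frag_of (f x)" c] by (auto simp: keys_frag_of)
    then show ?thesis using that fX by auto
  qed
  have g_cls: "g (cls c) = cls (?F c)" if c: "c \<in> carrier FA" for c
  proof (rule free_Abelian_group_induct[of c X])
    show "Poly_Mapping.keys c \<subseteq> X" using c by simp
    show "g (cls 0) = cls (?F 0)"
      using additive_zero_diff(1)[OF P_abelian g g_add] by (simp add: cls_zero)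
    fix c d assume cd: "Poly_Mapping.keys c \<subseteq> X" "Poly_Mapping.keys d \<subseteq> X"
      and eq: "g (cls c) = cls (?F c)" "g (cls d) = cls (?F d)"
    have "g (cls (c - d)) = g (cls c) \<ominus>\<^bsub>P\<^esub> g (cls d)"
      using cd additive_zero_diff(3)[OF P_abelian g g_add] by (simp add: cls_diff cls_closed)
    also have "\<dots> = cls (?F (c - d))"
      using cd F_closed[of c] F_closed[of d] by (simp add: eq frag_extend_diff cls_diff)
    finally show "g (cls (c - d)) = cls (?F (c - d))" .
  next
    fix x assume "x \<in> X"
    then show "g (cls (frag_of x)) = cls (?F (frag_of x))"
      using g_gen by (simp add: gen_def)
  qed
  have eq: "presented_map X rels f A = g A" if A: "A \<in> carrier P" for A
  proof -
    obtain c where c: "c \<in> carrier FA" and A: "A = cls c"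
      using A by (auto simp: P_carrier)
    have "cls (?F d) = g A" if d: "d \<in> A" for d
    proof -
      have "cls d = A"
        using group.repr_independence[OF _ _ c rels_subgroup, of d] d by (simp add: A presented_class_def)
      moreover have "d \<in> carrier FA"
        using d c subgroup.mem_carrier[OF rels_subgroup]
        by (auto simp: A presented_class_def r_coset_def simp del: carrier_free_Abelian_group_iff
            intro!: monoid.m_closed[OF group.is_monoid, of FA, unfolded mult_free_Abelian_group])
      ultimately show ?thesis using g_cls by metis
    qed
    moreover have "c \<in> A" using c cls_self by (simp add: A)
    ultimately show ?thesis
      unfolding presented_map_def by blast
  qed
  show "A \<in> carrier P \<Longrightarrow> presented_map X rels f A \<in> carrier P"
    by (simp add: eq g)
  show "\<lbrakk>A \<in> carrier P; B \<in> carrier P\<rbrakk> \<Longrightarrow>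
      presented_map X rels f (A \<oplus>\<^bsub>P\<^esub> B) = presented_map X rels f A \<oplus>\<^bsub>P\<^esub> presented_map X rels f B"
    by (simp add: eq g_add)
  show "x \<in> X \<Longrightarrow> presented_map X rels f (gen x) = gen (f x)"
    by (simp add: eq g_gen gen_closed)
qed

end

text \<open>The module axioms are asked of the generators, up to the relations; additive maps that agree on
  the generators are equal, which carries the axioms over to the whole group.\<close>

locale module_presentation = graded_coefficients R + presentation X T3 T2 l h
  for R :: "('a, 'y) graded_ring_scheme" (structure)
    and X :: "'x set" and T3 T2 and l :: "'a \<Rightarrow> 'x \<Rightarrow> 'x" and h +
  assumes l_closed: "\<lbrakk>a \<in> carrier R; x \<in> X\<rbrakk> \<Longrightarrow> l a x \<in> X"
    and l_compatible: "a \<in> carrier R \<Longrightarrow> compatible X T3 T2 P (\<lambda>x. gen (l a x))"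
    and l_add: "\<lbrakk>a \<in> carrier R; b \<in> carrier R; x \<in> X\<rbrakk> \<Longrightarrow> gen (l (a \<oplus> b) x) = gen (l a x) \<oplus>\<^bsub>P\<^esub> gen (l b x)"
    and l_mult: "\<lbrakk>a \<in> carrier R; b \<in> carrier R; x \<in> X\<rbrakk> \<Longrightarrow> gen (l (a \<otimes> b) x) = gen (l a (l b x))"
    and l_one: "x \<in> X \<Longrightarrow> gen (l \<one> x) = gen x"
    and l_degree: "\<lbrakk>a \<in> homog R d; x \<in> X; h x e\<rbrakk> \<Longrightarrow> h (l a x) (d + e)"
begin

lemma P_smult: "a \<odot>\<^bsub>P\<^esub> A = presented_map X rels (l a) A"
  by (simp add: presented_module_def)

lemma smult_gen: "\<lbrakk>a \<in> carrier R; x \<in> X\<rbrakk> \<Longrightarrow> a \<odot>\<^bsub>P\<^esub> gen x = gen (l a x)"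
  by (simp add: P_smult presented_map l_closed l_compatible)

lemma smult_closed: "\<lbrakk>a \<in> carrier R; A \<in> carrier P\<rbrakk> \<Longrightarrow> a \<odot>\<^bsub>P\<^esub> A \<in> carrier P"
  by (simp add: P_smult presented_map l_closed l_compatible)

lemma smult_r_distr:
  "\<lbrakk>a \<in> carrier R; A \<in> carrier P; B \<in> carrier P\<rbrakk> \<Longrightarrow> a \<odot>\<^bsub>P\<^esub> (A \<oplus>\<^bsub>P\<^esub> B) = a \<odot>\<^bsub>P\<^esub> A \<oplus>\<^bsub>P\<^esub> a \<odot>\<^bsub>P\<^esub> B"
  by (simp add: P_smult presented_map l_closed l_compatible)

lemma P_module: "module R P"
proof (rule moduleI[OF is_cring P_abelian smult_closed _ smult_r_distr])
  fix a b A assume a: "a \<in> carrier R" and b: "b \<in> carrier R" and A: "A \<in> carrier P"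
  show "(a \<oplus> b) \<odot>\<^bsub>P\<^esub> A = a \<odot>\<^bsub>P\<^esub> A \<oplus>\<^bsub>P\<^esub> b \<odot>\<^bsub>P\<^esub> A"
    by (rule additive_eq[OF P_abelian _ _ _ _ _ A])
      (use a b in \<open>auto simp: smult_closed smult_r_distr smult_gen l_add P.a_ac\<close>)
  show "a \<otimes> b \<odot>\<^bsub>P\<^esub> A = a \<odot>\<^bsub>P\<^esub> (b \<odot>\<^bsub>P\<^esub> A)"
    by (rule additive_eq[OF P_abelian _ _ _ _ _ A])
      (use a b in \<open>auto simp: smult_closed smult_r_distr smult_gen l_mult l_closed\<close>)
next
  fix A assume A: "A \<in> carrier P"
  show "\<one> \<odot>\<^bsub>P\<^esub> A = A"
    by (rule additive_eq[OF P_abelian _ _ _ _ _ A])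
      (auto simp: smult_closed smult_r_distr smult_gen l_one)
qed

lemma P_grade: "grade P d = generate (presented_group X rels) {gen x | x. x \<in> X \<and> h x d}"
  by (simp add: presented_module_def gen_def)

lemma P_inv: "A \<in> carrier P \<Longrightarrow> inv\<^bsub>presented_group X rels\<^esub> A = \<ominus>\<^bsub>P\<^esub> A"
  by (simp add: presented_module_def a_inv_def m_inv_def)

lemma grade_induct [consumes 1, case_names zero gen neg add]:
  assumes "A \<in> grade P d" and "Q \<zero>\<^bsub>P\<^esub>" and "\<And>x. \<lbrakk>x \<in> X; h x d\<rbrakk> \<Longrightarrow> Q (gen x)"
    and "\<And>x. \<lbrakk>x \<in> X; h x d\<rbrakk> \<Longrightarrow> Q (\<ominus>\<^bsub>P\<^esub> gen x)"
    and "\<And>A B. \<lbrakk>A \<in> grade P d; B \<in> grade P d; Q A; Q B\<rbrakk> \<Longrightarrow> Q (A \<oplus>\<^bsub>P\<^esub> B)"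
  shows "Q A"
  using assms(1) unfolding P_grade
proof (induction rule: generate.induct)
  case one
  then show ?case using assms(2) by (simp add: presented_module_def)
next
  case (inv A)
  then show ?case using assms(4) P_inv gen_closed by auto
next
  case (eng A B)
  then show ?case
    using assms(5)[of A B] by (simp add: P_grade) (simp add: presented_module_def)
qed (use assms(3) in auto)

lemma gen_grade: "\<lbrakk>x \<in> X; h x d\<rbrakk> \<Longrightarrow> gen x \<in> grade P d"
  unfolding P_grade by (auto intro: generate.incl)

lemma gen_neg_grade: "\<lbrakk>x \<in> X; h x d\<rbrakk> \<Longrightarrow> \<ominus>\<^bsub>P\<^esub> gen x \<in> grade P d"
  unfolding P_grade by (subst P_inv[symmetric]) (auto intro: generate.inv gen_closed)

lemma P_zero_grade: "\<zero>\<^bsub>P\<^esub> \<in> grade P d"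
  unfolding P_grade using generate.one[of "presented_group X rels"] by (simp add: presented_module_def)

lemma P_add_grade: "\<lbrakk>A \<in> grade P d; B \<in> grade P d\<rbrakk> \<Longrightarrow> A \<oplus>\<^bsub>P\<^esub> B \<in> grade P d"
  unfolding P_grade using generate.eng[of A "presented_group X rels" _ B] by (simp add: presented_module_def)

lemma P_grade_carrier: "A \<in> grade P d \<Longrightarrow> A \<in> carrier P"
  by (induction rule: grade_induct) (auto simp: gen_closed)

lemma P_graded_mod: "graded_mod R P"
proof -
  interpret P: module R P by (rule P_module)
  have "a \<odot>\<^bsub>P\<^esub> A \<in> grade P (d + e)" if a: "a \<in> homog R d" and A: "A \<in> grade P e" for a A d e
    using A
  proof (induction rule: grade_induct)
    case zero
    then show ?case using homog_carrier[OF a] by (simp add: P_zero_grade)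
  next
    case (gen x)
    then show ?case using homog_carrier[OF a] l_degree[OF a] by (simp add: smult_gen gen_grade l_closed)
  next
    case (neg x)
    then show ?case
      using homog_carrier[OF a] l_degree[OF a]
      by (simp add: P.smult_r_minus gen_closed smult_gen gen_neg_grade l_closed)
  next
    case (add A B)
    then show ?case
      using homog_carrier[OF a] by (simp add: smult_r_distr P_add_grade P_grade_carrier)
  qed
  then show ?thesis
    by (intro graded_mod.intro graded_mod_axioms.intro graded_coefficients_axioms P_module
        P_zero_grade P_add_grade P_grade_carrier)
qed

text \<open>The dual basis consists of the classes of the generators \<open>b j\<close> and the functionals induced by the
  coordinates \<open>F j\<close>; the expansion of an arbitrary element follows from that of generators.\<close>

lemma presented_dual_basis:
  assumes J: "finite J"
    and F: "\<And>j. j \<in> J \<Longrightarrow> compatible X T3 T2 R (F j)"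
    and F_l: "\<And>j a x. \<lbrakk>j \<in> J; a \<in> carrier R; x \<in> X\<rbrakk> \<Longrightarrow> F j (l a x) = a \<otimes> F j x"
    and F_deg: "\<And>j x d. \<lbrakk>j \<in> J; x \<in> X; h x d\<rbrakk> \<Longrightarrow> F j x \<in> homog R (d + e j)"
    and b: "\<And>j. j \<in> J \<Longrightarrow> b j \<in> X" and b_deg: "\<And>j. j \<in> J \<Longrightarrow> h (b j) (- e j)"
    and span: "\<And>x. x \<in> X \<Longrightarrow> gen x = (\<Oplus>\<^bsub>P\<^esub>j\<in>J. gen (l (F j x) (b j)))"
  shows "\<exists>\<nu>. homog_dual_basis R P J (\<lambda>j. gen (b j)) \<nu> e"
proof -
  interpret P: graded_mod R P by (rule P_graded_mod)
  have "\<forall>j\<in>J. \<exists>g. (\<forall>A\<in>carrier P. g A \<in> carrier R) \<and>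
      (\<forall>A\<in>carrier P. \<forall>B\<in>carrier P. g (A \<oplus>\<^bsub>P\<^esub> B) = g A \<oplus> g B) \<and> (\<forall>x\<in>X. g (gen x) = F j x)"
    using universal[OF abelian_group_axioms F] by blast
  then obtain g where "\<forall>j\<in>J. (\<forall>A\<in>carrier P. g j A \<in> carrier R) \<and>
      (\<forall>A\<in>carrier P. \<forall>B\<in>carrier P. g j (A \<oplus>\<^bsub>P\<^esub> B) = g j A \<oplus> g j B) \<and> (\<forall>x\<in>X. g j (gen x) = F j x)"
    by (rule bchoice[THEN exE])
  then have g: "\<And>j A. \<lbrakk>j \<in> J; A \<in> carrier P\<rbrakk> \<Longrightarrow> g j A \<in> carrier R"
    and g_add: "\<And>j A B. \<lbrakk>j \<in> J; A \<in> carrier P; B \<in> carrier P\<rbrakk> \<Longrightarrow> g j (A \<oplus>\<^bsub>P\<^esub> B) = g j A \<oplus> g j B"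
    and g_gen: "\<And>j x. \<lbrakk>j \<in> J; x \<in> X\<rbrakk> \<Longrightarrow> g j (gen x) = F j x"
    by blast+
  have g_smult: "g j (a \<odot>\<^bsub>P\<^esub> A) = a \<otimes> g j A" if "j \<in> J" "a \<in> carrier R" "A \<in> carrier P" for j a A
    by (rule additive_eq[OF abelian_group_axioms _ _ _ _ _ that(3)])
      (use that(1,2) in \<open>auto simp: g g_add smult_closed smult_r_distr r_distr smult_gen g_gen l_closed F_l\<close>)
  define \<nu> where "\<nu> = (\<lambda>j. \<lambda>A\<in>carrier P. g j A)"
  have \<nu>: "\<nu> j \<in> module_hom R P (self_module R)" if "j \<in> J" for j
    using that by (simp add: module_hom_self_iff \<nu>_def g g_add g_smult smult_closed)
  have \<nu>_deg: "\<nu> j A \<in> homog R (d + e j)" if j: "j \<in> J" and A: "A \<in> grade P d" for j A d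
  proof -
    have "g j A \<in> homog R (d + e j)"
      using A
    proof (induction rule: grade_induct)
      case zero
      then show ?case
        using additive_zero_diff(1)[OF abelian_group_axioms g[OF j] g_add[OF j]] by (simp add: zero_homog)
    next
      case (gen x)
      then show ?case using j F_deg by (simp add: g_gen)
    next
      case (neg x)
      then show ?case
        using additive_zero_diff(2)[OF abelian_group_axioms g[OF j] g_add[OF j]] j F_deg
        by (simp add: g_gen gen_closed neg_homog)
    next
      case (add A B)
      then show ?case using j by (simp add: g_add P_grade_carrier add_homog)
    qed
    then show ?thesis using P_grade_carrier[OF A] by (simp add: \<nu>_def)
  qed
  have expand: "A = (\<Oplus>\<^bsub>P\<^esub>j\<in>J. \<nu> j A \<odot>\<^bsub>P\<^esub> gen (b j))" if A: "A \<in> carrier P" for A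
  proof -
    let ?s = "\<lambda>A. \<Oplus>\<^bsub>P\<^esub>j\<in>J. g j A \<odot>\<^bsub>P\<^esub> gen (b j)"
    have closed: "(\<lambda>j. g j A \<odot>\<^bsub>P\<^esub> gen (b j)) \<in> J \<rightarrow> carrier P" if "A \<in> carrier P" for A
      using that g gen_closed b smult_closed by auto
    have "id A = ?s A"
    proof (rule additive_eq[OF P_abelian _ _ _ _ _ A])
      fix A B assume AB: "A \<in> carrier P" "B \<in> carrier P"
      have "?s (A \<oplus>\<^bsub>P\<^esub> B) = (\<Oplus>\<^bsub>P\<^esub>j\<in>J. g j A \<odot>\<^bsub>P\<^esub> gen (b j) \<oplus>\<^bsub>P\<^esub> g j B \<odot>\<^bsub>P\<^esub> gen (b j))"
        by (rule P.finsum_cong')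
          (use AB g gen_closed b smult_closed in \<open>auto simp: g_add P.smult_l_distr\<close>)
      also have "\<dots> = ?s A \<oplus>\<^bsub>P\<^esub> ?s B"
        by (rule P.finsum_addf[OF closed closed]) (use AB in auto)
      finally show "?s (A \<oplus>\<^bsub>P\<^esub> B) = ?s A \<oplus>\<^bsub>P\<^esub> ?s B" .
    next
      fix x assume x: "x \<in> X"
      have "?s (gen x) = (\<Oplus>\<^bsub>P\<^esub>j\<in>J. gen (l (F j x) (b j)))"
        by (rule P.finsum_cong')
          (use x b F gen_closed l_closed in \<open>auto simp: g_gen smult_gen compatible_def\<close>)
      then show "id (gen x) = ?s (gen x)"
        using span[OF x] by simp
    qed (use closed P.finsum_closed in auto)
    then show ?thesis using A by (simp add: \<nu>_def)
  qed
  have "homog_dual_basis R P J (\<lambda>j. gen (b j)) \<nu> e"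
    unfolding homog_dual_basis_def deg_part_def
    using J \<nu> \<nu>_deg expand b b_deg gen_grade by auto
  then show ?thesis by (rule exI[of _ \<nu>])
qed

end

section \<open>Bimodules with dual bases on both sides\<close>

text \<open>With this counterpart of \<^const>\<open>right_module\<close> both sides of a bimodule are modules of the same
  type, and one lemma serves for both.\<close>

definition left_module :: "('a, 'm, 'z) graded_bimodule_scheme \<Rightarrow> ('a, 'm) graded_module" where
  "left_module M = \<lparr>carrier = carrier M, monoid.mult = monoid.mult M, one = one M,
     ring.zero = ring.zero M, add = add M, smult = smult M, grade = grade M\<rparr>"

lemma left_module_simps [simp]:
  "carrier (left_module M) = carrier M" "ring.zero (left_module M) = ring.zero M"
  "add (left_module M) = add M" "smult (left_module M) = smult M" "grade (left_module M) = grade M"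
  by (simp_all add: left_module_def)

lemma right_module_simps [simp]:
  "carrier (right_module M) = carrier M" "ring.zero (right_module M) = ring.zero M"
  "add (right_module M) = add M" "smult (right_module M) = (\<lambda>r m. rsmult M m r)"
  "grade (right_module M) = grade M"
  by (simp_all add: right_module_def)

lemma finsum_left_module [simp]: "finsum (left_module M) = finsum M"
  by (intro ext) (simp add: finsum_def finprod_def)

lemma finsum_right_module [simp]: "finsum (right_module M) = finsum M"
  by (intro ext) (simp add: finsum_def finprod_def)

locale graded_bimod = graded_coefficients R + L: graded_mod R "left_module M" +
    Rt: graded_mod R "right_module M"
  for R :: "('a, 'y) graded_ring_scheme" (structure)
    and M :: "('a, 'm, 'z) graded_bimodule_scheme" +
  assumes actions_commute: "\<lbrakk>a \<in> carrier R; b \<in> carrier R; m \<in> carrier M\<rbrakk> \<Longrightarrow>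
    a \<odot>\<^bsub>M\<^esub> rsmult M m b = rsmult M (a \<odot>\<^bsub>M\<^esub> m) b"

text \<open>The index set is an argument because its type cannot be quantified inside the definition.\<close>

definition biprojective ::
    "('a, 'y) graded_ring_scheme \<Rightarrow> ('a, 'm, 'z) graded_bimodule_scheme \<Rightarrow> 'j set \<Rightarrow> bool" where
  "biprojective R M J \<longleftrightarrow> graded_bimod R M \<and>
     (\<exists>f \<nu> e. homog_dual_basis R (left_module M) J f \<nu> e) \<and>
     (\<exists>f \<nu> e. homog_dual_basis R (right_module M) J f \<nu> e)"

lemma commuting_homs_left:
  "commuting_homs R (left_module M) (left_module N) (\<lambda>r m. rsmult M m r) (\<lambda>r n. rsmult N n r) (carrier R)
    = bimodule_hom R M N"
  by (auto simp: commuting_homs_def bimodule_hom_def module_hom_def)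

lemma commuting_homs_right:
  "commuting_homs R (right_module M) (right_module N) (smult M) (smult N) (carrier R)
    = bimodule_hom R M N"
  by (auto simp: commuting_homs_def bimodule_hom_def module_hom_def)

text \<open>The theorem on commuting homomorphisms is applied twice, each time with one action as scalar
  multiplication and the other action as the family of operators.\<close>

theorem hom_bimodule_reflexive:
  fixes R :: "('a, 'y) graded_ring_scheme"
    and M :: "('a, 'm, 'z) graded_bimodule_scheme" and N :: "('a, 'n, 'u) graded_bimodule_scheme"
  assumes M: "biprojective R M J" and N: "biprojective R N K"
  shows "reflexive R (hom_bimodule R M N)" and "reflexive R (right_module (hom_bimodule R M N))"
proof -
  interpret M: graded_bimod R M using M by (simp add: biprojective_def)
  interpret N: graded_bimod R N using N by (simp add: biprojective_def)
  obtain a \<alpha> p where left_M: "homog_dual_basis R (left_module M) J a \<alpha> p"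
    using M by (auto simp: biprojective_def)
  obtain b \<beta> q where left_N: "homog_dual_basis R (left_module N) K b \<beta> q"
    using N by (auto simp: biprojective_def)
  have "hom_space_dual_bases R (left_module M) (left_module N) (\<lambda>r m. rsmult M m r)
      (\<lambda>r n. rsmult N n r) (carrier R) (hom_bimodule R M N) J a \<alpha> p K b \<beta> q"
  proof (intro hom_space_dual_bases.intro module_with_dual_basis.intro
      module_with_dual_basis_axioms.intro hom_space.intro hom_space_axioms.intro
      M.L.graded_mod_axioms N.L.graded_mod_axioms M.graded_coefficients_axioms left_M left_N)
  qed (use M.Rt.smult_closed N.Rt.smult_closed N.Rt.smult_r_distr in
      \<open>simp_all add: commuting_homs_left hom_bimodule_def deg_sum_def deg_part_def N.actions_commute\<close>)
  then show "reflexive R (hom_bimodule R M N)"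
    by (rule hom_space_dual_bases.reflexive_hom)
  obtain a \<alpha> p where right_M: "homog_dual_basis R (right_module M) J a \<alpha> p"
    using M by (auto simp: biprojective_def)
  obtain b \<beta> q where right_N: "homog_dual_basis R (right_module N) K b \<beta> q"
    using N by (auto simp: biprojective_def)
  have "hom_space_dual_bases R (right_module M) (right_module N) (smult M) (smult N) (carrier R)
      (right_module (hom_bimodule R M N)) J a \<alpha> p K b \<beta> q"
  proof (intro hom_space_dual_bases.intro module_with_dual_basis.intro
      module_with_dual_basis_axioms.intro hom_space.intro hom_space_axioms.intro
      M.Rt.graded_mod_axioms N.Rt.graded_mod_axioms M.graded_coefficients_axioms right_M right_N)
  qed (use M.L.smult_closed N.L.smult_closed N.L.smult_r_distr in
      \<open>simp_all add: commuting_homs_right hom_bimodule_def deg_sum_def deg_part_def N.actions_commute\<close>)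
  then show "reflexive R (right_module (hom_bimodule R M N))"
    by (rule hom_space_dual_bases.reflexive_hom)
qed

subsection \<open>Twisted bimodules\<close>

text \<open>A twisted bimodule is free of rank one on the element \<open>1\<close> from either side.  The coordinate of
  \<open>m\<close> is \<open>m\<close> on the left and the image of \<open>m\<close> under the inverse automorphism on the right.\<close>

lemma (in graded_coefficients) twisted_biprojective:
  assumes \<phi>: "act w \<in> ring_hom R R" and \<psi>: "\<psi> \<in> ring_hom R R"
    and \<phi>\<psi>: "\<And>r. r \<in> carrier R \<Longrightarrow> act w (\<psi> r) = r" and \<psi>\<phi>: "\<And>r. r \<in> carrier R \<Longrightarrow> \<psi> (act w r) = r"
    and \<phi>_deg: "\<And>r d. r \<in> homog R d \<Longrightarrow> act w r \<in> homog R d"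
    and \<psi>_deg: "\<And>r d. r \<in> homog R d \<Longrightarrow> \<psi> r \<in> homog R d"
  shows "biprojective R (twisted R act w) {()}"
proof -
  let ?T = "twisted R act w"
  note homs [simp] = ring_hom_closed[OF \<phi>] ring_hom_closed[OF \<psi>] ring_hom_add[OF \<phi>] ring_hom_add[OF \<psi>]
    ring_hom_mult[OF \<phi>] ring_hom_mult[OF \<psi>] ring_hom_one[OF \<phi>] ring_hom_one[OF \<psi>] \<phi>\<psi> \<psi>\<phi>
  have [simp]: "carrier ?T = carrier R" "ring.zero ?T = \<zero>" "add ?T = add R" "smult ?T = monoid.mult R"
    "grade ?T = homog R" "rsmult ?T = (\<lambda>m r. m \<otimes> act w r)"
    by (simp_all add: twisted_def)
  have [simp]: "finsum ?T = finsum R"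
    by (intro ext) (simp add: finsum_def finprod_def)
  have abelian: "abelian_group (left_module ?T)" "abelian_group (right_module ?T)"
    by (rule abelian_groupI; auto simp: a_ac intro: l_neg)+
  have "module R (left_module ?T)"
    by (intro moduleI abelian is_cring) (auto simp: l_distr r_distr m_assoc)
  then have left: "graded_mod R (left_module ?T)"
    by (intro graded_mod.intro graded_mod_axioms.intro graded_coefficients_axioms)
      (auto simp: zero_homog add_homog mult_homog homog_carrier)
  have "module R (right_module ?T)"
    by (intro moduleI abelian is_cring) (auto simp: l_distr r_distr m_ac)
  moreover have "m \<otimes> act w a \<in> homog R (d + e)" if "a \<in> homog R d" "m \<in> homog R e" for a m d e
    using mult_homog[OF that(2) \<phi>_deg[OF that(1)]] by (simp add: add.commute)
  ultimately have right: "graded_mod R (right_module ?T)"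
    by (intro graded_mod.intro graded_mod_axioms.intro graded_coefficients_axioms)
      (auto simp: zero_homog add_homog homog_carrier)
  have "graded_bimod R ?T"
    by (intro graded_bimod.intro graded_bimod_axioms.intro left right graded_coefficients_axioms)
      (auto simp: m_assoc)
  moreover have "homog_dual_basis R (left_module ?T) {()} (\<lambda>_. \<one>) (\<lambda>_. \<lambda>m\<in>carrier R. m) (\<lambda>_. 0)"
    unfolding homog_dual_basis_def deg_part_def module_hom_self_iff
    by (auto simp: one_homog homog_carrier)
  moreover have "homog_dual_basis R (right_module ?T) {()} (\<lambda>_. \<one>) (\<lambda>_. \<lambda>m\<in>carrier R. \<psi> m) (\<lambda>_. 0)"
    unfolding homog_dual_basis_def deg_part_def module_hom_self_iff
    by (auto simp: one_homog homog_carrier \<psi>_deg m_comm)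
  ultimately show ?thesis
    unfolding biprojective_def by blast
qed

subsection \<open>Presented bimodules\<close>

lemma left_presented_bimodule:
  "left_module (presented_bimodule X rels l r h) = presented_module X rels l h"
  by (simp add: left_module_def presented_bimodule_def presented_module_def)

lemma right_presented_bimodule:
  "right_module (presented_bimodule X rels l r h) = presented_module X rels (\<lambda>a x. r x a) h"
  by (simp add: right_module_def presented_bimodule_def presented_module_def)

lemma presented_bimodule_bimod:
  assumes left: "module_presentation R X T3 T2 l h"
    and right: "module_presentation R X T3 T2 (\<lambda>a x. r x a) h"
    and commute: "\<And>a b x. \<lbrakk>a \<in> carrier R; b \<in> carrier R; x \<in> X\<rbrakk> \<Longrightarrow> l a (r x b) = r (l a x) b"
  shows "graded_bimod R (presented_bimodule X (relators T3 T2) l r h)"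
proof -
  interpret L: module_presentation R X T3 T2 l h by (rule left)
  interpret Rt: module_presentation R X T3 T2 "\<lambda>a x. r x a" h by (rule right)
  let ?P = "presented_bimodule X (relators T3 T2) l r h"
  have eq: "carrier L.P = carrier ?P" "carrier Rt.P = carrier ?P" "add L.P = add ?P" "add Rt.P = add ?P"
    "smult L.P = smult ?P" "smult Rt.P = (\<lambda>b A. rsmult ?P A b)"
    by (simp_all add: presented_bimodule_def presented_module_def)
  have "a \<odot>\<^bsub>?P\<^esub> rsmult ?P A b = rsmult ?P (a \<odot>\<^bsub>?P\<^esub> A) b"
    if a: "a \<in> carrier R" and b: "b \<in> carrier R" and A: "A \<in> carrier ?P" for a b A
  proof (rule L.additive_eq[OF L.P_abelian, where g = "\<lambda>A. a \<odot>\<^bsub>?P\<^esub> rsmult ?P A b"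
        and g' = "\<lambda>A. rsmult ?P (a \<odot>\<^bsub>?P\<^esub> A) b"])
    show "A \<in> carrier L.P" using A by (simp add: eq)
    show "a \<odot>\<^bsub>?P\<^esub> rsmult ?P (L.gen x) b = rsmult ?P (a \<odot>\<^bsub>?P\<^esub> L.gen x) b" if "x \<in> X" for x
      using L.smult_gen[OF a that] L.smult_gen[OF a Rt.l_closed[OF b that]]
        Rt.smult_gen[OF b that] Rt.smult_gen[OF b L.l_closed[OF a that]] commute[OF a b that]
      by (simp add: eq)
  qed (use a b L.smult_closed Rt.smult_closed L.smult_r_distr Rt.smult_r_distr in \<open>simp_all add: eq\<close>)
  then show ?thesis
    using L.P_graded_mod Rt.P_graded_mod
    by (intro graded_bimod.intro graded_bimod_axioms.intro L.graded_coefficients_axioms)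
      (simp_all only: left_presented_bimodule right_presented_bimodule)
qed

lemma (in abelian_group) finsum_product:
  assumes "finite J" "finite K" "\<And>j k. \<lbrakk>j \<in> J; k \<in> K\<rbrakk> \<Longrightarrow> f j k \<in> carrier G"
  shows "(\<Oplus>j\<in>J. \<Oplus>k\<in>K. f j k) = (\<Oplus>x\<in>J \<times> K. case x of (j, k) \<Rightarrow> f j k)"
  using assms(1,3)
proof (induction J)
  case (insert j J)
  have "insert j J \<times> K = Pair j ` K \<union> J \<times> K" by auto
  moreover have "(\<Oplus>x\<in>Pair j ` K \<union> J \<times> K. case x of (j, k) \<Rightarrow> f j k)
      = (\<Oplus>x\<in>Pair j ` K. case x of (j, k) \<Rightarrow> f j k) \<oplus> (\<Oplus>x\<in>J \<times> K. case x of (j, k) \<Rightarrow> f j k)"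
    by (rule finsum_Un_disjoint) (use insert assms(2) in auto)
  moreover have "(\<Oplus>x\<in>Pair j ` K. case x of (j, k) \<Rightarrow> f j k) = (\<Oplus>k\<in>K. f j k)"
    by (subst finsum_reindex) (use insert in \<open>auto simp: inj_on_def\<close>)
  ultimately show ?case
    using insert by (simp add: Pi_def)
qed simp

lemma (in abelian_group) finsum_swap:
  assumes "finite J" "finite K" "\<And>j k. \<lbrakk>j \<in> J; k \<in> K\<rbrakk> \<Longrightarrow> f j k \<in> carrier G"
  shows "(\<Oplus>j\<in>J. \<Oplus>k\<in>K. f j k) = (\<Oplus>k\<in>K. \<Oplus>j\<in>J. f j k)"
  using assms(1,3)
proof (induction J)
  case (insert j J)
  have "(\<Oplus>k\<in>K. \<Oplus>j\<in>insert j J. f j k) = (\<Oplus>k\<in>K. f j k \<oplus> (\<Oplus>j\<in>J. f j k))"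
    by (rule finsum_cong') (use insert in \<open>auto simp: Pi_def intro!: finsum_closed\<close>)
  also have "\<dots> = (\<Oplus>k\<in>K. f j k) \<oplus> (\<Oplus>k\<in>K. \<Oplus>j\<in>J. f j k)"
    by (rule finsum_addf) (use insert in \<open>auto simp: Pi_def intro!: finsum_closed\<close>)
  finally show ?case
    using insert by (simp add: Pi_def)
qed (simp add: finsum_zero)

subsection \<open>Tensor products\<close>

definition tensor_T3 :: "('a, 'm, 'z) graded_bimodule_scheme \<Rightarrow> ('a, 'n, 'u) graded_bimodule_scheme \<Rightarrow>
    (('m \<times> 'n) \<times> ('m \<times> 'n) \<times> ('m \<times> 'n)) set" where
  "tensor_T3 M N =
     {((m \<oplus>\<^bsub>M\<^esub> m', n), (m, n), (m', n)) | m m' n. m \<in> carrier M \<and> m' \<in> carrier M \<and> n \<in> carrier N} \<union>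
     {((m, n \<oplus>\<^bsub>N\<^esub> n'), (m, n), (m, n')) | m n n'. m \<in> carrier M \<and> n \<in> carrier N \<and> n' \<in> carrier N}"

definition tensor_T2 :: "('a, 'y) ring_scheme \<Rightarrow> ('a, 'm, 'z) graded_bimodule_scheme \<Rightarrow>
    ('a, 'n, 'u) graded_bimodule_scheme \<Rightarrow> (('m \<times> 'n) \<times> ('m \<times> 'n)) set" where
  "tensor_T2 R M N = {((rsmult M m r, n), (m, r \<odot>\<^bsub>N\<^esub> n)) | m r n.
     m \<in> carrier M \<and> r \<in> carrier R \<and> n \<in> carrier N}"

lemma tensor_relators: "tensor_rels R M N = relators (tensor_T3 M N) (tensor_T2 R M N)"
proof -
  have "{frag_of x - frag_of y - frag_of z | x y z. (x, y, z) \<in> tensor_T3 M N} =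
      {frag_of (m \<oplus>\<^bsub>M\<^esub> m', n) - frag_of (m, n) - frag_of (m', n) | m m' n.
        m \<in> carrier M \<and> m' \<in> carrier M \<and> n \<in> carrier N} \<union>
      {frag_of (m, n \<oplus>\<^bsub>N\<^esub> n') - frag_of (m, n) - frag_of (m, n') | m n n'.
        m \<in> carrier M \<and> n \<in> carrier N \<and> n' \<in> carrier N}"
    unfolding tensor_T3_def Un_iff ex_disj_distrib conj_disj_distribL Collect_disj_eq[symmetric]
      mem_Collect_eq by (rule Collect_cong, intro iffI; elim disjE exE conjE; simp only: prod.inject; (rule disjI1, blast)?; (rule disjI2, blast)?)
  moreover have "{frag_of x - frag_of y | x y. (x, y) \<in> tensor_T2 R M N} =
      {frag_of (rsmult M m r, n) - frag_of (m, r \<odot>\<^bsub>N\<^esub> n) | m r n.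
        m \<in> carrier M \<and> r \<in> carrier R \<and> n \<in> carrier N}"
    unfolding tensor_T2_def mem_Collect_eq by (rule Collect_cong, intro iffI; elim exE conjE; simp only: prod.inject; blast)
  ultimately show ?thesis
    unfolding tensor_rels_def relators_def by simp
qed

lemma tensor_compatible:
  "compatible (carrier M \<times> carrier N) (tensor_T3 M N) (tensor_T2 R M N) G f \<longleftrightarrow>
    (\<forall>m\<in>carrier M. \<forall>n\<in>carrier N. f (m, n) \<in> carrier G) \<and>
    (\<forall>m\<in>carrier M. \<forall>m'\<in>carrier M. \<forall>n\<in>carrier N. f (m \<oplus>\<^bsub>M\<^esub> m', n) = f (m, n) \<oplus>\<^bsub>G\<^esub> f (m', n)) \<and>
    (\<forall>m\<in>carrier M. \<forall>n\<in>carrier N. \<forall>n'\<in>carrier N. f (m, n \<oplus>\<^bsub>N\<^esub> n') = f (m, n) \<oplus>\<^bsub>G\<^esub> f (m, n')) \<and>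
    (\<forall>m\<in>carrier M. \<forall>r\<in>carrier R. \<forall>n\<in>carrier N. f (rsmult M m r, n) = f (m, r \<odot>\<^bsub>N\<^esub> n))"
  (is "_ \<longleftrightarrow> ?rhs")
proof
  assume "compatible (carrier M \<times> carrier N) (tensor_T3 M N) (tensor_T2 R M N) G f"
  then have X: "\<And>m n. \<lbrakk>m \<in> carrier M; n \<in> carrier N\<rbrakk> \<Longrightarrow> f (m, n) \<in> carrier G"
    and T3: "\<And>x y z. (x, y, z) \<in> tensor_T3 M N \<Longrightarrow> f x = f y \<oplus>\<^bsub>G\<^esub> f z"
    and T2: "\<And>x y. (x, y) \<in> tensor_T2 R M N \<Longrightarrow> f x = f y"
    by (auto simp: compatible_def)
  show ?rhs
    by (intro conjI ballI X T3 T2) (unfold tensor_T3_def tensor_T2_def, blast+)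
next
  assume ?rhs
  then show "compatible (carrier M \<times> carrier N) (tensor_T3 M N) (tensor_T2 R M N) G f"
    unfolding compatible_def tensor_T3_def tensor_T2_def by auto
qed

locale bimod_pair = M: graded_bimod R M + N: graded_bimod R N
  for R :: "('a, 'y) graded_ring_scheme" (structure)
    and M :: "('a, 'm, 'z) graded_bimodule_scheme" and N :: "('a, 'n, 'u) graded_bimodule_scheme"
begin

lemma tensor_elements [simp]:
  "\<lbrakk>a \<in> carrier R; m \<in> carrier M\<rbrakk> \<Longrightarrow> a \<odot>\<^bsub>M\<^esub> m \<in> carrier M"
  "\<lbrakk>a \<in> carrier R; m \<in> carrier M\<rbrakk> \<Longrightarrow> rsmult M m a \<in> carrier M"
  "\<lbrakk>a \<in> carrier R; n \<in> carrier N\<rbrakk> \<Longrightarrow> a \<odot>\<^bsub>N\<^esub> n \<in> carrier N"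
  "\<lbrakk>a \<in> carrier R; n \<in> carrier N\<rbrakk> \<Longrightarrow> rsmult N n a \<in> carrier N"
  "\<lbrakk>m \<in> carrier M; m' \<in> carrier M\<rbrakk> \<Longrightarrow> m \<oplus>\<^bsub>M\<^esub> m' \<in> carrier M"
  "\<lbrakk>n \<in> carrier N; n' \<in> carrier N\<rbrakk> \<Longrightarrow> n \<oplus>\<^bsub>N\<^esub> n' \<in> carrier N"
  using M.L.smult_closed M.Rt.smult_closed N.L.smult_closed N.Rt.smult_closed
    M.L.M.add.m_closed N.L.M.add.m_closed by simp_all

abbreviation "tensor_X \<equiv> carrier M \<times> carrier N"
abbreviation "tensor_l \<equiv> (\<lambda>r (m, n). (r \<odot>\<^bsub>M\<^esub> m, n))"
abbreviation "tensor_r \<equiv> (\<lambda>r (m, n). (m, rsmult N n r))"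
definition "tensor_h = (\<lambda>(m, n) d. \<exists>i j. m \<in> grade M i \<and> n \<in> grade N j \<and> i + j = d)"

lemma tensor_presentation: "presentation tensor_X (tensor_T3 M N) (tensor_T2 R M N)"
  by unfold_locales (auto simp: tensor_T3_def tensor_T2_def)

lemma left_presentation:
  "module_presentation R tensor_X (tensor_T3 M N) (tensor_T2 R M N) tensor_l tensor_h"
proof -
  interpret P: presentation tensor_X "tensor_T3 M N" "tensor_T2 R M N" tensor_l tensor_h
    by (rule tensor_presentation)
  note rel = P.gen_compatible[unfolded tensor_compatible]
  show ?thesis
  proof (unfold_locales, goal_cases)
    case (2 a)
    then show ?case
      unfolding tensor_compatible
      using rel M.L.smult_r_distr[of a] M.actions_commute[of a] by simp
  next
    case (3 a b x)
    then show ?case using rel M.L.smult_l_distr[of a b] by auto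
  next
    case (4 a b x)
    then show ?case using M.L.smult_assoc1[of a b] by auto
  next
    case (5 x)
    then show ?case using M.L.smult_one by auto
  next
    case (6 a d x e)
    then show ?case
      using M.L.smult_grade[of a d] unfolding tensor_h_def by (fastforce simp: add.assoc)
  qed auto
qed

lemma right_presentation:
  "module_presentation R tensor_X (tensor_T3 M N) (tensor_T2 R M N) tensor_r tensor_h"
proof -
  interpret P: presentation tensor_X "tensor_T3 M N" "tensor_T2 R M N" tensor_r tensor_h
    by (rule tensor_presentation)
  note rel = P.gen_compatible[unfolded tensor_compatible]
  show ?thesis
  proof (unfold_locales, goal_cases)
    case (2 a)
    then show ?case
      unfolding tensor_compatible
      using rel N.Rt.smult_r_distr[of a] N.actions_commute[of _ a] by simp
  next
    case (3 a b x)
    then show ?case using rel N.Rt.smult_l_distr[of a b] by auto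
  next
    case (4 a b x)
    then show ?case using N.Rt.smult_assoc1[of a b] by auto
  next
    case (5 x)
    then show ?case using N.Rt.smult_one by auto
  next
    case (6 a d x e)
    then obtain m n i j where x: "x = (m, n)" "m \<in> grade M i" "n \<in> grade N j" "i + j = e" unfolding tensor_h_def by auto
    then have "rsmult N n a \<in> grade N (d + j)"
      using N.Rt.smult_grade[OF 6(1), of n j] by simp
    with x have "m \<in> grade M i \<and> rsmult N n a \<in> grade N (d + j) \<and> i + (d + j) = d + e" by simp
    then show ?case unfolding x(1) tensor_h_def prod.case by blast
  qed auto
qed

lemma tensor_bimod: "graded_bimod R (tensor R M N)"
proof -
  have "graded_bimod R (presented_bimodule tensor_X (relators (tensor_T3 M N) (tensor_T2 R M N))
      tensor_l (\<lambda>(m, n) r. (m, rsmult N n r)) tensor_h)"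
  proof (rule presented_bimodule_bimod[OF left_presentation])
    have "(\<lambda>a x. case x of (m, n) \<Rightarrow> \<lambda>r. (m, rsmult N n r)) = (\<lambda>a x r. tensor_r r x)"
      by (auto simp: fun_eq_iff)
    then have eq: "(\<lambda>a x. (case x of (m, n) \<Rightarrow> \<lambda>r. (m, rsmult N n r)) a) = tensor_r"
      by (auto simp: fun_eq_iff)
    show "module_presentation R tensor_X (tensor_T3 M N) (tensor_T2 R M N)
      (\<lambda>a x. (case x of (m, n) \<Rightarrow> \<lambda>r. (m, rsmult N n r)) a) tensor_h"
      unfolding eq by (rule right_presentation)
  qed auto
  then show ?thesis by (simp add: tensor_def tensor_relators tensor_h_def)
qed

lemma left_module_tensor:
  "left_module (tensor R M N)
    = presented_module tensor_X (relators (tensor_T3 M N) (tensor_T2 R M N)) tensor_l tensor_h"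
  by (simp add: tensor_def left_presented_bimodule tensor_relators tensor_h_def)

lemma right_module_tensor:
  "right_module (tensor R M N)
    = presented_module tensor_X (relators (tensor_T3 M N) (tensor_T2 R M N)) tensor_r tensor_h"
proof -
  have eq: "(\<lambda>a x. (case x of (m, n) \<Rightarrow> \<lambda>r. (m, rsmult N n r)) a) = tensor_r"
    by (auto simp: fun_eq_iff)
  show ?thesis
    unfolding tensor_def right_presented_bimodule tensor_relators eq tensor_h_def ..
qed

text \<open>Expanding \<open>n\<close> and moving the coordinates \<open>\<mu> k n\<close> across the tensor sign turns \<open>m \<otimes> n\<close> into the
  sum of the elements \<open>m (\<mu> k n) \<otimes> g k\<close>; expanding the first factors shows that
  \<open>\<nu> j (m (\<mu> k n))\<close> is the coordinate of \<open>m \<otimes> n\<close> at \<open>f j \<otimes> g k\<close>.\<close>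

lemma tensor_left_dual_basis:
  assumes f: "homog_dual_basis R (left_module M) J f \<nu> d"
    and g: "homog_dual_basis R (left_module N) K g \<mu> e"
  shows "\<exists>b \<nu> e. homog_dual_basis R (left_module (tensor R M N)) (J \<times> K) b \<nu> e"
proof -
  interpret P: module_presentation R tensor_X "tensor_T3 M N" "tensor_T2 R M N" tensor_l tensor_h
    by (rule left_presentation)
  interpret F: module_with_dual_basis R "left_module M" J f \<nu> d
    by unfold_locales (rule f)
  interpret G: module_with_dual_basis R "left_module N" K g \<mu> e
    by unfold_locales (rule g)
  have \<nu>: "\<nu> j m \<in> carrier R" "m' \<in> carrier M \<Longrightarrow> \<nu> j (m \<oplus>\<^bsub>M\<^esub> m') = \<nu> j m \<oplus> \<nu> j m'"
    "a \<in> carrier R \<Longrightarrow> \<nu> j (a \<odot>\<^bsub>M\<^esub> m) = a \<otimes> \<nu> j m" if "j \<in> J" "m \<in> carrier M" for j m m' a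
    using F.functional_hom[OF that(1)] that(2) by (auto simp: module_hom_self_iff)
  have \<mu>: "\<mu> k n \<in> carrier R" "n' \<in> carrier N \<Longrightarrow> \<mu> k (n \<oplus>\<^bsub>N\<^esub> n') = \<mu> k n \<oplus> \<mu> k n'"
    "a \<in> carrier R \<Longrightarrow> \<mu> k (a \<odot>\<^bsub>N\<^esub> n) = a \<otimes> \<mu> k n" if "k \<in> K" "n \<in> carrier N" for k n n' a
    using G.functional_hom[OF that(1)] that(2) by (auto simp: module_hom_self_iff)
  have basis: "\<And>j. j \<in> J \<Longrightarrow> f j \<in> carrier M" "\<And>k. k \<in> K \<Longrightarrow> g k \<in> carrier N"
    using F.basis_carrier G.basis_carrier by auto
  note rel = P.gen_compatible[unfolded tensor_compatible]
  define C where "C = (\<lambda>(j, k) (m, n). \<nu> j (rsmult M m (\<mu> k n)))"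
  have C_closed: "C x y \<in> carrier R" if "x \<in> J \<times> K" "y \<in> tensor_X" for x y
    using that by (auto simp: C_def \<nu> \<mu>)
  have "\<exists>\<eta>. homog_dual_basis R P.P (J \<times> K) (\<lambda>x. P.gen ((\<lambda>(j, k). (f j, g k)) x)) \<eta> (\<lambda>(j, k). d j + e k)"
  proof (rule P.presented_dual_basis[where F = C])
    show "finite (J \<times> K)" using F.finite_index G.finite_index by simp
    show "compatible tensor_X (tensor_T3 M N) (tensor_T2 R M N) R (C x)" if "x \<in> J \<times> K" for x
      unfolding tensor_compatible C_def
      using that M.Rt.smult_r_distr M.Rt.smult_l_distr M.Rt.smult_assoc1[symmetric]
      by (auto simp: \<nu> \<mu> M.m_comm)
    show "C x (tensor_l a y) = a \<otimes> C x y" if "x \<in> J \<times> K" "a \<in> carrier R" "y \<in> tensor_X" for x a y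
      using that by (auto simp: C_def \<nu> \<mu> M.actions_commute[symmetric])
    show "C x y \<in> homog R (i + (case x of (j, k) \<Rightarrow> d j + e k))"
      if xy: "x \<in> J \<times> K" "y \<in> tensor_X" "tensor_h y i" for x y i
    proof -
      obtain j k m n i1 i2 where x: "x = (j, k)" "j \<in> J" "k \<in> K" and y: "y = (m, n)"
        and mn: "m \<in> grade M i1" "n \<in> grade N i2" "i = i1 + i2"
        using xy by (auto simp: tensor_h_def)
      have "\<mu> k n \<in> homog R (i2 + e k)"
        using G.functional_deg[OF x(3)] mn by (auto simp: deg_part_def)
      then have "rsmult M m (\<mu> k n) \<in> grade M (i2 + e k + i1)"
        using M.Rt.smult_grade[of "\<mu> k n" "i2 + e k" m i1] mn by simp
      then have "\<nu> j (rsmult M m (\<mu> k n)) \<in> homog R (i2 + e k + i1 + d j)"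
        using F.functional_deg[OF x(2)] by (auto simp: deg_part_def)
      then show ?thesis by (simp add: x y mn C_def algebra_simps)
    qed
    show "(case x of (j, k) \<Rightarrow> (f j, g k)) \<in> tensor_X" if "x \<in> J \<times> K" for x
      using that basis by auto
    show "tensor_h (case x of (j, k) \<Rightarrow> (f j, g k)) (- (case x of (j, k) \<Rightarrow> d j + e k))"
      if "x \<in> J \<times> K" for x
      using that F.basis_grade G.basis_grade by (fastforce simp: tensor_h_def)
    show "P.gen y = (\<Oplus>\<^bsub>P.P\<^esub>x\<in>J \<times> K. P.gen (tensor_l (C x y) (case x of (j, k) \<Rightarrow> (f j, g k))))"
      if y: "y \<in> tensor_X" for y
    proof -
      obtain m n where y: "y = (m, n)" and m: "m \<in> carrier M" and n: "n \<in> carrier N"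
        using y by auto
      have "P.gen (m, n) = P.gen (m, \<Oplus>\<^bsub>N\<^esub>k\<in>K. \<mu> k n \<odot>\<^bsub>N\<^esub> g k)"
        using G.expand n by simp
      also have "\<dots> = (\<Oplus>\<^bsub>P.P\<^esub>k\<in>K. P.gen (m, \<mu> k n \<odot>\<^bsub>N\<^esub> g k))"
        using additive_finsum[OF N.L.M.abelian_group_axioms P.P_abelian,
            of "\<lambda>n. P.gen (m, n)" "\<lambda>k. \<mu> k n \<odot>\<^bsub>N\<^esub> g k" K] rel m n \<mu> basis by (simp add: Pi_def)
      also have "\<dots> = (\<Oplus>\<^bsub>P.P\<^esub>k\<in>K. \<Oplus>\<^bsub>P.P\<^esub>j\<in>J. P.gen (\<nu> j (rsmult M m (\<mu> k n)) \<odot>\<^bsub>M\<^esub> f j, g k))"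
      proof (rule P.P.finsum_cong')
        fix k assume k: "k \<in> K"
        let ?m = "rsmult M m (\<mu> k n)"
        have m': "?m \<in> carrier M" using k m n \<mu> by simp
        have "P.gen (m, \<mu> k n \<odot>\<^bsub>N\<^esub> g k) = P.gen (?m, g k)"
          using rel k m n \<mu> basis by simp
        also have "\<dots> = P.gen (\<Oplus>\<^bsub>M\<^esub>j\<in>J. \<nu> j ?m \<odot>\<^bsub>M\<^esub> f j, g k)"
          using F.expand m' by simp
        also have "\<dots> = (\<Oplus>\<^bsub>P.P\<^esub>j\<in>J. P.gen (\<nu> j ?m \<odot>\<^bsub>M\<^esub> f j, g k))"
          using additive_finsum[OF M.L.M.abelian_group_axioms P.P_abelian,
              of "\<lambda>m. P.gen (m, g k)" "\<lambda>j. \<nu> j ?m \<odot>\<^bsub>M\<^esub> f j" J] rel k m' \<nu> basis by (simp add: Pi_def)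
        finally show "P.gen (m, \<mu> k n \<odot>\<^bsub>N\<^esub> g k) = (\<Oplus>\<^bsub>P.P\<^esub>j\<in>J. P.gen (\<nu> j ?m \<odot>\<^bsub>M\<^esub> f j, g k))" .
      next
        show "(\<lambda>k. \<Oplus>\<^bsub>P.P\<^esub>j\<in>J. P.gen (\<nu> j (rsmult M m (\<mu> k n)) \<odot>\<^bsub>M\<^esub> f j, g k)) \<in> K \<rightarrow> carrier P.P"
          by (intro Pi_I P.P.finsum_closed P.gen_closed) (use m n \<nu> \<mu> basis in simp)
      qed simp
      also have "\<dots> = (\<Oplus>\<^bsub>P.P\<^esub>j\<in>J. \<Oplus>\<^bsub>P.P\<^esub>k\<in>K. P.gen (\<nu> j (rsmult M m (\<mu> k n)) \<odot>\<^bsub>M\<^esub> f j, g k))"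
        by (rule P.P.finsum_swap[OF F.finite_index G.finite_index, symmetric])
          (use m n \<nu> \<mu> basis in \<open>auto intro!: P.gen_closed\<close>)
      also have "\<dots> = (\<Oplus>\<^bsub>P.P\<^esub>x\<in>J \<times> K. case x of (j, k) \<Rightarrow> P.gen (\<nu> j (rsmult M m (\<mu> k n)) \<odot>\<^bsub>M\<^esub> f j, g k))"
        by (rule P.P.finsum_product[OF F.finite_index G.finite_index])
          (use m n \<nu> \<mu> basis in \<open>auto intro!: P.gen_closed\<close>)
      also have "\<dots> = (\<Oplus>\<^bsub>P.P\<^esub>x\<in>J \<times> K. P.gen (tensor_l (C x y) (case x of (j, k) \<Rightarrow> (f j, g k))))"
        by (rule P.P.finsum_cong') (use m n \<nu> \<mu> basis in \<open>auto simp: C_def y intro!: P.gen_closed\<close>)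
      finally show ?thesis by (simp add: y)
    qed
  qed
  then show ?thesis unfolding left_module_tensor by blast
qed

text \<open>Here the first factor is expanded first, and its coordinates move to the right across the tensor
  sign.\<close>

lemma tensor_right_dual_basis:
  assumes f: "homog_dual_basis R (right_module M) J f \<nu> d"
    and g: "homog_dual_basis R (right_module N) K g \<mu> e"
  shows "\<exists>b \<nu> e. homog_dual_basis R (right_module (tensor R M N)) (J \<times> K) b \<nu> e"
proof -
  interpret P: module_presentation R tensor_X "tensor_T3 M N" "tensor_T2 R M N" tensor_r tensor_h
    by (rule right_presentation)
  interpret F: module_with_dual_basis R "right_module M" J f \<nu> d
    by unfold_locales (rule f)
  interpret G: module_with_dual_basis R "right_module N" K g \<mu> e
    by unfold_locales (rule g)
  have \<nu>: "\<nu> j m \<in> carrier R" "m' \<in> carrier M \<Longrightarrow> \<nu> j (m \<oplus>\<^bsub>M\<^esub> m') = \<nu> j m \<oplus> \<nu> j m'"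
    "a \<in> carrier R \<Longrightarrow> \<nu> j (rsmult M m a) = a \<otimes> \<nu> j m" if "j \<in> J" "m \<in> carrier M" for j m m' a
    using F.functional_hom[OF that(1)] that(2) by (auto simp: module_hom_self_iff)
  have \<mu>: "\<mu> k n \<in> carrier R" "n' \<in> carrier N \<Longrightarrow> \<mu> k (n \<oplus>\<^bsub>N\<^esub> n') = \<mu> k n \<oplus> \<mu> k n'"
    "a \<in> carrier R \<Longrightarrow> \<mu> k (rsmult N n a) = a \<otimes> \<mu> k n" if "k \<in> K" "n \<in> carrier N" for k n n' a
    using G.functional_hom[OF that(1)] that(2) by (auto simp: module_hom_self_iff)
  have basis: "\<And>j. j \<in> J \<Longrightarrow> f j \<in> carrier M" "\<And>k. k \<in> K \<Longrightarrow> g k \<in> carrier N"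
    using F.basis_carrier G.basis_carrier by auto
  note rel = P.gen_compatible[unfolded tensor_compatible]
  define C where "C = (\<lambda>(j, k) (m, n). \<mu> k (\<nu> j m \<odot>\<^bsub>N\<^esub> n))"
  have "\<exists>\<eta>. homog_dual_basis R P.P (J \<times> K) (\<lambda>x. P.gen ((\<lambda>(j, k). (f j, g k)) x)) \<eta> (\<lambda>(j, k). d j + e k)"
  proof (rule P.presented_dual_basis[where F = C])
    show "finite (J \<times> K)" using F.finite_index G.finite_index by simp
    show "compatible tensor_X (tensor_T3 M N) (tensor_T2 R M N) R (C x)" if "x \<in> J \<times> K" for x
      unfolding tensor_compatible C_def
      using that N.L.smult_r_distr N.L.smult_l_distr N.L.smult_assoc1[symmetric]
      by (auto simp: \<nu> \<mu> M.m_comm)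
    show "C x (tensor_r a y) = a \<otimes> C x y" if "x \<in> J \<times> K" "a \<in> carrier R" "y \<in> tensor_X" for x a y
      using that by (auto simp: C_def \<nu> \<mu> N.actions_commute)
    show "C x y \<in> homog R (i + (case x of (j, k) \<Rightarrow> d j + e k))"
      if xy: "x \<in> J \<times> K" "y \<in> tensor_X" "tensor_h y i" for x y i
    proof -
      obtain j k m n i1 i2 where x: "x = (j, k)" "j \<in> J" "k \<in> K" and y: "y = (m, n)"
        and mn: "m \<in> grade M i1" "n \<in> grade N i2" "i = i1 + i2"
        using xy by (auto simp: tensor_h_def)
      have "\<nu> j m \<in> homog R (i1 + d j)"
        using F.functional_deg[OF x(2)] mn by (auto simp: deg_part_def)
      then have "\<nu> j m \<odot>\<^bsub>N\<^esub> n \<in> grade N (i1 + d j + i2)"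
        using N.L.smult_grade[of "\<nu> j m" "i1 + d j" n i2] mn by simp
      then have "\<mu> k (\<nu> j m \<odot>\<^bsub>N\<^esub> n) \<in> homog R (i1 + d j + i2 + e k)"
        using G.functional_deg[OF x(3)] by (auto simp: deg_part_def)
      then show ?thesis by (simp add: x y mn C_def algebra_simps)
    qed
    show "(case x of (j, k) \<Rightarrow> (f j, g k)) \<in> tensor_X" if "x \<in> J \<times> K" for x
      using that basis by auto
    show "tensor_h (case x of (j, k) \<Rightarrow> (f j, g k)) (- (case x of (j, k) \<Rightarrow> d j + e k))"
      if "x \<in> J \<times> K" for x
      using that F.basis_grade G.basis_grade by (fastforce simp: tensor_h_def)
    show "P.gen y = (\<Oplus>\<^bsub>P.P\<^esub>x\<in>J \<times> K. P.gen (tensor_r (C x y) (case x of (j, k) \<Rightarrow> (f j, g k))))"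
      if y: "y \<in> tensor_X" for y
    proof -
      obtain m n where y: "y = (m, n)" and m: "m \<in> carrier M" and n: "n \<in> carrier N"
        using y by auto
      have "P.gen (m, n) = P.gen (\<Oplus>\<^bsub>M\<^esub>j\<in>J. rsmult M (f j) (\<nu> j m), n)"
        using F.expand m by simp
      also have "\<dots> = (\<Oplus>\<^bsub>P.P\<^esub>j\<in>J. P.gen (rsmult M (f j) (\<nu> j m), n))"
        using additive_finsum[OF M.Rt.M.abelian_group_axioms P.P_abelian,
            of "\<lambda>m. P.gen (m, n)" "\<lambda>j. rsmult M (f j) (\<nu> j m)" J] rel m n \<nu> basis by (simp add: Pi_def)
      also have "\<dots> = (\<Oplus>\<^bsub>P.P\<^esub>j\<in>J. \<Oplus>\<^bsub>P.P\<^esub>k\<in>K. P.gen (f j, rsmult N (g k) (\<mu> k (\<nu> j m \<odot>\<^bsub>N\<^esub> n))))"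
      proof (rule P.P.finsum_cong')
        fix j assume j: "j \<in> J"
        let ?n = "\<nu> j m \<odot>\<^bsub>N\<^esub> n"
        have n': "?n \<in> carrier N" using j m n \<nu> by simp
        have "P.gen (rsmult M (f j) (\<nu> j m), n) = P.gen (f j, ?n)"
          using rel j m n \<nu> basis by simp
        also have "\<dots> = P.gen (f j, \<Oplus>\<^bsub>N\<^esub>k\<in>K. rsmult N (g k) (\<mu> k ?n))"
          using G.expand n' by simp
        also have "\<dots> = (\<Oplus>\<^bsub>P.P\<^esub>k\<in>K. P.gen (f j, rsmult N (g k) (\<mu> k ?n)))"
          using additive_finsum[OF N.Rt.M.abelian_group_axioms P.P_abelian,
              of "\<lambda>n. P.gen (f j, n)" "\<lambda>k. rsmult N (g k) (\<mu> k ?n)" K] rel j n' \<mu> basis by (simp add: Pi_def)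
        finally show "P.gen (rsmult M (f j) (\<nu> j m), n)
            = (\<Oplus>\<^bsub>P.P\<^esub>k\<in>K. P.gen (f j, rsmult N (g k) (\<mu> k ?n)))" .
      next
        show "(\<lambda>j. \<Oplus>\<^bsub>P.P\<^esub>k\<in>K. P.gen (f j, rsmult N (g k) (\<mu> k (\<nu> j m \<odot>\<^bsub>N\<^esub> n)))) \<in> J \<rightarrow> carrier P.P"
          by (intro Pi_I P.P.finsum_closed P.gen_closed) (use m n \<nu> \<mu> basis in simp)
      qed simp
      also have "\<dots> = (\<Oplus>\<^bsub>P.P\<^esub>x\<in>J \<times> K. case x of (j, k) \<Rightarrow> P.gen (f j, rsmult N (g k) (\<mu> k (\<nu> j m \<odot>\<^bsub>N\<^esub> n))))"
        by (rule P.P.finsum_product[OF F.finite_index G.finite_index])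
          (use m n \<nu> \<mu> basis in \<open>auto intro!: P.gen_closed\<close>)
      also have "\<dots> = (\<Oplus>\<^bsub>P.P\<^esub>x\<in>J \<times> K. P.gen (tensor_r (C x y) (case x of (j, k) \<Rightarrow> (f j, g k))))"
        by (rule P.P.finsum_cong') (use m n \<nu> \<mu> basis in \<open>auto simp: C_def y intro!: P.gen_closed\<close>)
      finally show ?thesis by (simp add: y)
    qed
  qed
  then show ?thesis unfolding right_module_tensor by blast
qed

end

theorem tensor_biprojective:
  assumes M: "biprojective R M J" and N: "biprojective R N K"
  shows "biprojective R (tensor R M N) (J \<times> K)"
proof -
  interpret M: graded_bimod R M using M by (simp add: biprojective_def)
  interpret N: graded_bimod R N using N by (simp add: biprojective_def)
  interpret bimod_pair R M N ..
  show ?thesis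
    using M N tensor_bimod tensor_left_dual_basis tensor_right_dual_basis
    unfolding biprojective_def by blast
qed

subsection \<open>Bott-Samelson bimodules\<close>

definition bs_T3 :: "('a, 'y) ring_scheme \<Rightarrow> 'w list \<Rightarrow> ('a list \<times> 'a list \<times> 'a list) set" where
  "bs_T3 R ts = {(rs[i := a \<oplus>\<^bsub>R\<^esub> b], rs[i := a], rs[i := b]) | rs i a b.
     rs \<in> bs_gens R ts \<and> i < length rs \<and> a \<in> carrier R \<and> b \<in> carrier R}"

definition bs_T2 :: "('a, 'y) ring_scheme \<Rightarrow> ('w \<Rightarrow> 'a \<Rightarrow> 'a) \<Rightarrow> 'w list \<Rightarrow> ('a list \<times> 'a list) set" where
  "bs_T2 R act ts = {(rs[i := rs ! i \<otimes>\<^bsub>R\<^esub> a], rs[Suc i := a \<otimes>\<^bsub>R\<^esub> rs ! Suc i]) | rs i a.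
     rs \<in> bs_gens R ts \<and> i < length ts \<and> a \<in> invariants (carrier R) act (ts ! i)}"

lemma bs_relators: "bs_rels R act ts = relators (bs_T3 R ts) (bs_T2 R act ts)"
proof -
  have "{frag_of x - frag_of y - frag_of z | x y z. (x, y, z) \<in> bs_T3 R ts} =
      {frag_of (rs[i := a \<oplus>\<^bsub>R\<^esub> b]) - frag_of (rs[i := a]) - frag_of (rs[i := b]) | rs i a b.
        rs \<in> bs_gens R ts \<and> i < length rs \<and> a \<in> carrier R \<and> b \<in> carrier R}"
    unfolding bs_T3_def mem_Collect_eq
    by (rule Collect_cong, intro iffI; elim exE conjE; simp only: prod.inject; blast)
  moreover have "{frag_of x - frag_of y | x y. (x, y) \<in> bs_T2 R act ts} =
      {frag_of (rs[i := rs ! i \<otimes>\<^bsub>R\<^esub> a]) - frag_of (rs[Suc i := a \<otimes>\<^bsub>R\<^esub> rs ! Suc i]) | rs i a.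
        rs \<in> bs_gens R ts \<and> i < length ts \<and> a \<in> invariants (carrier R) act (ts ! i)}"
    unfolding bs_T2_def mem_Collect_eq
    by (rule Collect_cong, intro iffI; elim exE conjE; simp only: prod.inject; blast)
  ultimately show ?thesis
    unfolding bs_rels_def relators_def by simp
qed

lemma bs_compatible:
  "compatible (bs_gens R ts) (bs_T3 R ts) (bs_T2 R act ts) G f \<longleftrightarrow>
    (\<forall>rs\<in>bs_gens R ts. f rs \<in> carrier G) \<and>
    (\<forall>rs\<in>bs_gens R ts. \<forall>i<length rs. \<forall>a\<in>carrier R. \<forall>b\<in>carrier R.
      f (rs[i := a \<oplus>\<^bsub>R\<^esub> b]) = f (rs[i := a]) \<oplus>\<^bsub>G\<^esub> f (rs[i := b])) \<and>
    (\<forall>rs\<in>bs_gens R ts. \<forall>i<length ts. \<forall>a\<in>invariants (carrier R) act (ts ! i).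
      f (rs[i := rs ! i \<otimes>\<^bsub>R\<^esub> a]) = f (rs[Suc i := a \<otimes>\<^bsub>R\<^esub> rs ! Suc i]))"
  (is "_ \<longleftrightarrow> ?rhs")
proof
  assume "compatible (bs_gens R ts) (bs_T3 R ts) (bs_T2 R act ts) G f"
  then have X: "\<And>rs. rs \<in> bs_gens R ts \<Longrightarrow> f rs \<in> carrier G"
    and T3: "\<And>x y z. (x, y, z) \<in> bs_T3 R ts \<Longrightarrow> f x = f y \<oplus>\<^bsub>G\<^esub> f z"
    and T2: "\<And>x y. (x, y) \<in> bs_T2 R act ts \<Longrightarrow> f x = f y"
    by (auto simp: compatible_def)
  show ?rhs
    by (intro conjI ballI allI impI X T3 T2) (unfold bs_T3_def bs_T2_def, blast+)
next
  assume ?rhs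
  then show "compatible (bs_gens R ts) (bs_T3 R ts) (bs_T2 R act ts) G f"
    unfolding compatible_def bs_T3_def bs_T2_def by auto
qed

abbreviation bs_act :: "('a, 'y) ring_scheme \<Rightarrow> 'a \<Rightarrow> 'a list \<Rightarrow> 'a list" where
  "bs_act R a rs \<equiv> rs[0 := a \<otimes>\<^bsub>R\<^esub> rs ! 0]"

definition bs_degree :: "('a, 'y) graded_ring_scheme \<Rightarrow> 'a list \<Rightarrow> int \<Rightarrow> bool" where
  "bs_degree R rs d \<longleftrightarrow> (\<exists>ds. list_all2 (\<lambda>r e. r \<in> homog R e) rs ds \<and> sum_list ds = d)"

lemma bs_degree_rev: "bs_degree R (rev rs) d \<longleftrightarrow> bs_degree R rs d"
proof -
  have "bs_degree R (rev rs) d" if "bs_degree R rs d" for rs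
  proof -
    from that obtain ds where "list_all2 (\<lambda>r e. r \<in> homog R e) rs ds" "sum_list ds = d"
      by (auto simp: bs_degree_def)
    then show ?thesis
      unfolding bs_degree_def by (intro exI[of _ "rev ds"]) (simp add: list_all2_rev)
  qed
  from this[of rs] this[of "rev rs"] show ?thesis by auto
qed

lemma bs_degree_Nil: "bs_degree R [] d \<longleftrightarrow> d = 0"
  by (auto simp: bs_degree_def)

lemma bs_degree_Cons:
  "bs_degree R (r # rs) d \<longleftrightarrow> (\<exists>e. r \<in> homog R e \<and> bs_degree R rs (d - e))"
proof
  assume "bs_degree R (r # rs) d"
  then obtain e ds where "r \<in> homog R e" "list_all2 (\<lambda>r e. r \<in> homog R e) rs ds" "e + sum_list ds = d"
    by (auto simp: bs_degree_def list_all2_Cons1)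
  then show "\<exists>e. r \<in> homog R e \<and> bs_degree R rs (d - e)"
    by (intro exI[of _ e]) (auto simp: bs_degree_def)
next
  assume "\<exists>e. r \<in> homog R e \<and> bs_degree R rs (d - e)"
  then obtain e ds where "r \<in> homog R e" "list_all2 (\<lambda>r e. r \<in> homog R e) rs ds" "sum_list ds = d - e"
    by (auto simp: bs_degree_def)
  then show "bs_degree R (r # rs) d"
    unfolding bs_degree_def by (intro exI[of _ "e # ds"]) simp
qed

lemma bs_gens_update:
  "\<lbrakk>rs \<in> bs_gens R ts; a \<in> carrier R\<rbrakk> \<Longrightarrow> rs[i := a] \<in> bs_gens R ts"
  using set_update_subset_insert[of rs i a] by (auto simp: bs_gens_def)

lemma bs_gens_nth: "\<lbrakk>rs \<in> bs_gens R ts; i \<le> length ts\<rbrakk> \<Longrightarrow> rs ! i \<in> carrier R"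
  by (auto simp: bs_gens_def subset_iff)

lemma bs_gens_length: "rs \<in> bs_gens R ts \<Longrightarrow> length rs = Suc (length ts)"
  by (simp add: bs_gens_def)

lemma bs_gens_rev: "rs \<in> bs_gens R (rev ts) \<Longrightarrow> rev rs \<in> bs_gens R ts"
  by (simp add: bs_gens_def)

lemma bs_gens_Cons: "r # rs \<in> bs_gens R (t # ts) \<longleftrightarrow> r \<in> carrier R \<and> rs \<in> bs_gens R ts"
  by (auto simp: bs_gens_def)

lemma bs_gens_ConsE:
  assumes "rs \<in> bs_gens R (t # ts)"
  obtains r rs' where "rs = r # rs'" "r \<in> carrier R" "rs' \<in> bs_gens R ts"
  using assms by (cases rs) (auto simp: bs_gens_def)

context graded_coefficients
begin

lemma bs_presentation: "presentation (bs_gens R ts) (bs_T3 R ts) (bs_T2 R act ts)"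
  by unfold_locales
    (auto simp: bs_T3_def bs_T2_def invariants_def bs_gens_length intro!: bs_gens_update m_closed
      bs_gens_nth)

text \<open>Reversing lists identifies the right action on the bimodule of a reflection expression with the
  left action on the bimodule of the reversed expression, since it exchanges the two sides of the
  relation that moves an invariant across a tensor sign.\<close>

lemma compatible_rev:
  assumes f: "compatible (bs_gens R ts) (bs_T3 R ts) (bs_T2 R act ts) G f"
  shows "compatible (bs_gens R (rev ts)) (bs_T3 R (rev ts)) (bs_T2 R act (rev ts)) G (\<lambda>rs. f (rev rs))"
proof -
  note f = f[unfolded bs_compatible]
  have X: "f (rev rs) \<in> carrier G" if "rs \<in> bs_gens R (rev ts)" for rs
    using f bs_gens_rev[OF that] by blast
  have T3: "f (rev (rs[i := a \<oplus> b])) = f (rev (rs[i := a])) \<oplus>\<^bsub>G\<^esub> f (rev (rs[i := b]))"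
    if "rs \<in> bs_gens R (rev ts)" "i < length rs" "a \<in> carrier R" "b \<in> carrier R" for rs i a b
    using f bs_gens_rev[OF that(1)] that by (simp add: rev_update)
  have T2: "f (rev (rs[i := rs ! i \<otimes> a])) = f (rev (rs[Suc i := a \<otimes> rs ! Suc i]))"
    if rs: "rs \<in> bs_gens R (rev ts)" and i: "i < length ts"
      and a: "a \<in> invariants (carrier R) act (rev ts ! i)" for rs i a
  proof -
    define k where "k = length ts - Suc i"
    have k: "k < length ts" "Suc k = length ts - i" and len: "length rs = Suc (length ts)"
      using i bs_gens_length[OF rs] by (auto simp: k_def)
    have a': "a \<in> invariants (carrier R) act (ts ! k)" and aR: "a \<in> carrier R"
      using a i by (auto simp: rev_nth k_def invariants_def)
    have nth: "rev rs ! k = rs ! Suc i" "rev rs ! Suc k = rs ! i"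
      using i len by (auto simp: rev_nth k_def Suc_diff_Suc)
    have closed: "rs ! i \<in> carrier R" "rs ! Suc i \<in> carrier R"
      using bs_gens_nth[OF rs] i by auto
    have "f ((rev rs)[k := rev rs ! k \<otimes> a]) = f ((rev rs)[Suc k := a \<otimes> rev rs ! Suc k])"
      using f bs_gens_rev[OF rs] k(1) a' by blast
    then have "f ((rev rs)[k := a \<otimes> rs ! Suc i]) = f ((rev rs)[Suc k := rs ! i \<otimes> a])"
      using closed aR by (simp add: nth m_comm)
    moreover have "rev (rs[i := rs ! i \<otimes> a]) = (rev rs)[Suc k := rs ! i \<otimes> a]"
      "rev (rs[Suc i := a \<otimes> rs ! Suc i]) = (rev rs)[k := a \<otimes> rs ! Suc i]"
      using i len by (simp_all add: rev_update k_def Suc_diff_Suc)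
    ultimately show ?thesis by simp
  qed
  show ?thesis
    unfolding bs_compatible by (intro conjI ballI allI impI X T3) (simp_all add: T2)
qed

lemma compatible_act:
  assumes f: "compatible (bs_gens R ts) (bs_T3 R ts) (bs_T2 R act ts) G f" and a: "a \<in> carrier R"
  shows "compatible (bs_gens R ts) (bs_T3 R ts) (bs_T2 R act ts) G (\<lambda>rs. f (bs_act R a rs))"
proof -
  note f = f[unfolded bs_compatible]
  have act: "bs_act R a rs \<in> bs_gens R ts" if "rs \<in> bs_gens R ts" for rs
    using that a by (intro bs_gens_update m_closed bs_gens_nth) auto
  have X: "f (bs_act R a rs) \<in> carrier G" if "rs \<in> bs_gens R ts" for rs
    using f act[OF that] by blast
  have T3: "f (bs_act R a (rs[i := b \<oplus> c])) = f (bs_act R a (rs[i := b])) \<oplus>\<^bsub>G\<^esub> f (bs_act R a (rs[i := c]))"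
    if rs: "rs \<in> bs_gens R ts" and i: "i < length rs" and bc: "b \<in> carrier R" "c \<in> carrier R" for rs i b c
  proof (cases i)
    case 0
    then show ?thesis
      using f rs i bc a by (simp add: r_distr)
  next
    case (Suc j)
    then have "bs_act R a (rs[i := d]) = (bs_act R a rs)[i := d]" for d
      by (simp add: list_update_swap)
    then show ?thesis
      using f act[OF rs] i bc by simp
  qed
  have T2: "f (bs_act R a (rs[i := rs ! i \<otimes> b])) = f (bs_act R a (rs[Suc i := b \<otimes> rs ! Suc i]))"
    if rs: "rs \<in> bs_gens R ts" and i: "i < length ts"
      and b: "b \<in> invariants (carrier R) act (ts ! i)" for rs i b
  proof -
    have bR: "b \<in> carrier R" and rs0: "rs ! 0 \<in> carrier R" and len: "length rs = Suc (length ts)"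
      using b rs bs_gens_nth[OF rs, of 0] bs_gens_length by (auto simp: invariants_def)
    have "bs_act R a (rs[i := rs ! i \<otimes> b]) = (bs_act R a rs)[i := (bs_act R a rs) ! i \<otimes> b]"
      using a bR rs0 len by (cases i) (auto simp: m_assoc list_update_swap)
    moreover have "bs_act R a (rs[Suc i := b \<otimes> rs ! Suc i])
        = (bs_act R a rs)[Suc i := b \<otimes> (bs_act R a rs) ! Suc i]"
      by (simp add: list_update_swap)
    ultimately show ?thesis
      using f act[OF rs] i b by metis
  qed
  show ?thesis
    unfolding bs_compatible by (intro conjI ballI allI impI X T3 T2)
qed

lemma bs_left_presentation:
  "module_presentation R (bs_gens R ts) (bs_T3 R ts) (bs_T2 R act ts) (bs_act R) (bs_degree R)"
proof -
  interpret P: presentation "bs_gens R ts" "bs_T3 R ts" "bs_T2 R act ts" "bs_act R" "bs_degree R"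
    by (rule bs_presentation)
  note rel = P.gen_compatible
  show ?thesis
  proof (unfold_locales, goal_cases)
    case (1 a x)
    then show ?case by (intro bs_gens_update m_closed bs_gens_nth) auto
  next
    case (2 a)
    then show ?case using compatible_act[OF rel] by simp
  next
    case (3 a b x)
    then show ?case
      using rel[unfolded bs_compatible] bs_gens_nth[OF 3(3), of 0] bs_gens_length[OF 3(3)]
      by (simp add: l_distr)
  next
    case (4 a b x)
    then show ?case
      using bs_gens_nth[OF 4(3), of 0] bs_gens_length[OF 4(3)] by (simp add: m_assoc)
  next
    case (5 x)
    then show ?case using bs_gens_nth[OF 5, of 0] by simp
  next
    case (6 a d x e)
    then obtain r rs where x: "x = r # rs" by (cases x) (auto simp: bs_gens_def)
    with 6 obtain i where "r \<in> homog R i" "bs_degree R rs (e - i)" by (auto simp: bs_degree_Cons)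
    then show ?case
      using mult_homog[OF 6(1), of r i] by (auto simp: x bs_degree_Cons intro!: exI[of _ "d + i"])
  qed
qed

lemma bs_right_act:
  assumes "rs \<in> bs_gens R ts" "a \<in> carrier R"
  shows "rs[length ts := rs ! length ts \<otimes> a] = rev (bs_act R a (rev rs))"
  using assms bs_gens_length[OF assms(1)] bs_gens_nth[OF assms(1), of "length ts"]
  by (simp add: rev_update rev_nth m_comm)

lemma compatible_cong:
  assumes "presentation X T3 T2" "\<And>x. x \<in> X \<Longrightarrow> f x = g x" "compatible X T3 T2 G f"
  shows "compatible X T3 T2 G g"
proof -
  interpret presentation X T3 T2 by fact
  show ?thesis
    using assms(2,3) T3 T2 unfolding compatible_def by metis
qed

lemma bs_right_presentation:
  "module_presentation R (bs_gens R ts) (bs_T3 R ts) (bs_T2 R act ts)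
     (\<lambda>a rs. rs[length ts := rs ! length ts \<otimes> a]) (bs_degree R)"
proof -
  let ?r = "\<lambda>a rs. rs[length ts := rs ! length ts \<otimes> a]"
  interpret P: presentation "bs_gens R ts" "bs_T3 R ts" "bs_T2 R act ts" ?r "bs_degree R"
    by (rule bs_presentation)
  interpret Q: module_presentation R "bs_gens R (rev ts)" "bs_T3 R (rev ts)" "bs_T2 R act (rev ts)"
      "bs_act R" "bs_degree R"
    by (rule bs_left_presentation)
  have rev: "rev rs \<in> bs_gens R (rev ts)" if "rs \<in> bs_gens R ts" for rs
    using bs_gens_rev[of rs R "rev ts"] that by simp
  note rel = P.gen_compatible
  show ?thesis
  proof (unfold_locales, goal_cases)
    case (1 a x)
    then show ?case by (intro bs_gens_update m_closed bs_gens_nth) auto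
  next
    case (2 a)
    have "compatible (bs_gens R (rev (rev ts))) (bs_T3 R (rev (rev ts))) (bs_T2 R act (rev (rev ts))) P.P
        (\<lambda>rs. P.gen (rev (bs_act R a (rev rs))))"
      by (rule compatible_rev[OF compatible_act[OF compatible_rev[OF rel] 2]])
    then have "compatible (bs_gens R ts) (bs_T3 R ts) (bs_T2 R act ts) P.P
        (\<lambda>rs. P.gen (rev (bs_act R a (rev rs))))"
      by simp
    then show ?case
      by (rule compatible_cong[OF bs_presentation, rotated]) (simp only: bs_right_act 2)
  next
    case (3 a b x)
    then show ?case
      using rel[unfolded bs_compatible] bs_gens_nth[OF 3(3), of "length ts"] bs_gens_length[OF 3(3)]
      by (simp add: r_distr)
  next
    case (4 a b x)
    then show ?case
      using bs_gens_nth[OF 4(3), of "length ts"] bs_gens_length[OF 4(3)] by (simp add: m_ac)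
  next
    case (5 x)
    then show ?case using bs_gens_nth[OF 5, of "length ts"] by simp
  next
    case (6 a d x e)
    then have "bs_degree R (bs_act R a (rev x)) (d + e)"
      using Q.l_degree[OF 6(1) rev[OF 6(2)], of e] by (simp add: bs_degree_rev)
    then show ?case
      using bs_right_act[OF 6(2), of a] homog_carrier[OF 6(1)] by (simp add: bs_degree_rev)
  qed
qed

lemma bott_samelson_bimod: "graded_bimod R (bott_samelson R act ts)"
proof -
  have "graded_bimod R (presented_bimodule (bs_gens R ts) (relators (bs_T3 R ts) (bs_T2 R act ts))
      (bs_act R) (\<lambda>rs a. rs[length ts := rs ! length ts \<otimes> a]) (bs_degree R))"
  proof (rule presented_bimodule_bimod[OF bs_left_presentation bs_right_presentation])
    fix a b rs assume a: "a \<in> carrier R" and b: "b \<in> carrier R" and rs: "rs \<in> bs_gens R ts"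
    show "bs_act R a (rs[length ts := rs ! length ts \<otimes> b])
        = (bs_act R a rs)[length ts := bs_act R a rs ! length ts \<otimes> b]"
      using a b bs_gens_length[OF rs] bs_gens_nth[OF rs, of 0]
      by (cases ts) (auto simp: m_assoc list_update_swap)
  qed
  then show ?thesis
    by (simp add: bott_samelson_def bs_relators bs_degree_def[abs_def])
qed

lemma left_module_bott_samelson:
  "left_module (bott_samelson R act ts)
    = presented_module (bs_gens R ts) (relators (bs_T3 R ts) (bs_T2 R act ts)) (bs_act R) (bs_degree R)"
  by (simp add: bott_samelson_def left_presented_bimodule bs_relators bs_degree_def[abs_def])

lemma right_module_bott_samelson:
  "right_module (bott_samelson R act ts)
    = presented_module (bs_gens R ts) (relators (bs_T3 R ts) (bs_T2 R act ts))
        (\<lambda>a rs. rs[length ts := rs ! length ts \<otimes> a]) (bs_degree R)"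
  by (simp add: bott_samelson_def right_presented_bimodule bs_relators bs_degree_def[abs_def])

end

text \<open>A homogeneous dual basis with two members of \<open>R\<close> as a module over its subring of
  \<open>\<tau>\<close>-invariants.\<close>

definition invariant_dual_basis ::
    "('a, 'y) graded_ring_scheme \<Rightarrow> ('a \<Rightarrow> 'a) \<Rightarrow> (bool \<Rightarrow> 'a \<Rightarrow> 'a) \<Rightarrow> (bool \<Rightarrow> 'a) \<Rightarrow> (bool \<Rightarrow> int) \<Rightarrow> bool"
  where
  "invariant_dual_basis R \<tau> D b deg \<longleftrightarrow> (\<forall>i.
     (\<forall>r\<in>carrier R. D i r \<in> carrier R \<and> \<tau> (D i r) = D i r) \<and>
     (\<forall>r\<in>carrier R. \<forall>s\<in>carrier R. D i (r \<oplus>\<^bsub>R\<^esub> s) = D i r \<oplus>\<^bsub>R\<^esub> D i s) \<and>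
     (\<forall>a\<in>carrier R. \<tau> a = a \<longrightarrow> (\<forall>r\<in>carrier R. D i (a \<otimes>\<^bsub>R\<^esub> r) = a \<otimes>\<^bsub>R\<^esub> D i r)) \<and>
     (\<forall>d. \<forall>r\<in>homog R d. D i r \<in> homog R (d - deg i)) \<and> b i \<in> homog R (deg i) \<and>
     (\<forall>r\<in>carrier R. r = D False r \<otimes>\<^bsub>R\<^esub> b False \<oplus>\<^bsub>R\<^esub> D True r \<otimes>\<^bsub>R\<^esub> b True))"

locale invariant_dual_bases = graded_coefficients R
  for R :: "('a, 'y) graded_ring_scheme" (structure) +
  fixes act :: "'w \<Rightarrow> 'a \<Rightarrow> 'a" and T :: "'w set"
    and D :: "'w \<Rightarrow> bool \<Rightarrow> 'a \<Rightarrow> 'a" and b :: "'w \<Rightarrow> bool \<Rightarrow> 'a" and deg :: "'w \<Rightarrow> bool \<Rightarrow> int"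
  assumes dual_basis: "t \<in> T \<Longrightarrow> invariant_dual_basis R (act t) (D t) (b t) (deg t)"
begin

lemma D_invariant: "\<lbrakk>t \<in> T; r \<in> carrier R\<rbrakk> \<Longrightarrow> D t e r \<in> invariants (carrier R) act t"
  and D_add: "\<lbrakk>t \<in> T; r \<in> carrier R; s \<in> carrier R\<rbrakk> \<Longrightarrow> D t e (r \<oplus> s) = D t e r \<oplus> D t e s"
  and D_linear: "\<lbrakk>t \<in> T; a \<in> invariants (carrier R) act t; r \<in> carrier R\<rbrakk> \<Longrightarrow> D t e (a \<otimes> r) = a \<otimes> D t e r"
  and D_degree: "\<lbrakk>t \<in> T; r \<in> homog R d\<rbrakk> \<Longrightarrow> D t e r \<in> homog R (d - deg t e)"
  and b_degree: "t \<in> T \<Longrightarrow> b t e \<in> homog R (deg t e)"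
  and D_expand: "\<lbrakk>t \<in> T; r \<in> carrier R\<rbrakk> \<Longrightarrow> r = D t False r \<otimes> b t False \<oplus> D t True r \<otimes> b t True"
  using dual_basis[of t] unfolding invariant_dual_basis_def invariants_def mem_Collect_eq by blast+

text \<open>The coordinates of \<open>r\<^sub>0 \<otimes> \<dots> \<otimes> r\<^sub>n\<close> are computed from the right: \<open>r\<^sub>n\<close> is split over the
  invariants of the last reflection, its invariant coordinate moves into \<open>r\<^bsub>n-1\<^esub>\<close>, and the
  procedure continues with this factor.  The list \<open>es\<close> records which of the two basis elements is
  taken at each step.\<close>

primrec bs_coeff :: "'w list \<Rightarrow> bool list \<Rightarrow> 'a list \<Rightarrow> 'a" where
  "bs_coeff [] es rs = hd rs"
| "bs_coeff (t # ts) es rs = hd rs \<otimes> D t (hd es) (bs_coeff ts (tl es) (tl rs))"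

primrec bs_tail :: "'w list \<Rightarrow> bool list \<Rightarrow> 'a list" where
  "bs_tail [] es = []"
| "bs_tail (t # ts) es = b t (hd es) # bs_tail ts (tl es)"

primrec bs_shift :: "'w list \<Rightarrow> bool list \<Rightarrow> int" where
  "bs_shift [] es = 0"
| "bs_shift (t # ts) es = deg t (hd es) + bs_shift ts (tl es)"

lemma D_closed: "\<lbrakk>t \<in> T; r \<in> carrier R\<rbrakk> \<Longrightarrow> D t e r \<in> carrier R"
  using D_invariant by (auto simp: invariants_def)

lemma b_closed: "t \<in> T \<Longrightarrow> b t e \<in> carrier R"
  using b_degree homog_carrier by blast

lemma bs_coeff_closed: "\<lbrakk>set ts \<subseteq> T; rs \<in> bs_gens R ts\<rbrakk> \<Longrightarrow> bs_coeff ts es rs \<in> carrier R"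
proof (induction ts arbitrary: es rs)
  case Nil
  then show ?case by (cases rs) (auto simp: bs_gens_def)
next
  case (Cons t ts)
  then show ?case by (auto elim!: bs_gens_ConsE intro!: D_closed)
qed

lemma bs_tail_gens: "\<lbrakk>set ts \<subseteq> T; r \<in> carrier R\<rbrakk> \<Longrightarrow> r # bs_tail ts es \<in> bs_gens R ts"
  by (induction ts arbitrary: es r) (auto simp: bs_gens_def b_closed)

lemma bs_coeff_act:
  "\<lbrakk>set ts \<subseteq> T; r # rs \<in> bs_gens R ts; a \<in> carrier R\<rbrakk> \<Longrightarrow>
     bs_coeff ts es ((a \<otimes> r) # rs) = a \<otimes> bs_coeff ts es (r # rs)"
  by (cases ts) (auto simp: bs_gens_Cons m_assoc D_closed bs_coeff_closed)

lemma bs_coeff_add: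
  "\<lbrakk>set ts \<subseteq> T; rs \<in> bs_gens R ts; i < length rs; a \<in> carrier R; c \<in> carrier R\<rbrakk> \<Longrightarrow>
     bs_coeff ts es (rs[i := a \<oplus> c]) = bs_coeff ts es (rs[i := a]) \<oplus> bs_coeff ts es (rs[i := c])"
proof (induction ts arbitrary: es rs i)
  case Nil
  then show ?case by (cases rs) (auto simp: bs_gens_def)
next
  case (Cons t ts)
  from Cons.prems(2) obtain r rs' where rs: "rs = r # rs'" "r \<in> carrier R" "rs' \<in> bs_gens R ts"
    by (rule bs_gens_ConsE)
  show ?case
  proof (cases i)
    case 0
    then show ?thesis
      using Cons.prems rs by (simp add: l_distr D_closed bs_coeff_closed)
  next
    case (Suc j)
    then have "bs_coeff ts (tl es) (rs'[j := a \<oplus> c])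
        = bs_coeff ts (tl es) (rs'[j := a]) \<oplus> bs_coeff ts (tl es) (rs'[j := c])"
      using Cons.prems rs by (intro Cons.IH) auto
    then show ?thesis
      using Suc Cons.prems rs
      by (simp add: D_add r_distr D_closed bs_coeff_closed bs_gens_update)
  qed
qed

lemma bs_coeff_balanced:
  "\<lbrakk>set ts \<subseteq> T; rs \<in> bs_gens R ts; i < length ts; a \<in> invariants (carrier R) act (ts ! i)\<rbrakk> \<Longrightarrow>
     bs_coeff ts es (rs[i := rs ! i \<otimes> a]) = bs_coeff ts es (rs[Suc i := a \<otimes> rs ! Suc i])"
proof (induction ts arbitrary: es rs i)
  case (Cons t ts)
  from Cons.prems(2) obtain r rs' where rs: "rs = r # rs'" "r \<in> carrier R" "rs' \<in> bs_gens R ts"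
    by (rule bs_gens_ConsE)
  show ?case
  proof (cases i)
    case 0
    have a: "a \<in> invariants (carrier R) act t" "a \<in> carrier R"
      using Cons.prems(4) 0 by (auto simp: invariants_def)
    obtain r' rs'' where rs': "rs' = r' # rs''"
      using rs(3) by (cases rs') (auto simp: bs_gens_def)
    then show ?thesis
      using 0 Cons.prems rs a
      by (simp add: bs_coeff_act D_linear bs_coeff_closed D_closed m_assoc)
  next
    case (Suc j)
    then show ?thesis
      using Cons.prems rs Cons.IH[of rs' j "tl es"] by simp
  qed
qed simp

lemma bs_coeff_degree:
  "\<lbrakk>set ts \<subseteq> T; rs \<in> bs_gens R ts; bs_degree R rs d\<rbrakk> \<Longrightarrow>
     bs_coeff ts es rs \<in> homog R (d - bs_shift ts es)"
proof (induction ts arbitrary: es rs d)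
  case Nil
  then show ?case by (cases rs) (auto simp: bs_gens_def bs_degree_Cons bs_degree_Nil)
next
  case (Cons t ts)
  from Cons.prems(2) obtain r rs' where rs: "rs = r # rs'" "r \<in> carrier R" "rs' \<in> bs_gens R ts"
    by (rule bs_gens_ConsE)
  with Cons.prems obtain e where r: "r \<in> homog R e" and rs'_deg: "bs_degree R rs' (d - e)"
    by (auto simp: bs_degree_Cons)
  have "bs_coeff ts (tl es) rs' \<in> homog R (d - e - bs_shift ts (tl es))"
    using Cons.prems rs rs'_deg by (intro Cons.IH) auto
  then have "D t (hd es) (bs_coeff ts (tl es) rs') \<in> homog R (d - e - bs_shift ts (tl es) - deg t (hd es))"
    using Cons.prems by (intro D_degree) auto
  from mult_homog[OF r this] show ?case
    by (simp add: rs algebra_simps)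
qed

lemma bs_tail_degree: "set ts \<subseteq> T \<Longrightarrow> bs_degree R (bs_tail ts es) (bs_shift ts es)"
proof (induction ts arbitrary: es)
  case Nil
  show ?case by (simp add: bs_degree_def)
next
  case (Cons t ts)
  then show ?case
    by (auto simp: bs_degree_Cons b_degree intro!: exI[of _ "deg t (hd es)"])
qed

text \<open>The expansion is stated for an arbitrary map that is compatible with the relations, because
  prefixing one factor turns such a map into one for a shorter expression, to which the induction
  hypothesis applies.\<close>

lemma bs_coeff_span:
  assumes Q: "abelian_group Q"
  shows "\<lbrakk>set ts \<subseteq> T; compatible (bs_gens R ts) (bs_T3 R ts) (bs_T2 R act ts) Q f; rs \<in> bs_gens R ts\<rbrakk> \<Longrightarrow>
     f rs = (\<Oplus>\<^bsub>Q\<^esub>es\<in>{es. length es = length ts}. f (bs_coeff ts es rs # bs_tail ts es))"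
proof (induction ts arbitrary: f rs)
  interpret Q: abelian_group Q by fact
  case Nil
  have "{es :: bool list. length es = length []} = {[]}" by auto
  moreover have "f rs \<in> carrier Q" using Nil by (auto simp: bs_compatible)
  moreover have "[hd rs] = rs" using Nil by (cases rs) (auto simp: bs_gens_def)
  ultimately show ?case by simp
next
  interpret Q: abelian_group Q by fact
  case (Cons t ts)
  note f = Cons.prems(2)[unfolded bs_compatible]
  have f_closed: "f xs \<in> carrier Q" if "xs \<in> bs_gens R (t # ts)" for xs
    using f that by blast
  from Cons.prems(3) obtain r rs' where rs: "rs = r # rs'" "r \<in> carrier R" "rs' \<in> bs_gens R ts"
    by (rule bs_gens_ConsE)
  have t: "t \<in> T" and ts: "set ts \<subseteq> T" using Cons.prems(1) by auto
  let ?E = "{es :: bool list. length es = length ts}"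
  have fin: "finite ?E" using finite_lists_length_eq[of "UNIV :: bool set" "length ts"] by simp
  have "compatible (bs_gens R ts) (bs_T3 R ts) (bs_T2 R act ts) Q (\<lambda>xs. f (r # xs))"
    unfolding bs_compatible
  proof (intro conjI ballI allI impI)
    show "f (r # xs) \<in> carrier Q" if "xs \<in> bs_gens R ts" for xs
      using that rs f_closed by (simp add: bs_gens_Cons)
    show "f (r # xs[i := a \<oplus> c]) = f (r # xs[i := a]) \<oplus>\<^bsub>Q\<^esub> f (r # xs[i := c])"
      if "xs \<in> bs_gens R ts" "i < length xs" "a \<in> carrier R" "c \<in> carrier R" for xs i a c
    proof -
      have "r # xs \<in> bs_gens R (t # ts)" "Suc i < length (r # xs)"
        using that rs by (auto simp: bs_gens_Cons)
      then have "f ((r # xs)[Suc i := a \<oplus> c]) = f ((r # xs)[Suc i := a]) \<oplus>\<^bsub>Q\<^esub> f ((r # xs)[Suc i := c])"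
        using f that by blast
      then show ?thesis by simp
    qed
    show "f (r # xs[i := xs ! i \<otimes> a]) = f (r # xs[Suc i := a \<otimes> xs ! Suc i])"
      if "xs \<in> bs_gens R ts" "i < length ts" "a \<in> invariants (carrier R) act (ts ! i)" for xs i a
    proof -
      have "r # xs \<in> bs_gens R (t # ts)" "Suc i < length (t # ts)"
          "a \<in> invariants (carrier R) act ((t # ts) ! Suc i)"
        using that rs by (auto simp: bs_gens_Cons)
      then have "f ((r # xs)[Suc i := (r # xs) ! Suc i \<otimes> a])
          = f ((r # xs)[Suc (Suc i) := a \<otimes> (r # xs) ! Suc (Suc i)])"
        using f by blast
      then show ?thesis by simp
    qed
  qed
  from Cons.IH[OF ts this rs(3)]
  have "f rs = (\<Oplus>\<^bsub>Q\<^esub>es\<in>?E. f (r # bs_coeff ts es rs' # bs_tail ts es))"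
    by (simp add: rs)
  also have "\<dots> = (\<Oplus>\<^bsub>Q\<^esub>es\<in>?E. f (bs_coeff (t # ts) (False # es) rs # bs_tail (t # ts) (False # es))
      \<oplus>\<^bsub>Q\<^esub> f (bs_coeff (t # ts) (True # es) rs # bs_tail (t # ts) (True # es)))"
  proof (rule Q.finsum_cong')
    fix es assume "es \<in> ?E"
    let ?c = "bs_coeff ts es rs'"
    have c: "?c \<in> carrier R" using ts rs bs_coeff_closed by blast
    have "f (r # ?c # bs_tail ts es)
        = f (r # (D t False ?c \<otimes> b t False \<oplus> D t True ?c \<otimes> b t True) # bs_tail ts es)"
      using D_expand[OF t c] by simp
    also have "\<dots> = f (r # (D t False ?c \<otimes> b t False) # bs_tail ts es)
        \<oplus>\<^bsub>Q\<^esub> f (r # (D t True ?c \<otimes> b t True) # bs_tail ts es)"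
    proof -
      have "r # ?c # bs_tail ts es \<in> bs_gens R (t # ts)" "Suc 0 < length (r # ?c # bs_tail ts es)"
        using rs bs_tail_gens[OF ts c] by (auto simp: bs_gens_Cons)
      then have "f ((r # ?c # bs_tail ts es)[Suc 0 := u \<oplus> v])
          = f ((r # ?c # bs_tail ts es)[Suc 0 := u]) \<oplus>\<^bsub>Q\<^esub> f ((r # ?c # bs_tail ts es)[Suc 0 := v])"
        if "u \<in> carrier R" "v \<in> carrier R" for u v
        using f that by blast
      then show ?thesis using t c D_closed b_closed by simp
    qed
    finally have "f (r # ?c # bs_tail ts es) = f (r # (D t False ?c \<otimes> b t False) # bs_tail ts es)
        \<oplus>\<^bsub>Q\<^esub> f (r # (D t True ?c \<otimes> b t True) # bs_tail ts es)" .
    moreover have "f (r # (D t e ?c \<otimes> b t e) # bs_tail ts es)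
        = f ((r \<otimes> D t e ?c) # b t e # bs_tail ts es)" for e
    proof -
      have "r # b t e # bs_tail ts es \<in> bs_gens R (t # ts)" "0 < length (t # ts)"
          "D t e ?c \<in> invariants (carrier R) act ((t # ts) ! 0)"
        using rs bs_tail_gens[OF ts b_closed[OF t]] D_invariant[OF t c] by (auto simp: bs_gens_Cons)
      then have "f ((r # b t e # bs_tail ts es)[0 := (r # b t e # bs_tail ts es) ! 0 \<otimes> D t e ?c])
          = f ((r # b t e # bs_tail ts es)[Suc 0 := D t e ?c \<otimes> (r # b t e # bs_tail ts es) ! Suc 0])"
        using f by blast
      then show ?thesis by simp
    qed
    ultimately show "f (r # ?c # bs_tail ts es)
        = f (bs_coeff (t # ts) (False # es) rs # bs_tail (t # ts) (False # es))
          \<oplus>\<^bsub>Q\<^esub> f (bs_coeff (t # ts) (True # es) rs # bs_tail (t # ts) (True # es))"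
      by (simp add: rs)
  next
    show "(\<lambda>es. f (bs_coeff (t # ts) (False # es) rs # bs_tail (t # ts) (False # es))
      \<oplus>\<^bsub>Q\<^esub> f (bs_coeff (t # ts) (True # es) rs # bs_tail (t # ts) (True # es))) \<in> ?E \<rightarrow> carrier Q"
      by (intro Pi_I Q.add.m_closed f_closed bs_tail_gens bs_coeff_closed Cons.prems)
  qed simp
  also have "\<dots> = (\<Oplus>\<^bsub>Q\<^esub>es\<in>?E. f (bs_coeff (t # ts) (False # es) rs # bs_tail (t # ts) (False # es)))
      \<oplus>\<^bsub>Q\<^esub> (\<Oplus>\<^bsub>Q\<^esub>es\<in>?E. f (bs_coeff (t # ts) (True # es) rs # bs_tail (t # ts) (True # es)))"
    by (rule Q.finsum_addf; intro Pi_I f_closed bs_tail_gens bs_coeff_closed Cons.prems)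
  also have "\<dots> = (\<Oplus>\<^bsub>Q\<^esub>es\<in>Cons False ` ?E. f (bs_coeff (t # ts) es rs # bs_tail (t # ts) es))
      \<oplus>\<^bsub>Q\<^esub> (\<Oplus>\<^bsub>Q\<^esub>es\<in>Cons True ` ?E. f (bs_coeff (t # ts) es rs # bs_tail (t # ts) es))"
    by (subst (1 2) Q.finsum_reindex)
      (auto intro!: f_closed bs_tail_gens bs_coeff_closed Cons.prems simp del: bs_coeff.simps bs_tail.simps)
  also have "\<dots> = (\<Oplus>\<^bsub>Q\<^esub>es\<in>Cons False ` ?E \<union> Cons True ` ?E. f (bs_coeff (t # ts) es rs # bs_tail (t # ts) es))"
    by (rule Q.finsum_Un_disjoint[symmetric])
      (use fin in \<open>auto intro!: f_closed bs_tail_gens bs_coeff_closed Cons.prems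
        simp del: bs_coeff.simps bs_tail.simps\<close>)
  also have "Cons False ` ?E \<union> Cons True ` ?E = {es. length es = length (t # ts)}"
  proof -
    have "es \<in> Cons False ` ?E \<union> Cons True ` ?E" if "length es = Suc (length ts)" for es
      using that by (cases es) (auto simp: image_iff)
    then show ?thesis by auto
  qed
  finally show ?case .
qed

theorem bott_samelson_biprojective:
  assumes ts: "set ts \<subseteq> T"
  shows "biprojective R (bott_samelson R act ts) {es :: bool list. length es = length ts}"
proof -
  let ?E = "{es :: bool list. length es = length ts}"
  have fin: "finite ?E" using finite_lists_length_eq[of "UNIV :: bool set" "length ts"] by simp
  have coeff: "compatible (bs_gens R ts) (bs_T3 R ts) (bs_T2 R act ts) R (bs_coeff ts es)"
    if "set ts \<subseteq> T" for ts es
    unfolding bs_compatible using that bs_coeff_closed bs_coeff_add bs_coeff_balanced by blast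
  have l_tail: "bs_act R a (\<one> # bs_tail ts es) = a # bs_tail ts es" if "a \<in> carrier R" for a ts es
    using that by simp
  have tail_deg: "bs_degree R (\<one> # bs_tail ts es) (bs_shift ts es)" if "set ts \<subseteq> T" for ts es
    using bs_tail_degree[OF that] one_homog by (auto simp: bs_degree_Cons intro!: exI[of _ 0])
  interpret L: module_presentation R "bs_gens R ts" "bs_T3 R ts" "bs_T2 R act ts" "bs_act R" "bs_degree R"
    by (rule bs_left_presentation)
  have "\<exists>\<eta>. homog_dual_basis R L.P ?E (\<lambda>es. L.gen (\<one> # bs_tail ts es)) \<eta> (\<lambda>es. - bs_shift ts es)"
  proof (rule L.presented_dual_basis[where F = "bs_coeff ts"])
    show "bs_coeff ts es (bs_act R a rs) = a \<otimes> bs_coeff ts es rs"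
      if "a \<in> carrier R" "rs \<in> bs_gens R ts" for es a rs
      using that ts bs_coeff_act[OF ts] by (cases rs) (auto simp: bs_gens_def)
    show "bs_coeff ts es rs \<in> homog R (d + - bs_shift ts es)"
      if "rs \<in> bs_gens R ts" "bs_degree R rs d" for es rs d
      using bs_coeff_degree[OF ts that] by simp
    show "L.gen rs = (\<Oplus>\<^bsub>L.P\<^esub>es\<in>?E. L.gen (bs_act R (bs_coeff ts es rs) (\<one> # bs_tail ts es)))"
      if "rs \<in> bs_gens R ts" for rs
      using bs_coeff_span[OF L.P_abelian ts L.gen_compatible that] bs_coeff_closed[OF ts that]
      by (simp add: l_tail)
  qed (use fin ts coeff tail_deg bs_tail_gens in auto)
  then have left: "\<exists>f \<nu> e. homog_dual_basis R (left_module (bott_samelson R act ts)) ?E f \<nu> e"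
    unfolding left_module_bott_samelson by blast
  let ?r = "\<lambda>a rs. rs[length ts := rs ! length ts \<otimes> a]"
  have rts: "set (rev ts) \<subseteq> T" using ts by simp
  have rev: "rev rs \<in> bs_gens R (rev ts)" if "rs \<in> bs_gens R ts" for rs
    using bs_gens_rev[of rs R "rev ts"] that by simp
  interpret Rt: module_presentation R "bs_gens R ts" "bs_T3 R ts" "bs_T2 R act ts" ?r "bs_degree R"
    by (rule bs_right_presentation)
  have "\<exists>\<eta>. homog_dual_basis R Rt.P ?E (\<lambda>es. Rt.gen (rev (\<one> # bs_tail (rev ts) es))) \<eta>
      (\<lambda>es. - bs_shift (rev ts) es)"
  proof (rule Rt.presented_dual_basis[where F = "\<lambda>es rs. bs_coeff (rev ts) es (rev rs)"])
    show "compatible (bs_gens R ts) (bs_T3 R ts) (bs_T2 R act ts) R (\<lambda>rs. bs_coeff (rev ts) es (rev rs))" for es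
      using compatible_rev[OF coeff[OF rts]] by simp
    show "bs_coeff (rev ts) es (rev (?r a rs)) = a \<otimes> bs_coeff (rev ts) es (rev rs)"
      if a: "a \<in> carrier R" and rs: "rs \<in> bs_gens R ts" for es a rs
    proof -
      obtain x xs where x: "rev rs = x # xs"
        using rev[OF rs] by (cases "rev rs") (auto simp: bs_gens_def)
      show ?thesis
        using a rev[OF rs] bs_coeff_act[OF rts, of x xs a es]
        unfolding bs_right_act[OF rs a] by (simp add: x)
    qed
    show "bs_coeff (rev ts) es (rev rs) \<in> homog R (d + - bs_shift (rev ts) es)"
      if "rs \<in> bs_gens R ts" "bs_degree R rs d" for es rs d
      using bs_coeff_degree[OF rts rev[OF that(1)], of d] that(2) by (simp add: bs_degree_rev)
    show "rev (\<one> # bs_tail (rev ts) es) \<in> bs_gens R ts" for es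
      by (rule bs_gens_rev) (rule bs_tail_gens[OF rts], simp)
    then show "Rt.gen rs = (\<Oplus>\<^bsub>Rt.P\<^esub>es\<in>?E. Rt.gen (?r (bs_coeff (rev ts) es (rev rs)) (rev (\<one> # bs_tail (rev ts) es))))"
      if "rs \<in> bs_gens R ts" for rs
      using bs_coeff_span[OF Rt.P_abelian rts compatible_rev[OF Rt.gen_compatible] rev[OF that]]
        bs_coeff_closed[OF rts rev[OF that]]
      by (simp add: bs_right_act l_tail del: rev.simps)
    show "bs_degree R (rev (\<one> # bs_tail (rev ts) es)) (- (- bs_shift (rev ts) es))" for es
      using tail_deg[OF rts] by (simp add: bs_degree_rev del: rev.simps)
  qed (use fin in auto)
  then have "\<exists>f \<nu> e. homog_dual_basis R (right_module (bott_samelson R act ts)) ?E f \<nu> e"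
    unfolding right_module_bott_samelson by blast
  with left show ?thesis
    unfolding biprojective_def using bott_samelson_bimod by blast
qed

end

section \<open>Symmetric algebras\<close>

subsection \<open>Monoid algebras of multisets\<close>

lemma update_eq_single_add:
  "m \<notin> Poly_Mapping.keys p \<Longrightarrow> Poly_Mapping.update m k p = Poly_Mapping.single m k + p"
  by (intro poly_mapping_eqI)
    (auto simp: lookup_update lookup_add lookup_single when_def in_keys_iff)

lemma poly_mapping_induct [case_names zero single add]:
  fixes p :: "'m \<Rightarrow>\<^sub>0 'k::comm_monoid_add"
  assumes "P 0" and "\<And>m k. P (Poly_Mapping.single m k)" and "\<And>p q. \<lbrakk>P p; P q\<rbrakk> \<Longrightarrow> P (p + q)"
  shows "P p"
proof (induction p rule: update_induct)
  case (update p m k)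
  then show ?case using assms(3)[OF assms(2)[of m k]] by (simp add: update_eq_single_add)
qed (rule assms)

text \<open>The ring homomorphism on the monoid algebra induced by a ring homomorphism \<open>c\<close> and a monoid
  homomorphism \<open>h\<close>.\<close>

definition mono_eval :: "('k::comm_ring_1 \<Rightarrow> 'r::comm_ring_1) \<Rightarrow> ('m \<Rightarrow> 'r) \<Rightarrow> ('m \<Rightarrow>\<^sub>0 'k) \<Rightarrow> 'r" where
  "mono_eval c h p = (\<Sum>m\<in>Poly_Mapping.keys p. c (Poly_Mapping.lookup p m) * h m)"

locale monomial_evaluation =
  fixes c :: "'k::comm_ring_1 \<Rightarrow> 'r::comm_ring_1" and h :: "'m::comm_monoid_add \<Rightarrow> 'r"
  assumes c_add: "c (x + y) = c x + c y" and c_mult: "c (x * y) = c x * c y" and c_one: "c 1 = 1"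
    and h_add: "h (m + n) = h m * h n" and h_zero: "h 0 = 1"
begin

lemma c_zero: "c 0 = 0"
  using c_add[of 0 0] by simp

lemma eval_superset:
  "\<lbrakk>finite A; Poly_Mapping.keys p \<subseteq> A\<rbrakk> \<Longrightarrow> mono_eval c h p = (\<Sum>m\<in>A. c (Poly_Mapping.lookup p m) * h m)"
  unfolding mono_eval_def by (rule sum.mono_neutral_left) (auto simp: c_zero in_keys_iff)

lemma eval_add: "mono_eval c h (p + q) = mono_eval c h p + mono_eval c h q"
proof -
  let ?A = "Poly_Mapping.keys p \<union> Poly_Mapping.keys q"
  have "mono_eval c h (p + q) = (\<Sum>m\<in>?A. c (Poly_Mapping.lookup (p + q) m) * h m)"
    by (rule eval_superset) (auto dest: subsetD[OF keys_add])
  also have "\<dots> = (\<Sum>m\<in>?A. c (Poly_Mapping.lookup p m) * h m) + (\<Sum>m\<in>?A. c (Poly_Mapping.lookup q m) * h m)"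
    by (simp add: lookup_add c_add algebra_simps sum.distrib)
  finally show ?thesis
    by (simp add: eval_superset[of ?A])
qed

lemma eval_zero: "mono_eval c h 0 = 0"
  by (simp add: mono_eval_def)

lemma eval_single: "mono_eval c h (Poly_Mapping.single m k) = c k * h m"
  using eval_superset[of "{m}" "Poly_Mapping.single m k"] by simp

lemma eval_mult: "mono_eval c h (p * q) = mono_eval c h p * mono_eval c h q"
proof (induction p rule: poly_mapping_induct)
  case (single m k)
  show ?case
    by (induction q rule: poly_mapping_induct)
      (simp_all add: eval_zero mult_single eval_single c_mult h_add eval_add algebra_simps)
qed (simp_all add: eval_zero eval_add algebra_simps)

lemma eval_one: "mono_eval c h 1 = 1"
  using eval_single[of 0 1] by (simp add: c_one h_zero)

lemma eval_minus: "mono_eval c h (p - q) = mono_eval c h p - mono_eval c h q"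
  using eval_add[of "p - q" q] by (simp add: algebra_simps)

end

lemma poly_map_eval:
  "poly_map f = mono_eval (Poly_Mapping.single 0) (\<lambda>m. Poly_Mapping.single (image_mset f m) 1)"
  by (intro ext) (simp add: poly_map_def mono_eval_def mult_single)

interpretation poly_map: monomial_evaluation "Poly_Mapping.single 0 :: 'k::field \<Rightarrow> ('v multiset \<Rightarrow>\<^sub>0 'k)"
    "\<lambda>m. Poly_Mapping.single (image_mset f m) 1" for f :: "'v \<Rightarrow> 'v"
  by unfold_locales (simp_all add: single_add mult_single)

lemmas poly_map_simps = poly_map.eval_add[folded poly_map_eval] poly_map.eval_mult[folded poly_map_eval]
  poly_map.eval_one[folded poly_map_eval] poly_map.eval_zero[folded poly_map_eval]
  poly_map.eval_minus[folded poly_map_eval]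

lemma poly_map_single: "poly_map f (Poly_Mapping.single m k) = Poly_Mapping.single (image_mset f m) k"
  by (simp add: poly_map_eval poly_map.eval_single mult_single)

lemma poly_map_comp: "poly_map f (poly_map g p) = poly_map (f \<circ> g) p"
  by (induction p rule: poly_mapping_induct)
    (simp_all add: poly_map_simps poly_map_single multiset.map_comp comp_def)

lemma poly_map_id: "poly_map id p = p"
  by (induction p rule: poly_mapping_induct) (simp_all add: poly_map_simps poly_map_single)

lemma keys_poly_map: "Poly_Mapping.keys (poly_map f p) \<subseteq> image_mset f ` Poly_Mapping.keys p"
proof -
  have "Poly_Mapping.keys (poly_map f p) \<subseteq>
      (\<Union>m\<in>Poly_Mapping.keys p. Poly_Mapping.keys (Poly_Mapping.single (image_mset f m) (Poly_Mapping.lookup p m)))"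
    unfolding poly_map_def by (rule Poly_Mapping.keys_sum)
  also have "\<dots> \<subseteq> image_mset f ` Poly_Mapping.keys p" by auto
  finally show ?thesis .
qed

subsection \<open>The defining ideal\<close>

lemma poly_alg_simps [simp]:
  "carrier poly_alg = UNIV" "monoid.mult poly_alg = (*)" "one poly_alg = 1"
  "ring.zero poly_alg = 0" "add poly_alg = (+)"
  by (simp_all add: poly_alg_def)

lemma poly_alg_cring: "cring (poly_alg :: ('v multiset \<Rightarrow>\<^sub>0 'k::field) ring)"
  by (intro cringI abelian_groupI comm_monoidI)
    (auto simp: algebra_simps intro: exI[of _ "- _"])

interpretation poly_alg: cring "poly_alg :: ('v multiset \<Rightarrow>\<^sub>0 'k::field) ring"
  by (rule poly_alg_cring)

abbreviation var :: "'v \<Rightarrow> ('v multiset \<Rightarrow>\<^sub>0 'k::field)" where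
  "var v \<equiv> Poly_Mapping.single {#v#} 1"

locale symmetric_algebra = vector_space scale
  for scale :: "'k::field \<Rightarrow> 'v::ab_group_add \<Rightarrow> 'v"
begin

abbreviation "SI \<equiv> sym_ideal scale"

lemma SI_ideal: "ideal SI poly_alg"
  unfolding sym_ideal_def by (rule poly_alg.genideal_ideal) simp

interpretation SI: ideal SI poly_alg by (rule SI_ideal)

lemma SI_zero: "0 \<in> SI"
  using SI.zero_closed by simp

lemma SI_add: "\<lbrakk>p \<in> SI; q \<in> SI\<rbrakk> \<Longrightarrow> p + q \<in> SI"
  using SI.a_closed[of p q] by simp

lemma SI_mult: "p \<in> SI \<Longrightarrow> q * p \<in> SI"
  using SI.I_l_closed[of p q] by simp

lemma SI_mult': "p \<in> SI \<Longrightarrow> p * q \<in> SI"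
  using SI_mult[of p q] by (simp add: mult.commute)

lemma SI_uminus: "p \<in> SI \<Longrightarrow> - p \<in> SI"
  using SI_mult[of p "- 1"] by simp

lemma SI_minus: "\<lbrakk>p \<in> SI; q \<in> SI\<rbrakk> \<Longrightarrow> p - q \<in> SI"
  using SI_add[OF _ SI_uminus, of p q] by simp

lemma SI_gens: "var (v + w) - var v - var w \<in> SI" "var (scale c v) - Poly_Mapping.single {#v#} c \<in> SI"
proof -
  have sub: "{var (v + w) - var v - var w | v w. True} \<union>
      {var (scale c v) - Poly_Mapping.single {#v#} c | c v. True} \<subseteq> SI"
    unfolding sym_ideal_def by (rule poly_alg.genideal_self) simp
  show "var (v + w) - var v - var w \<in> SI"
    by (rule subsetD[OF sub], rule UnI1) blast
  show "var (scale c v) - Poly_Mapping.single {#v#} c \<in> SI"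
    by (rule subsetD[OF sub], rule UnI2) blast
qed

lemma SI_least:
  assumes "0 \<in> K" "\<And>p q. \<lbrakk>p \<in> K; q \<in> K\<rbrakk> \<Longrightarrow> p + q \<in> K" "\<And>p q. p \<in> K \<Longrightarrow> q * p \<in> K"
    and "\<And>v w. var (v + w) - var v - var w \<in> K"
    and "\<And>v c. var (scale c v) - Poly_Mapping.single {#v#} c \<in> K"
  shows "SI \<subseteq> K"
  unfolding sym_ideal_def
proof (rule poly_alg.genideal_minimal)
  have neg: "- p \<in> K" if "p \<in> K" for p
    using assms(3)[OF that, of "- 1"] by simp
  show "ideal K poly_alg"
  proof (intro idealI poly_alg.ring_axioms subgroup.intro)
    show "inv\<^bsub>add_monoid poly_alg\<^esub> p \<in> K" if "p \<in> K" for p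
    proof -
      have "inv\<^bsub>add_monoid poly_alg\<^esub> p = - p"
        using poly_alg.minus_equality[of "- p" p] by (simp add: a_inv_def)
      then show ?thesis using neg[OF that] by simp
    qed
  qed (use assms in \<open>auto simp: mult.commute\<close>)
qed (use assms in auto)

lemma sym_class_eq: "sym_class scale p = {h + p | h. h \<in> SI}"
  by (auto simp: sym_class_def a_r_coset_def r_coset_def)

lemma sym_class_eq_iff: "sym_class scale p = sym_class scale q \<longleftrightarrow> p - q \<in> SI"
proof
  assume "sym_class scale p = sym_class scale q"
  moreover have "p \<in> sym_class scale p"
    using SI_zero by (auto simp: sym_class_eq intro: exI[of _ 0])
  ultimately show "p - q \<in> SI" by (auto simp: sym_class_eq)
next
  assume pq: "p - q \<in> SI"
  have "h + p \<in> sym_class scale q" if "h \<in> SI" for h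
    using SI_add[OF that pq] by (auto simp: sym_class_eq intro!: exI[of _ "h + (p - q)"])
  moreover have "h + q \<in> sym_class scale p" if "h \<in> SI" for h
    using SI_minus[OF that pq] by (auto simp: sym_class_eq intro!: exI[of _ "h - (p - q)"])
  ultimately show "sym_class scale p = sym_class scale q"
    by (auto simp: sym_class_eq)
qed

abbreviation "Sym \<equiv> sym_alg scale"
abbreviation "cl \<equiv> sym_class scale"

lemma Sym_carrier: "carrier Sym = range cl"
  by (auto simp: sym_alg_def ring.extend_def FactRing_def A_RCOSETS_defs sym_class_def a_r_coset_def)

lemma Sym_zero: "\<zero>\<^bsub>Sym\<^esub> = cl 0"
  by (simp add: sym_alg_def ring.extend_def FactRing_def sym_class_eq)

lemma Sym_one: "\<one>\<^bsub>Sym\<^esub> = cl 1"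
  by (simp add: sym_alg_def ring.extend_def FactRing_def sym_class_def)

lemma Sym_mult: "cl p \<otimes>\<^bsub>Sym\<^esub> cl q = cl (p * q)"
  using SI.rcoset_mult_add[of p q] by (simp add: sym_alg_def ring.extend_def FactRing_def sym_class_def)

lemma Sym_add: "cl p \<oplus>\<^bsub>Sym\<^esub> cl q = cl (p + q)"
  using SI.a_rcos_sum[of p q] by (simp add: sym_alg_def ring.extend_def FactRing_def sym_class_def)

lemma Sym_homog: "homog Sym d = cl ` {p. \<forall>m\<in>Poly_Mapping.keys p. 2 * int (size m) = d}"
  by (simp add: sym_alg_def ring.extend_def graded_ring.fields_def)

lemma Sym_cring: "cring Sym"
proof (intro cringI abelian_groupI comm_monoidI)
  show "\<exists>y\<in>carrier Sym. y \<oplus>\<^bsub>Sym\<^esub> x = \<zero>\<^bsub>Sym\<^esub>" if x: "x \<in> carrier Sym" for x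
  proof -
    obtain p where "x = cl p" using x by (auto simp: Sym_carrier)
    then have "cl (- p) \<oplus>\<^bsub>Sym\<^esub> x = \<zero>\<^bsub>Sym\<^esub>" by (simp add: Sym_add Sym_zero)
    then show ?thesis by (auto simp: Sym_carrier)
  qed
qed (auto simp: Sym_carrier Sym_zero Sym_one Sym_add Sym_mult algebra_simps)

sublocale Sym: cring Sym by (rule Sym_cring)

lemma Sym_a_inv: "\<ominus>\<^bsub>Sym\<^esub> cl p = cl (- p)"
  by (rule Sym.minus_equality) (auto simp: Sym_carrier Sym_add Sym_zero)

lemma Sym_a_minus: "cl p \<ominus>\<^bsub>Sym\<^esub> cl q = cl (p - q)"
  by (simp add: Sym.minus_eq Sym_a_inv Sym_add)

lemma var_zero: "var 0 \<in> SI"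
  using SI_uminus[OF SI_gens(1)[of 0 0]] by simp

lemma var_sum:
  "finite A \<Longrightarrow> var (\<Sum>a\<in>A. scale (c a) (g a)) - (\<Sum>a\<in>A. Poly_Mapping.single {#g a#} (c a)) \<in> SI"
proof (induction A rule: finite_induct)
  case empty
  show ?case using var_zero by simp
next
  case (insert a A)
  let ?s = "\<Sum>a\<in>A. scale (c a) (g a)" and ?t = "\<Sum>a\<in>A. Poly_Mapping.single {#g a#} (c a)"
  have "(var (scale (c a) (g a) + ?s) - var (scale (c a) (g a)) - var ?s)
      + (var (scale (c a) (g a)) - Poly_Mapping.single {#g a#} (c a)) + (var ?s - ?t) \<in> SI"
    using insert SI_gens by (intro SI_add) auto
  then show ?case using insert by (simp add: algebra_simps)
qed

end

text \<open>Coordinates with respect to a finite basis map the symmetric algebra to a polynomial ring.  The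
  ideal is the whole kernel because substituting the basis vectors for the variables recovers
  every polynomial modulo the ideal.  Monomials with exponents in a multiset of natural numbers can
  be ordered, so this polynomial ring has no zero divisors, and neither has the symmetric algebra.\<close>

lemma (in symmetric_algebra) coordinate_embedding:
  assumes B: "finite B" "independent B" "span B = UNIV"
  shows "\<exists>\<Psi> :: ('v multiset \<Rightarrow>\<^sub>0 'k) \<Rightarrow> (nat multiset \<Rightarrow>\<^sub>0 'k).
    (\<forall>p q. \<Psi> (p * q) = \<Psi> p * \<Psi> q) \<and> (\<forall>p. \<Psi> p = 0 \<longleftrightarrow> p \<in> SI) \<and> (\<forall>v. \<Psi> (var v) = 0 \<longrightarrow> v = 0)"
proof -
  obtain idx :: "'v \<Rightarrow> nat" where idx: "inj_on idx B"
    using finite_imp_inj_to_nat_seg[OF B(1)] by blast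
  define en where "en = the_inv_into B idx"
  have en: "en (idx b) = b" if "b \<in> B" for b
    unfolding en_def by (rule the_inv_into_f_f[OF idx that])
  define vec :: "'v \<Rightarrow> (nat multiset \<Rightarrow>\<^sub>0 'k)"
    where "vec v = (\<Sum>b\<in>B. Poly_Mapping.single {#idx b#} (representation B v b))" for v
  define \<Psi> where "\<Psi> = mono_eval (Poly_Mapping.single 0 :: 'k \<Rightarrow> (nat multiset \<Rightarrow>\<^sub>0 'k))
      (\<lambda>m. prod_mset (image_mset vec m))"
  interpret \<Psi>: monomial_evaluation "Poly_Mapping.single 0 :: 'k \<Rightarrow> (nat multiset \<Rightarrow>\<^sub>0 'k)"
      "\<lambda>m. prod_mset (image_mset vec m)"
    by unfold_locales (simp_all add: single_add mult_single)
  define \<Theta> where "\<Theta> = mono_eval (Poly_Mapping.single 0 :: 'k \<Rightarrow> ('v multiset \<Rightarrow>\<^sub>0 'k))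
      (\<lambda>m :: nat multiset. Poly_Mapping.single (image_mset en m) 1)"
  interpret \<Theta>: monomial_evaluation "Poly_Mapping.single 0 :: 'k \<Rightarrow> ('v multiset \<Rightarrow>\<^sub>0 'k)"
      "\<lambda>m :: nat multiset. Poly_Mapping.single (image_mset en m) 1"
    by unfold_locales (simp_all add: single_add mult_single)
  have \<Psi>_single: "\<Psi> (Poly_Mapping.single m k) = Poly_Mapping.single 0 k * prod_mset (image_mset vec m)" for m k
    by (simp add: \<Psi>_def \<Psi>.eval_single)
  have \<Theta>_single: "\<Theta> (Poly_Mapping.single m k) = Poly_Mapping.single (image_mset en m) k" for m k
    by (simp add: \<Theta>_def \<Theta>.eval_single mult_single)
  have vec_add: "vec (v + w) = vec v + vec w" for v w
    using B by (simp add: vec_def representation_add single_add sum.distrib)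
  have vec_scale: "vec (scale c v) = Poly_Mapping.single 0 c * vec v" for c v
    using B by (simp add: vec_def representation_scale sum_distrib_left mult_single)
  have "SI \<subseteq> {p. \<Psi> p = 0}"
    by (rule SI_least)
      (auto simp: \<Psi>_def \<Psi>.eval_zero \<Psi>.eval_add \<Psi>.eval_mult \<Psi>.eval_minus \<Psi>.eval_single vec_add vec_scale)
  moreover have retract: "\<Theta> (\<Psi> p) - p \<in> SI" for p
  proof (induction p rule: poly_mapping_induct)
    case zero
    show ?case by (simp add: \<Psi>_def \<Theta>_def \<Psi>.eval_zero \<Theta>.eval_zero SI_zero)
  next
    case (single m k)
    have vec: "\<Theta> (vec v) - var v \<in> SI" for v
    proof -
      have "\<Theta> (\<Sum>b\<in>A. Poly_Mapping.single {#idx b#} (representation B v b))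
          = (\<Sum>b\<in>A. Poly_Mapping.single {#b#} (representation B v b))" if "finite A" "A \<subseteq> B" for A
        using that
      proof (induction A rule: finite_induct)
        case empty
        show ?case by (simp add: \<Theta>_def \<Theta>.eval_zero)
      next
        case (insert a A)
        then show ?case
          using \<Theta>_single by (simp add: \<Theta>_def \<Theta>.eval_add en)
      qed
      then have "\<Theta> (vec v) = (\<Sum>b\<in>B. Poly_Mapping.single {#b#} (representation B v b))"
        using B by (simp add: vec_def)
      moreover have "(\<Sum>b\<in>B. scale (representation B v b) b) = v"
        using B by (intro sum_representation_eq) auto
      ultimately show ?thesis
        using SI_uminus[OF var_sum[OF B(1), of "representation B v" "\<lambda>b. b"]] by simp
    qed
    have mono: "\<Theta> (prod_mset (image_mset vec m)) - Poly_Mapping.single m 1 \<in> SI"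
    proof (induction m)
      case empty
      show ?case using SI_zero \<Theta>.eval_one by (simp add: \<Theta>_def)
    next
      case (add v m)
      let ?p = "prod_mset (image_mset vec m)"
      have "\<Theta> (vec v * ?p) - var v * Poly_Mapping.single m 1
          = \<Theta> (vec v) * (\<Theta> ?p - Poly_Mapping.single m 1) + (\<Theta> (vec v) - var v) * Poly_Mapping.single m 1"
        by (simp add: \<Theta>_def \<Theta>.eval_mult algebra_simps)
      also have "\<dots> \<in> SI"
        using add vec by (intro SI_add SI_mult SI_mult')
      finally show ?case by (simp add: mult_single)
    qed
    have "\<Theta> (\<Psi> (Poly_Mapping.single m k)) - Poly_Mapping.single m k
        = Poly_Mapping.single 0 k * (\<Theta> (prod_mset (image_mset vec m)) - Poly_Mapping.single m 1)"
      using \<Theta>_single[of 0 k] by (simp add: \<Psi>_single) (simp add: \<Theta>_def \<Theta>.eval_mult algebra_simps mult_single)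
    then show ?case using SI_mult[OF mono] by simp
  next
    case (add p q)
    have "\<Theta> (\<Psi> (p + q)) - (p + q) = (\<Theta> (\<Psi> p) - p) + (\<Theta> (\<Psi> q) - q)"
      by (simp add: \<Psi>_def \<Theta>_def \<Psi>.eval_add \<Theta>.eval_add)
    then show ?case using SI_add add by metis
  qed
  moreover have "p \<in> SI" if "\<Psi> p = 0" for p
    using SI_uminus[OF retract[of p]] that by (simp add: \<Theta>_def \<Theta>.eval_zero)
  moreover have "v = 0" if "\<Psi> (var v) = 0" for v
  proof -
    have "vec v = 0" using that by (simp add: \<Psi>_single)
    have "representation B v b = 0" if b: "b \<in> B" for b
    proof -
      have "Poly_Mapping.lookup (vec v) {#idx b#}
          = (\<Sum>b'\<in>B. if b' = b then representation B v b' else 0)"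
        unfolding vec_def lookup_sum
        by (intro sum.cong) (use idx b in \<open>auto simp: lookup_single when_def inj_on_def\<close>)
      then show ?thesis using \<open>vec v = 0\<close> b B(1) by simp
    qed
    then have "(\<Sum>b\<in>B. scale (representation B v b) b) = 0" by simp
    moreover have "(\<Sum>b\<in>B. scale (representation B v b) b) = v"
      using B by (intro sum_representation_eq) auto
    ultimately show ?thesis by simp
  qed
  moreover have "\<Psi> (p * q) = \<Psi> p * \<Psi> q" for p q
    by (simp add: \<Psi>_def \<Psi>.eval_mult)
  ultimately show ?thesis
    by (intro exI[of _ \<Psi>]) blast
qed

lemma keys_size_sum:
  assumes "\<forall>m\<in>Poly_Mapping.keys p. S (size m)" "\<forall>m\<in>Poly_Mapping.keys q. S (size m)"
  shows "\<forall>m\<in>Poly_Mapping.keys (p + q). S (size m)"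
  using assms keys_add[of p q] by blast

lemma keys_size_mult:
  fixes p q :: "'v multiset \<Rightarrow>\<^sub>0 'k::field"
  assumes "\<forall>m\<in>Poly_Mapping.keys p. size m = i" "\<forall>m\<in>Poly_Mapping.keys q. S (i + size m)"
  shows "\<forall>m\<in>Poly_Mapping.keys (p * q). S (size m)"
proof
  fix m assume "m \<in> Poly_Mapping.keys (p * q)"
  then obtain a b where "m = a + b" "a \<in> Poly_Mapping.keys p" "b \<in> Poly_Mapping.keys q"
    using keys_mult[of p q] by blast
  then show "S (size m)" using assms by auto
qed

context symmetric_algebra
begin

lemma poly_map_SI:
  assumes f: "Vector_Spaces.linear scale scale f" and p: "p \<in> SI"
  shows "poly_map f p \<in> SI"
proof -
  interpret f: Vector_Spaces.linear scale scale f by fact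
  have "SI \<subseteq> {p. poly_map f p \<in> SI}"
  proof (rule SI_least)
    show "var (v + w) - var v - var w \<in> {p. poly_map f p \<in> SI}" for v w
      using SI_gens(1)[of "f v" "f w"] by (simp add: poly_map_simps poly_map_single f.add)
    show "var (scale c v) - Poly_Mapping.single {#v#} c \<in> {p. poly_map f p \<in> SI}" for v c
      using SI_gens(2)[of c "f v"] by (simp add: poly_map_simps poly_map_single f.scale)
  qed (auto simp: poly_map_simps SI_zero SI_add SI_mult)
  then show ?thesis using p by blast
qed

lemma sym_map_cl:
  assumes f: "Vector_Spaces.linear scale scale f"
  shows "sym_map scale f (cl p) = cl (poly_map f p)"
proof -
  have "cl (poly_map f (h + p)) = cl (poly_map f p)" if "h \<in> SI" for h
    using poly_map_SI[OF f that] by (simp add: sym_class_eq_iff poly_map_simps)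
  then have "(\<Union>q\<in>cl p. cl (poly_map f q)) = (\<Union>q\<in>cl p. cl (poly_map f p))"
    by (intro SUP_cong) (auto simp: sym_class_eq[of p])
  moreover have "p \<in> cl p"
    using SI_zero by (auto simp: sym_class_eq intro: exI[of _ 0])
  ultimately show ?thesis unfolding sym_map_def by auto
qed

lemma sym_map_hom:
  assumes f: "Vector_Spaces.linear scale scale f"
  shows "sym_map scale f \<in> ring_hom Sym Sym"
  by (rule ring_hom_memI)
    (auto simp: Sym_carrier sym_map_cl[OF f] Sym_mult Sym_add Sym_one poly_map_simps)

lemma sym_map_comp:
  assumes f: "Vector_Spaces.linear scale scale f" and g: "Vector_Spaces.linear scale scale g"
    and fg: "\<And>v. f (g v) = v" and x: "x \<in> carrier Sym"
  shows "sym_map scale f (sym_map scale g x) = x"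
proof -
  have "f \<circ> g = id" using fg by auto
  then show ?thesis
    using x by (auto simp: Sym_carrier sym_map_cl[OF f] sym_map_cl[OF g] poly_map_comp poly_map_id)
qed

lemma sym_map_homog:
  assumes f: "Vector_Spaces.linear scale scale f" and x: "x \<in> homog Sym d"
  shows "sym_map scale f x \<in> homog Sym d"
proof -
  obtain p where "x = cl p" and p: "\<forall>m\<in>Poly_Mapping.keys p. 2 * int (size m) = d"
    using x by (auto simp: Sym_homog)
  moreover have "\<forall>m\<in>Poly_Mapping.keys (poly_map f p). 2 * int (size m) = d"
    using p keys_poly_map[of f p] by auto
  ultimately show ?thesis by (auto simp: Sym_homog sym_map_cl[OF f])
qed

theorem Sym_graded_coefficients:
  assumes B: "finite_dimensional_vector_space scale B"
  shows "graded_coefficients Sym"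
proof -
  interpret fd: finite_dimensional_vector_space scale B by fact
  obtain \<Psi> :: "('v multiset \<Rightarrow>\<^sub>0 'k) \<Rightarrow> (nat multiset \<Rightarrow>\<^sub>0 'k)"
    where \<Psi>_mult: "\<And>p q. \<Psi> (p * q) = \<Psi> p * \<Psi> q" and \<Psi>_zero: "\<And>p. \<Psi> p = 0 \<longleftrightarrow> p \<in> SI"
    using coordinate_embedding[OF fd.finite_Basis fd.independent_Basis fd.span_Basis] by blast
  show ?thesis
  proof (intro graded_coefficients.intro graded_coefficients_axioms.intro Sym_cring)
    fix x y assume x: "x \<in> carrier Sym" and y: "y \<in> carrier Sym" and zero: "x \<otimes>\<^bsub>Sym\<^esub> y = \<zero>\<^bsub>Sym\<^esub>"
    obtain p q where pq: "x = cl p" "y = cl q" using x y by (auto simp: Sym_carrier)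
    then have "p * q \<in> SI" using zero by (simp add: Sym_mult Sym_zero sym_class_eq_iff)
    then have "\<Psi> p * \<Psi> q = 0" by (simp add: \<Psi>_mult[symmetric] \<Psi>_zero)
    then have "\<Psi> p = 0 \<or> \<Psi> q = 0" by simp
    then show "x = \<zero>\<^bsub>Sym\<^esub> \<or> y = \<zero>\<^bsub>Sym\<^esub>"
      by (simp add: pq Sym_zero sym_class_eq_iff \<Psi>_zero)
  next
    fix x y d assume "x \<in> homog Sym d" "y \<in> homog Sym d"
    then obtain p q where "x = cl p" "y = cl q"
      and p: "\<forall>m\<in>Poly_Mapping.keys p. 2 * int (size m) = d" and q: "\<forall>m\<in>Poly_Mapping.keys q. 2 * int (size m) = d"
      by (auto simp: Sym_homog)
    moreover have "\<forall>m\<in>Poly_Mapping.keys (p + q). 2 * int (size m) = d"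
      using keys_size_sum[where S = "\<lambda>i. 2 * int i = d", OF p q] .
    ultimately show "x \<oplus>\<^bsub>Sym\<^esub> y \<in> homog Sym d"
      by (auto simp: Sym_homog Sym_add)
  next
    fix x y d e assume "x \<in> homog Sym d" "y \<in> homog Sym e"
    then obtain p q where "x = cl p" "y = cl q"
      and p: "\<forall>m\<in>Poly_Mapping.keys p. 2 * int (size m) = d" and q: "\<forall>m\<in>Poly_Mapping.keys q. 2 * int (size m) = e"
      by (auto simp: Sym_homog)
    moreover have "\<forall>m\<in>Poly_Mapping.keys (p * q). 2 * int (size m) = d + e"
    proof
      fix m assume "m \<in> Poly_Mapping.keys (p * q)"
      then obtain a b where "m = a + b" "a \<in> Poly_Mapping.keys p" "b \<in> Poly_Mapping.keys q"
        using keys_mult[of p q] by blast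
      then show "2 * int (size m) = d + e" using p q by auto
    qed
    ultimately show "x \<otimes>\<^bsub>Sym\<^esub> y \<in> homog Sym (d + e)"
      by (auto simp: Sym_homog Sym_mult)
  next
    fix x d assume "x \<in> homog Sym d"
    then show "\<ominus>\<^bsub>Sym\<^esub> x \<in> homog Sym d"
      by (auto simp: Sym_homog Sym_a_inv)
  next
    show "carrier Sym \<subseteq> homog_sums (self_module Sym)"
    proof
      fix x assume "x \<in> carrier Sym"
      then obtain p where x: "x = cl p" by (auto simp: Sym_carrier)
      have "cl p \<in> homog_sums (self_module Sym)"
      proof (induction p rule: update_induct)
        case const
        show ?case using homog_sums.zero[of "self_module Sym"] by (simp add: Sym_zero)
      next
        case (update p m k)
        have "Poly_Mapping.update m k p = Poly_Mapping.single m k + p"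
            using update by (simp add: update_eq_single_add)
        moreover have "cl (Poly_Mapping.single m k) \<in> homog Sym (2 * int (size m))"
          by (auto simp: Sym_homog)
        ultimately show ?case
          using homog_sums.add[of "cl (Poly_Mapping.single m k)" "self_module Sym" _ "cl p"] update
          by (simp add: Sym_add)
      qed
      then show "x \<in> homog_sums (self_module Sym)" by (simp add: x)
    qed
  qed (auto simp: Sym_homog Sym_carrier Sym_zero Sym_one)
qed

lemma sym_vec_homog: "sym_vec scale v \<in> homog Sym 2"
  by (auto simp: Sym_homog sym_vec_def)

lemma sym_vec_nonzero:
  assumes B: "finite_dimensional_vector_space scale B" and "v \<noteq> 0"
  shows "sym_vec scale v \<noteq> \<zero>\<^bsub>Sym\<^esub>"
proof -
  interpret fd: finite_dimensional_vector_space scale B by fact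
  obtain \<Psi> :: "('v multiset \<Rightarrow>\<^sub>0 'k) \<Rightarrow> (nat multiset \<Rightarrow>\<^sub>0 'k)"
    where "\<And>p. \<Psi> p = 0 \<longleftrightarrow> p \<in> SI" "\<And>v. \<Psi> (var v) = 0 \<Longrightarrow> v = 0"
    using coordinate_embedding[OF fd.finite_Basis fd.independent_Basis fd.span_Basis] by blast
  then show ?thesis
    using assms(2) by (auto simp: sym_vec_def Sym_zero sym_class_eq_iff)
qed

lemma sym_map_vec:
  "Vector_Spaces.linear scale scale f \<Longrightarrow> sym_map scale f (sym_vec scale v) = sym_vec scale (f v)"
  by (simp add: sym_vec_def sym_map_cl poly_map_single)

lemma sym_vec_uminus: "sym_vec scale (- v) = \<ominus>\<^bsub>Sym\<^esub> sym_vec scale v"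
proof -
  have "var (- v) - Poly_Mapping.single {#v#} (- 1) \<in> SI"
    using SI_gens(2)[of "- 1" v] by simp
  then show ?thesis
    by (simp add: sym_vec_def Sym_a_inv sym_class_eq_iff single_uminus)
qed

text \<open>For a single vector the difference of \<open>v\<close> and its reflection is \<open>c v \<cdot> a\<close>.  The identity
  \<open>v p - f v \<cdot> f p = v (p - f p) + (v - f v) f p\<close> extends divisibility by \<open>a\<close> to all monomials and
  shows that the quotient has degree one less; the predicate \<open>S\<close> keeps track of degrees.\<close>

lemma poly_map_reflection_divisible:
  assumes f: "\<And>v. f v = v - scale (c v) a" and "\<forall>m\<in>Poly_Mapping.keys p. S (size m)"
  shows "\<exists>q. (\<forall>m\<in>Poly_Mapping.keys q. S (Suc (size m))) \<and> p - poly_map f p - var a * q \<in> SI"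
  using assms(2)
proof (induction p rule: update_induct)
  case const
  show ?case by (intro exI[of _ 0]) (simp add: poly_map_simps SI_zero)
next
  case (update p m k)
  have single: "\<exists>q. (\<forall>m'\<in>Poly_Mapping.keys q. Suc (size m') = size m) \<and>
      Poly_Mapping.single m k - poly_map f (Poly_Mapping.single m k) - var a * q \<in> SI"
  proof (induction m)
    case empty
    show ?case by (intro exI[of _ 0]) (simp add: poly_map_single SI_zero)
  next
    case (add v m)
    let ?p = "Poly_Mapping.single m k"
    obtain q where q: "\<forall>m'\<in>Poly_Mapping.keys q. Suc (size m') = size m"
      and div: "?p - poly_map f ?p - var a * q \<in> SI"
      using add by blast
    define q' where "q' = var v * q + Poly_Mapping.single 0 (c v) * poly_map f ?p"
    have size: "\<forall>m'\<in>Poly_Mapping.keys q'. Suc (size m') = size (add_mset v m)"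
      unfolding q'_def
    proof (rule keys_size_sum[where S = "\<lambda>i. Suc i = size (add_mset v m)"])
      show "\<forall>m'\<in>Poly_Mapping.keys (var v * q). Suc (size m') = size (add_mset v m)"
        by (rule keys_size_mult[where i = 1]) (use q in auto)
      show "\<forall>m'\<in>Poly_Mapping.keys (Poly_Mapping.single 0 (c v) * poly_map f ?p).
          Suc (size m') = size (add_mset v m)"
        by (auto simp: poly_map_single mult_single)
    qed
    have "var v - var (f v) - Poly_Mapping.single {#a#} (c v) \<in> SI"
    proof -
      have "v = f v + scale (c v) a" using f by simp
      then have "var v - var (f v) - var (scale (c v) a) \<in> SI"
        using SI_gens(1)[of "f v" "scale (c v) a"] by simp
      from SI_add[OF this SI_gens(2)[of "c v" a]] show ?thesis by (simp add: algebra_simps)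
    qed
    then have "var v * (?p - poly_map f ?p - var a * q)
        + (var v - var (f v) - Poly_Mapping.single {#a#} (c v)) * poly_map f ?p \<in> SI"
      using div by (intro SI_add SI_mult SI_mult')
    moreover have "Poly_Mapping.single (add_mset v m) k = var v * ?p"
      and "poly_map f (Poly_Mapping.single (add_mset v m) k) = var (f v) * poly_map f ?p"
      and "Poly_Mapping.single {#a#} (c v) = var a * Poly_Mapping.single 0 (c v)"
      by (simp_all add: poly_map_single mult_single)
    ultimately have "Poly_Mapping.single (add_mset v m) k
        - poly_map f (Poly_Mapping.single (add_mset v m) k) - var a * q' \<in> SI"
      by (simp add: q'_def algebra_simps)
    then show ?case using size by blast
  qed
  have keys: "Poly_Mapping.keys (Poly_Mapping.update m k p) = insert m (Poly_Mapping.keys p)"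
    using update by (simp add: keys_update)
  obtain q1 where q1: "\<forall>m'\<in>Poly_Mapping.keys q1. Suc (size m') = size m"
    and d1: "Poly_Mapping.single m k - poly_map f (Poly_Mapping.single m k) - var a * q1 \<in> SI"
    using single by blast
  obtain q2 where q2: "\<forall>m\<in>Poly_Mapping.keys q2. S (Suc (size m))"
    and d2: "p - poly_map f p - var a * q2 \<in> SI"
    using update keys by auto
  have "Poly_Mapping.update m k p = Poly_Mapping.single m k + p"
    using update by (simp add: update_eq_single_add)
  then have "Poly_Mapping.update m k p - poly_map f (Poly_Mapping.update m k p) - var a * (q1 + q2)
      = (Poly_Mapping.single m k - poly_map f (Poly_Mapping.single m k) - var a * q1)
        + (p - poly_map f p - var a * q2)"
    by (simp add: poly_map_simps algebra_simps)
  moreover have "S (size m)" using update.prems keys by auto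
  then have "\<forall>m'\<in>Poly_Mapping.keys (q1 + q2). S (Suc (size m'))"
    using q1 q2 by (intro keys_size_sum[where S = "\<lambda>i. S (Suc i)"]) auto
  ultimately show ?case
    using SI_add[OF d1 d2] by metis
qed

lemma sym_map_reflection_divisible:
  assumes f: "Vector_Spaces.linear scale scale f" "\<And>v. f v = v - scale (c v) a"
  shows "x \<in> carrier Sym \<Longrightarrow> \<exists>y\<in>carrier Sym. x \<ominus>\<^bsub>Sym\<^esub> sym_map scale f x = sym_vec scale a \<otimes>\<^bsub>Sym\<^esub> y"
    and "x \<in> homog Sym d \<Longrightarrow> \<exists>y\<in>homog Sym (d - 2). x \<ominus>\<^bsub>Sym\<^esub> sym_map scale f x = sym_vec scale a \<otimes>\<^bsub>Sym\<^esub> y"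
proof -
  have eq: "cl p \<ominus>\<^bsub>Sym\<^esub> sym_map scale f (cl p) = sym_vec scale a \<otimes>\<^bsub>Sym\<^esub> cl q"
    if "p - poly_map f p - var a * q \<in> SI" for p q
    using that by (simp add: sym_map_cl[OF f(1)] Sym_a_minus sym_vec_def Sym_mult sym_class_eq_iff)
  show "\<exists>y\<in>carrier Sym. x \<ominus>\<^bsub>Sym\<^esub> sym_map scale f x = sym_vec scale a \<otimes>\<^bsub>Sym\<^esub> y" if x: "x \<in> carrier Sym"
  proof -
    obtain p where p: "x = cl p" using x by (auto simp: Sym_carrier)
    obtain q where "p - poly_map f p - var a * q \<in> SI"
      using poly_map_reflection_divisible[OF f(2), of p "\<lambda>_. True"] by blast
    then show ?thesis using eq by (intro bexI[of _ "cl q"]) (auto simp: p Sym_carrier)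
  qed
  show "\<exists>y\<in>homog Sym (d - 2). x \<ominus>\<^bsub>Sym\<^esub> sym_map scale f x = sym_vec scale a \<otimes>\<^bsub>Sym\<^esub> y"
    if x: "x \<in> homog Sym d"
  proof -
    obtain p where p: "x = cl p" and deg: "\<forall>m\<in>Poly_Mapping.keys p. 2 * int (size m) = d"
      using x by (auto simp: Sym_homog)
    obtain q where "\<forall>m\<in>Poly_Mapping.keys q. 2 * int (Suc (size m)) = d"
      and q: "p - poly_map f p - var a * q \<in> SI"
      using poly_map_reflection_divisible[OF f(2), of p "\<lambda>i. 2 * int i = d"] deg by blast
    then have "cl q \<in> homog Sym (d - 2)"
      by (auto simp: Sym_homog intro!: imageI)
    then show ?thesis using eq[OF q] by (intro bexI[of _ "cl q"]) (auto simp: p)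
  qed
qed

end

section \<open>Localization of a graded ring at homogeneous elements\<close>

locale homog_localization = graded_coefficients A
  for A :: "('a, 'y) graded_ring_scheme" (structure) +
  fixes S :: "'a set"
  assumes S_submonoid: "submonoid S A"
    and S_homog: "s \<in> S \<Longrightarrow> \<exists>d. s \<in> homog A d"
begin

abbreviation "fr \<equiv> loc_frac A S"
abbreviation "L \<equiv> localization A S"

lemma S_closed [simp]: "s \<in> S \<Longrightarrow> s \<in> carrier A"
  and S_mult [simp]: "\<lbrakk>s \<in> S; t \<in> S\<rbrakk> \<Longrightarrow> s \<otimes> t \<in> S"
  and S_one [simp]: "\<one> \<in> S"
  using S_submonoid by (auto simp: submonoid_def)

lemma loc_rel_iff:
  "((a, s), (b, t)) \<in> loc_rel A S \<longleftrightarrow> a \<in> carrier A \<and> b \<in> carrier A \<and> s \<in> S \<and> t \<in> S \<and>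
     (\<exists>u\<in>S. u \<otimes> (a \<otimes> t) = u \<otimes> (b \<otimes> s))"
  by (simp add: loc_rel_def)

lemma loc_rel_equiv: "equiv (carrier A \<times> S) (loc_rel A S)"
proof (rule equivI)
  show "loc_rel A S \<subseteq> (carrier A \<times> S) \<times> (carrier A \<times> S)"
    by (auto simp: loc_rel_iff)
  show "refl_on (carrier A \<times> S) (loc_rel A S)"
    by (auto simp: refl_on_def loc_rel_iff)
  show "sym (loc_rel A S)"
  proof (rule symI, clarify)
    fix a s b t assume "((a, s), (b, t)) \<in> loc_rel A S"
    then show "((b, t), (a, s)) \<in> loc_rel A S"
      unfolding loc_rel_iff by metis
  qed
  show "trans (loc_rel A S)"
  proof (rule transI, clarify)
    fix a s b t c r
    assume "((a, s), (b, t)) \<in> loc_rel A S" "((b, t), (c, r)) \<in> loc_rel A S"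
    then obtain u v where u: "u \<in> S" "u \<otimes> (a \<otimes> t) = u \<otimes> (b \<otimes> s)" and v: "v \<in> S" "v \<otimes> (b \<otimes> r) = v \<otimes> (c \<otimes> t)"
      and mem: "a \<in> carrier A" "b \<in> carrier A" "c \<in> carrier A" "s \<in> S" "t \<in> S" "r \<in> S"
      by (auto simp: loc_rel_iff)
    have closed: "u \<in> carrier A" "v \<in> carrier A" "s \<in> carrier A" "t \<in> carrier A" "r \<in> carrier A"
      using u v mem by auto
    have "u \<otimes> v \<otimes> t \<otimes> (a \<otimes> r) = v \<otimes> r \<otimes> (u \<otimes> (a \<otimes> t))"
      using closed mem by algebra
    also have "\<dots> = u \<otimes> s \<otimes> (v \<otimes> (b \<otimes> r))"
      unfolding u(2) using closed mem by algebra
    also have "\<dots> = u \<otimes> v \<otimes> t \<otimes> (c \<otimes> s)"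
      unfolding v(2) using closed mem by algebra
    finally show "((a, s), (c, r)) \<in> loc_rel A S"
      using mem u(1) v(1) by (auto simp: loc_rel_iff intro!: bexI[of _ "u \<otimes> v \<otimes> t"])
  qed
qed

lemma frac_eq_iff:
  assumes "a \<in> carrier A" "b \<in> carrier A" "s \<in> S" "t \<in> S"
  shows "fr a s = fr b t \<longleftrightarrow> (\<exists>u\<in>S. u \<otimes> (a \<otimes> t) = u \<otimes> (b \<otimes> s))"
proof -
  have "fr a s = fr b t \<longleftrightarrow> ((a, s), (b, t)) \<in> loc_rel A S"
    unfolding loc_frac_def using assms by (intro eq_equiv_class_iff[OF loc_rel_equiv]) auto
  then show ?thesis using assms by (simp add: loc_rel_iff)
qed

lemma frac_eqI:
  assumes "a \<in> carrier A" "b \<in> carrier A" "s \<in> S" "t \<in> S" "a \<otimes> t = b \<otimes> s"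
  shows "fr a s = fr b t"
  using assms by (auto simp: frac_eq_iff intro!: bexI[of _ \<one>])

lemma frac_members: "(b, t) \<in> fr a s \<longleftrightarrow> ((a, s), (b, t)) \<in> loc_rel A S"
  by (simp add: loc_frac_def)

lemma frac_self: "\<lbrakk>a \<in> carrier A; s \<in> S\<rbrakk> \<Longrightarrow> (a, s) \<in> fr a s"
  by (auto simp: frac_members loc_rel_iff)

lemma L_carrier: "carrier L = {fr a s | a s. a \<in> carrier A \<and> s \<in> S}"
  by (auto simp: localization_def quotient_def loc_frac_def)

lemma frac_closed: "\<lbrakk>a \<in> carrier A; s \<in> S\<rbrakk> \<Longrightarrow> fr a s \<in> carrier L"
  by (auto simp: L_carrier)

lemma L_cases:
  assumes "x \<in> carrier L"
  obtains a s where "x = fr a s" "a \<in> carrier A" "s \<in> S"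
  using assms by (auto simp: L_carrier)

lemma L_zero: "\<zero>\<^bsub>L\<^esub> = fr \<zero> \<one>" and L_one: "\<one>\<^bsub>L\<^esub> = fr \<one> \<one>"
  by (simp_all add: localization_def)

lemma UN_pairs_constant:
  assumes F: "\<And>b t. (b, t) \<in> X \<Longrightarrow> F b t = C" and x: "x \<in> X"
  shows "(\<Union>(b, t)\<in>X. F b t) = C"
proof -
  have "(\<Union>(b, t)\<in>X. F b t) = (\<Union>p\<in>X. C)"
    by (rule SUP_cong) (auto simp: F)
  then show ?thesis using x by auto
qed

lemma UN_pairs_constant2:
  assumes "\<And>a' s' b' t'. \<lbrakk>(a', s') \<in> X; (b', t') \<in> Y\<rbrakk> \<Longrightarrow> F a' s' b' t' = C"
    and x: "x \<in> X" and y: "y \<in> Y"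
  shows "(\<Union>(a', s')\<in>X. \<Union>(b', t')\<in>Y. F a' s' b' t') = C"
  by (intro UN_pairs_constant[OF _ x] UN_pairs_constant[OF _ y] assms(1))

lemma L_mult:
  assumes a: "a \<in> carrier A" and b: "b \<in> carrier A" and s: "s \<in> S" and t: "t \<in> S"
  shows "fr a s \<otimes>\<^bsub>L\<^esub> fr b t = fr (a \<otimes> b) (s \<otimes> t)"
proof -
  have "fr (a' \<otimes> b') (s' \<otimes> t') = fr (a \<otimes> b) (s \<otimes> t)"
    if "(a', s') \<in> fr a s" "(b', t') \<in> fr b t" for a' s' b' t'
  proof -
    from that obtain u v where u: "u \<in> S" "u \<otimes> (a \<otimes> s') = u \<otimes> (a' \<otimes> s)"
      and v: "v \<in> S" "v \<otimes> (b \<otimes> t') = v \<otimes> (b' \<otimes> t)"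
      and mem: "a' \<in> carrier A" "b' \<in> carrier A" "s' \<in> S" "t' \<in> S"
      by (auto simp: frac_members loc_rel_iff)
    note closed = a b mem(1,2) S_closed[OF s] S_closed[OF t] S_closed[OF mem(3)] S_closed[OF mem(4)]
      S_closed[OF u(1)] S_closed[OF v(1)]
    have "(u \<otimes> v) \<otimes> (a' \<otimes> b' \<otimes> (s \<otimes> t)) = (u \<otimes> (a' \<otimes> s)) \<otimes> (v \<otimes> (b' \<otimes> t))"
      using closed by algebra
    also have "\<dots> = (u \<otimes> v) \<otimes> (a \<otimes> b \<otimes> (s' \<otimes> t'))"
      unfolding u(2)[symmetric] v(2)[symmetric] using closed by algebra
    finally show ?thesis
      using closed mem u(1) v(1) s t by (subst frac_eq_iff) auto
  qed
  then have "(\<Union>(a', s')\<in>fr a s. \<Union>(b', t')\<in>fr b t. fr (a' \<otimes> b') (s' \<otimes> t')) = fr (a \<otimes> b) (s \<otimes> t)"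
    by (rule UN_pairs_constant2[OF _ frac_self[OF a s] frac_self[OF b t]])
  then show ?thesis by (simp only: localization_def monoid.simps)
qed

lemma L_add:
  assumes a: "a \<in> carrier A" and b: "b \<in> carrier A" and s: "s \<in> S" and t: "t \<in> S"
  shows "fr a s \<oplus>\<^bsub>L\<^esub> fr b t = fr (a \<otimes> t \<oplus> b \<otimes> s) (s \<otimes> t)"
proof -
  have "fr (a' \<otimes> t' \<oplus> b' \<otimes> s') (s' \<otimes> t') = fr (a \<otimes> t \<oplus> b \<otimes> s) (s \<otimes> t)"
    if "(a', s') \<in> fr a s" "(b', t') \<in> fr b t" for a' s' b' t'
  proof -
    from that obtain u v where u: "u \<in> S" "u \<otimes> (a \<otimes> s') = u \<otimes> (a' \<otimes> s)"
      and v: "v \<in> S" "v \<otimes> (b \<otimes> t') = v \<otimes> (b' \<otimes> t)"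
      and mem: "a' \<in> carrier A" "b' \<in> carrier A" "s' \<in> S" "t' \<in> S"
      by (auto simp: frac_members loc_rel_iff)
    note closed = a b mem(1,2) S_closed[OF s] S_closed[OF t] S_closed[OF mem(3)] S_closed[OF mem(4)]
      S_closed[OF u(1)] S_closed[OF v(1)]
    have "(u \<otimes> v) \<otimes> ((a' \<otimes> t' \<oplus> b' \<otimes> s') \<otimes> (s \<otimes> t))
        = (u \<otimes> (a' \<otimes> s)) \<otimes> (v \<otimes> t' \<otimes> t) \<oplus> (v \<otimes> (b' \<otimes> t)) \<otimes> (u \<otimes> s' \<otimes> s)"
      using closed by algebra
    also have "\<dots> = (u \<otimes> v) \<otimes> ((a \<otimes> t \<oplus> b \<otimes> s) \<otimes> (s' \<otimes> t'))"
      unfolding u(2)[symmetric] v(2)[symmetric] using closed by algebra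
    finally show ?thesis
      using closed mem u(1) v(1) s t by (subst frac_eq_iff) auto
  qed
  then have "(\<Union>(a', s')\<in>fr a s. \<Union>(b', t')\<in>fr b t. fr (a' \<otimes> t' \<oplus> b' \<otimes> s') (s' \<otimes> t')) = fr (a \<otimes> t \<oplus> b \<otimes> s) (s \<otimes> t)"
    by (rule UN_pairs_constant2[OF _ frac_self[OF a s] frac_self[OF b t]])
  then show ?thesis by (simp only: localization_def ring.simps)
qed

lemma L_add_same:
  assumes "a \<in> carrier A" "b \<in> carrier A" "s \<in> S"
  shows "fr a s \<oplus>\<^bsub>L\<^esub> fr b s = fr (a \<oplus> b) s"
proof -
  have "(a \<otimes> s \<oplus> b \<otimes> s) \<otimes> s = (a \<oplus> b) \<otimes> (s \<otimes> s)"
    using assms(1,2) S_closed[OF assms(3)] by algebra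
  then show ?thesis
    using assms by (simp add: L_add) (intro frac_eqI; simp)
qed

lemma frac_zero: "s \<in> S \<Longrightarrow> fr \<zero> s = \<zero>\<^bsub>L\<^esub>"
  unfolding L_zero by (rule frac_eqI) auto

lemma L_cring: "cring L"
proof (intro cringI abelian_groupI comm_monoidI)
  fix x y z assume "x \<in> carrier L" "y \<in> carrier L" "z \<in> carrier L"
  then obtain a s b t c r where x: "x = fr a s" "a \<in> carrier A" "s \<in> S"
    and y: "y = fr b t" "b \<in> carrier A" "t \<in> S" and z: "z = fr c r" "c \<in> carrier A" "r \<in> S"
    by (elim L_cases)
  note mem = x(2,3) y(2,3) z(2,3)
  note closed = x(2) y(2) z(2) S_closed[OF x(3)] S_closed[OF y(3)] S_closed[OF z(3)]
  show "x \<oplus>\<^bsub>L\<^esub> y \<oplus>\<^bsub>L\<^esub> z = x \<oplus>\<^bsub>L\<^esub> (y \<oplus>\<^bsub>L\<^esub> z)"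
  proof -
    have "((a \<otimes> t \<oplus> b \<otimes> s) \<otimes> r \<oplus> c \<otimes> (s \<otimes> t)) \<otimes> (s \<otimes> (t \<otimes> r))
        = (a \<otimes> (t \<otimes> r) \<oplus> (b \<otimes> r \<oplus> c \<otimes> t) \<otimes> s) \<otimes> (s \<otimes> t \<otimes> r)"
      using closed by algebra
    then show ?thesis using mem by (simp add: x(1) y(1) z(1) L_add) (intro frac_eqI; simp)
  qed
  show "x \<otimes>\<^bsub>L\<^esub> y \<otimes>\<^bsub>L\<^esub> z = x \<otimes>\<^bsub>L\<^esub> (y \<otimes>\<^bsub>L\<^esub> z)"
    using mem by (simp add: x(1) y(1) z(1) L_mult m_assoc)
  show "(x \<oplus>\<^bsub>L\<^esub> y) \<otimes>\<^bsub>L\<^esub> z = x \<otimes>\<^bsub>L\<^esub> z \<oplus>\<^bsub>L\<^esub> y \<otimes>\<^bsub>L\<^esub> z"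
  proof -
    have "(a \<otimes> t \<oplus> b \<otimes> s) \<otimes> c \<otimes> (s \<otimes> r \<otimes> (t \<otimes> r))
        = (a \<otimes> c \<otimes> (t \<otimes> r) \<oplus> b \<otimes> c \<otimes> (s \<otimes> r)) \<otimes> (s \<otimes> t \<otimes> r)"
      using closed by algebra
    then show ?thesis using mem by (simp add: x(1) y(1) z(1) L_add L_mult) (intro frac_eqI; simp)
  qed
next
  fix x y assume "x \<in> carrier L" "y \<in> carrier L"
  then obtain a s b t where x: "x = fr a s" "a \<in> carrier A" "s \<in> S"
    and y: "y = fr b t" "b \<in> carrier A" "t \<in> S"
    by (elim L_cases)
  note mem = x(2,3) y(2,3)
  show "x \<oplus>\<^bsub>L\<^esub> y \<in> carrier L" "x \<otimes>\<^bsub>L\<^esub> y \<in> carrier L"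
    using mem by (auto simp: x(1) y(1) L_add L_mult intro!: frac_closed)
  show "x \<otimes>\<^bsub>L\<^esub> y = y \<otimes>\<^bsub>L\<^esub> x"
    using mem by (simp add: x(1) y(1) L_mult m_comm)
  show "x \<oplus>\<^bsub>L\<^esub> y = y \<oplus>\<^bsub>L\<^esub> x"
    using mem by (simp add: x(1) y(1) L_add a_comm m_comm)
next
  fix x assume "x \<in> carrier L"
  then obtain a s where x: "x = fr a s" "a \<in> carrier A" "s \<in> S"
    by (elim L_cases)
  show "\<zero>\<^bsub>L\<^esub> \<oplus>\<^bsub>L\<^esub> x = x"
    using x by (simp add: L_zero L_add)
  show "\<one>\<^bsub>L\<^esub> \<otimes>\<^bsub>L\<^esub> x = x"
    using x by (simp add: L_one L_mult)
  show "\<exists>y\<in>carrier L. y \<oplus>\<^bsub>L\<^esub> x = \<zero>\<^bsub>L\<^esub>"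
    using x L_add_same[of "\<ominus> a" a s] by (intro bexI[of _ "fr (\<ominus> a) s"]) (simp_all add: l_neg frac_zero frac_closed)
qed (auto simp: L_zero L_one intro: frac_closed)

sublocale L: cring L by (rule L_cring)

lemma L_a_inv: "\<lbrakk>a \<in> carrier A; s \<in> S\<rbrakk> \<Longrightarrow> \<ominus>\<^bsub>L\<^esub> fr a s = fr (\<ominus> a) s"
  using L_add_same[of "\<ominus> a" a s] by (intro L.minus_equality) (simp_all add: l_neg frac_zero frac_closed)

lemma L_homog_iff:
  "x \<in> homog L d \<longleftrightarrow> (\<exists>a s i j. x = fr a s \<and> a \<in> homog A i \<and> s \<in> S \<and> s \<in> homog A j \<and> i - j = d)"
  by (simp add: localization_def)

lemma L_homogI: "\<lbrakk>a \<in> homog A i; s \<in> S; s \<in> homog A j\<rbrakk> \<Longrightarrow> fr a s \<in> homog L (i - j)"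
  by (auto simp: L_homog_iff)

lemma frac_zero_iff:
  assumes "\<zero> \<notin> S" "a \<in> carrier A" "s \<in> S"
  shows "fr a s = \<zero>\<^bsub>L\<^esub> \<longleftrightarrow> a = \<zero>"
proof
  assume "fr a s = \<zero>\<^bsub>L\<^esub>"
  then obtain u where "u \<in> S" "u \<otimes> a = \<zero>"
    using assms by (auto simp: L_zero frac_eq_iff)
  then show "a = \<zero>" using integral[of u a] assms by auto
qed (use assms frac_zero in auto)

lemma trivial_localization:
  assumes "\<zero> \<in> S" "x \<in> carrier L"
  shows "x = \<zero>\<^bsub>L\<^esub>"
proof -
  obtain a s where x: "x = fr a s" "a \<in> carrier A" "s \<in> S" using assms(2) by (rule L_cases)
  then show ?thesis using assms(1) by (auto simp: L_zero frac_eq_iff intro!: bexI[of _ \<zero>])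
qed

theorem L_graded_coefficients: "graded_coefficients L"
proof (intro graded_coefficients.intro graded_coefficients_axioms.intro L_cring)
  fix x y assume x: "x \<in> carrier L" and y: "y \<in> carrier L" and xy: "x \<otimes>\<^bsub>L\<^esub> y = \<zero>\<^bsub>L\<^esub>"
  show "x = \<zero>\<^bsub>L\<^esub> \<or> y = \<zero>\<^bsub>L\<^esub>"
  proof (cases "\<zero> \<in> S")
    case True
    then show ?thesis using trivial_localization x by blast
  next
    case False
    obtain a s b t where "x = fr a s" "a \<in> carrier A" "s \<in> S" "y = fr b t" "b \<in> carrier A" "t \<in> S"
      using x y by (elim L_cases)
    then show ?thesis
      using xy integral[of a b] by (simp add: L_mult frac_zero_iff[OF False])
  qed
next
  fix x d assume "x \<in> homog L d"
  then obtain a s i j where x: "x = fr a s" "a \<in> homog A i" "s \<in> S" "s \<in> homog A j" "i - j = d"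
    by (auto simp: L_homog_iff)
  then show "x \<in> carrier L" by (auto intro!: frac_closed homog_carrier)
  show "\<ominus>\<^bsub>L\<^esub> x \<in> homog L d"
    using x L_homogI[OF neg_homog] by (auto simp: L_a_inv homog_carrier)
next
  fix x y d assume "x \<in> homog L d" "y \<in> homog L d"
  then obtain a s i j b t k l where x: "x = fr a s" "a \<in> homog A i" "s \<in> S" "s \<in> homog A j" "i - j = d"
    and y: "y = fr b t" "b \<in> homog A k" "t \<in> S" "t \<in> homog A l" "k - l = d"
    by (auto simp: L_homog_iff)
  have "b \<otimes> s \<in> homog A (i + l)"
    using mult_homog[OF y(2) x(4)] x(5) y(5) by (simp add: algebra_simps)
  then have "a \<otimes> t \<oplus> b \<otimes> s \<in> homog A (i + l)"
    using mult_homog[OF x(2) y(4)] add_homog by blast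
  then have "fr (a \<otimes> t \<oplus> b \<otimes> s) (s \<otimes> t) \<in> homog L (i + l - (j + l))"
    using x y mult_homog by (intro L_homogI) auto
  then show "x \<oplus>\<^bsub>L\<^esub> y \<in> homog L d"
    using x y by (simp add: L_add homog_carrier)
next
  fix x y d e assume "x \<in> homog L d" "y \<in> homog L e"
  then obtain a s i j b t k l where x: "x = fr a s" "a \<in> homog A i" "s \<in> S" "s \<in> homog A j" "i - j = d"
    and y: "y = fr b t" "b \<in> homog A k" "t \<in> S" "t \<in> homog A l" "k - l = e"
    by (auto simp: L_homog_iff)
  have "fr (a \<otimes> b) (s \<otimes> t) \<in> homog L (i + k - (j + l))"
    using x y mult_homog by (intro L_homogI) auto
  moreover have "i + k - (j + l) = d + e" using x y by simp
  ultimately show "x \<otimes>\<^bsub>L\<^esub> y \<in> homog L (d + e)"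
    using x y by (simp add: L_mult homog_carrier)
next
  show "\<zero>\<^bsub>L\<^esub> \<in> homog L d" for d
    using L_homogI[OF zero_homog S_one one_homog, of d] by (simp add: L_zero)
  show "\<one>\<^bsub>L\<^esub> \<in> homog L 0"
    using L_homogI[OF one_homog S_one one_homog] by (simp add: L_one)
  show "carrier L \<subseteq> homog_sums (self_module L)"
  proof
    fix x assume "x \<in> carrier L"
    then obtain a s where x: "x = fr a s" "a \<in> carrier A" "s \<in> S" by (rule L_cases)
    obtain j where j: "s \<in> homog A j" using S_homog x(3) by blast
    have "fr a s \<in> homog_sums (self_module L)"
      using x(2)
    proof (induction rule: homog_induct)
      case zero
      show ?case using homog_sums.zero[of "self_module L"] x(3) by (simp add: frac_zero)
    next
      case (add a b d)
      then show ?case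
        using homog_sums.add[of "fr a s" "self_module L" "d - j" "fr b s"] L_homogI[OF add(1) x(3) j]
          L_add_same[of a b s] x(3) homog_carrier by simp
    qed
    then show "x \<in> homog_sums (self_module L)" by (simp add: x)
  qed
qed

subsection \<open>Extension of automorphisms\<close>

context
  fixes f :: "'a \<Rightarrow> 'a"
  assumes f: "f \<in> ring_hom A A" and fS: "\<And>s. s \<in> S \<Longrightarrow> f s \<in> S"
begin

lemma localization_map_frac:
  assumes "a \<in> carrier A" "s \<in> S"
  shows "localization_map A S f (fr a s) = fr (f a) (f s)"
proof -
  have "fr (f b) (f t) = fr (f a) (f s)" if "(b, t) \<in> fr a s" for b t
  proof -
    from that obtain u where u: "u \<in> S" "u \<otimes> (a \<otimes> t) = u \<otimes> (b \<otimes> s)" and mem: "b \<in> carrier A" "t \<in> S"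
      by (auto simp: frac_members loc_rel_iff)
    have "f (u \<otimes> (b \<otimes> s)) = f (u \<otimes> (a \<otimes> t))" using u by simp
    then have "f u \<otimes> (f b \<otimes> f s) = f u \<otimes> (f a \<otimes> f t)"
      using u(1) mem assms by (simp add: ring_hom_mult[OF f])
    then show ?thesis
      using u(1) mem assms fS by (subst frac_eq_iff) (auto intro: ring_hom_closed[OF f])
  qed
  then show ?thesis
    unfolding localization_map_def by (rule UN_pairs_constant[OF _ frac_self[OF assms]])
qed

lemma localization_map_hom: "localization_map A S f \<in> ring_hom L L"
proof (rule ring_hom_memI)
  fix x y assume "x \<in> carrier L" "y \<in> carrier L"
  then obtain a s b t where x: "x = fr a s" "a \<in> carrier A" "s \<in> S"
    and y: "y = fr b t" "b \<in> carrier A" "t \<in> S"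
    by (elim L_cases)
  then show "localization_map A S f (x \<otimes>\<^bsub>L\<^esub> y) = localization_map A S f x \<otimes>\<^bsub>L\<^esub> localization_map A S f y"
    "localization_map A S f (x \<oplus>\<^bsub>L\<^esub> y) = localization_map A S f x \<oplus>\<^bsub>L\<^esub> localization_map A S f y"
    by (simp_all add: L_mult L_add localization_map_frac fS ring_hom_closed[OF f]
        ring_hom_mult[OF f] ring_hom_add[OF f])
next
  fix x assume "x \<in> carrier L"
  then show "localization_map A S f x \<in> carrier L"
    by (elim L_cases) (auto simp: localization_map_frac fS ring_hom_closed[OF f] intro!: frac_closed)
qed (simp add: L_one localization_map_frac ring_hom_one[OF f])

lemma localization_map_homog:
  assumes "\<And>a d. a \<in> homog A d \<Longrightarrow> f a \<in> homog A d" and "x \<in> homog L d"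
  shows "localization_map A S f x \<in> homog L d"
proof -
  obtain a s i j where x: "x = fr a s" "a \<in> homog A i" "s \<in> S" "s \<in> homog A j" and d: "i - j = d"
    using assms(2) by (auto simp: L_homog_iff)
  then have "fr (f a) (f s) \<in> homog L (i - j)"
    by (intro L_homogI assms(1) fS)
  then show ?thesis
    using x d by (simp add: localization_map_frac homog_carrier)
qed

text \<open>The numerator of the difference is \<open>a \<cdot> f s - f a \<cdot> s = (a - f a) f s - f a (s - f s)\<close>, a
  multiple of \<open>\<alpha>\<close> because numerators and denominators both have that property.\<close>

lemma localization_map_quotient:
  assumes \<alpha>: "\<alpha> \<in> carrier A" and a: "a \<in> carrier A" and s: "s \<in> S"
    and p: "p \<in> carrier A" "a \<ominus> f a = \<alpha> \<otimes> p" and q: "q \<in> carrier A" "s \<ominus> f s = \<alpha> \<otimes> q"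
  shows "fr a s \<ominus>\<^bsub>L\<^esub> localization_map A S f (fr a s) = fr \<alpha> \<one> \<otimes>\<^bsub>L\<^esub> fr (p \<otimes> f s \<ominus> f a \<otimes> q) (s \<otimes> f s)"
proof -
  have closed: "f a \<in> carrier A" "f s \<in> carrier A" "f s \<in> S" "s \<in> carrier A"
    using a s fS ring_hom_closed[OF f] by auto
  have "a \<otimes> f s \<ominus> f a \<otimes> s = (a \<ominus> f a) \<otimes> f s \<ominus> f a \<otimes> (s \<ominus> f s)"
    using a closed by algebra
  also have "\<dots> = \<alpha> \<otimes> (p \<otimes> f s \<ominus> f a \<otimes> q)"
    unfolding p(2) q(2) using \<alpha> p(1) q(1) closed by algebra
  finally have eq: "a \<otimes> f s \<oplus> \<ominus> f a \<otimes> s = \<alpha> \<otimes> (p \<otimes> f s \<ominus> f a \<otimes> q)"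
    using closed by (simp add: a_minus_def l_minus)
  then show ?thesis
    using assms closed by (simp add: L.minus_eq localization_map_frac L_a_inv L_add L_mult)
qed

lemma localization_map_divisible:
  assumes \<alpha>: "\<alpha> \<in> carrier A"
    and div: "\<And>a. a \<in> carrier A \<Longrightarrow> \<exists>q\<in>carrier A. a \<ominus> f a = \<alpha> \<otimes> q"
    and x: "x \<in> carrier L"
  shows "\<exists>q\<in>carrier L. x \<ominus>\<^bsub>L\<^esub> localization_map A S f x = fr \<alpha> \<one> \<otimes>\<^bsub>L\<^esub> q"
proof -
  obtain a s where x: "x = fr a s" "a \<in> carrier A" "s \<in> S" using x by (rule L_cases)
  obtain p q where p: "p \<in> carrier A" "a \<ominus> f a = \<alpha> \<otimes> p" and q: "q \<in> carrier A" "s \<ominus> f s = \<alpha> \<otimes> q"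
    using div[OF x(2)] div[OF S_closed[OF x(3)]] by blast
  have "fr (p \<otimes> f s \<ominus> f a \<otimes> q) (s \<otimes> f s) \<in> carrier L"
    using x p q fS ring_hom_closed[OF f] by (intro frac_closed) auto
  then show ?thesis
    using localization_map_quotient[OF \<alpha> x(2,3) p q] by (auto simp: x(1))
qed

lemma localization_map_divisible_homog:
  assumes \<alpha>: "\<alpha> \<in> carrier A"
    and div: "\<And>a d. a \<in> homog A d \<Longrightarrow> \<exists>q\<in>homog A (d - e). a \<ominus> f a = \<alpha> \<otimes> q"
    and f_homog: "\<And>a d. a \<in> homog A d \<Longrightarrow> f a \<in> homog A d" and x: "x \<in> homog L d"
  shows "\<exists>q\<in>homog L (d - e). x \<ominus>\<^bsub>L\<^esub> localization_map A S f x = fr \<alpha> \<one> \<otimes>\<^bsub>L\<^esub> q"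
proof -
  obtain a s i j where x: "x = fr a s" "a \<in> homog A i" "s \<in> S" "s \<in> homog A j" and d: "i - j = d"
    using x by (auto simp: L_homog_iff)
  obtain p q where p: "p \<in> homog A (i - e)" "a \<ominus> f a = \<alpha> \<otimes> p"
    and q: "q \<in> homog A (j - e)" "s \<ominus> f s = \<alpha> \<otimes> q"
    using div[OF x(2)] div[OF x(4)] by blast
  have "p \<otimes> f s \<in> homog A (i + j - e)"
    using mult_homog[OF p(1) f_homog[OF x(4)]] by (simp add: algebra_simps)
  moreover have "\<ominus> (f a \<otimes> q) \<in> homog A (i + j - e)"
    using neg_homog[OF mult_homog[OF f_homog[OF x(2)] q(1)]] by (simp add: algebra_simps)
  ultimately have "p \<otimes> f s \<ominus> f a \<otimes> q \<in> homog A (i + j - e)"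
    unfolding a_minus_def by (rule add_homog)
  moreover have "s \<otimes> f s \<in> homog A (j + j)" "s \<otimes> f s \<in> S"
    using mult_homog[OF x(4) f_homog[OF x(4)]] x(3) fS by auto
  ultimately have "fr (p \<otimes> f s \<ominus> f a \<otimes> q) (s \<otimes> f s) \<in> homog L (i + j - e - (j + j))"
    by (intro L_homogI)
  moreover have "i + j - e - (j + j) = d - e" using d by simp
  ultimately have "fr (p \<otimes> f s \<ominus> f a \<otimes> q) (s \<otimes> f s) \<in> homog L (d - e)" by metis
  then show ?thesis
    unfolding x(1) using localization_map_quotient[OF \<alpha> homog_carrier[OF x(2)] x(3)
        homog_carrier[OF p(1)] p(2) homog_carrier[OF q(1)] q(2)] by (rule bexI[rotated])
qed

end

lemma localization_map_inverse:
  assumes f: "f \<in> ring_hom A A" "\<And>s. s \<in> S \<Longrightarrow> f s \<in> S" and g: "g \<in> ring_hom A A" "\<And>s. s \<in> S \<Longrightarrow> g s \<in> S"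
    and fg: "\<And>a. a \<in> carrier A \<Longrightarrow> f (g a) = a" and x: "x \<in> carrier L"
  shows "localization_map A S f (localization_map A S g x) = x"
proof -
  obtain a s where x: "x = fr a s" "a \<in> carrier A" "s \<in> S" using x by (rule L_cases)
  then show ?thesis
    using fg ring_hom_closed[OF g(1)] by (simp add: localization_map_frac[OF g] localization_map_frac[OF f] g(2))
qed

end

section \<open>A ring as a module over the invariants of a reflection\<close>

context graded_coefficients
begin

text \<open>Every \<open>r\<close> is the sum of \<open>(r + \<tau> r) / 2\<close> and \<open>\<alpha> \<cdot> (r - \<tau> r) / (2 \<alpha>)\<close>, so \<open>1\<close> and \<open>\<alpha>\<close> form a basis over
  the invariants.  The quotient \<open>Q r = (r - \<tau> r) / \<alpha>\<close> is unique because \<open>\<alpha>\<close> can be cancelled, and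
  uniqueness makes it additive, linear over invariants, homogeneous and invariant; for the last,
  both \<open>r - \<tau> r\<close> and \<open>\<alpha>\<close> change sign under \<open>\<tau>\<close>.\<close>

lemma reflection_dual_basis:
  assumes \<tau>: "\<tau> \<in> ring_hom R R" and \<tau>\<tau>: "\<And>r. r \<in> carrier R \<Longrightarrow> \<tau> (\<tau> r) = r"
    and \<tau>_homog: "\<And>r d. r \<in> homog R d \<Longrightarrow> \<tau> r \<in> homog R d"
    and \<alpha>: "\<alpha> \<in> homog R e" "\<alpha> \<noteq> \<zero>" "\<tau> \<alpha> = \<ominus> \<alpha>"
    and half: "half \<in> homog R 0" "half \<oplus> half = \<one>" "\<tau> half = half"
    and div: "\<And>r. r \<in> carrier R \<Longrightarrow> \<exists>q\<in>carrier R. r \<ominus> \<tau> r = \<alpha> \<otimes> q"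
    and div_homog: "\<And>r d. r \<in> homog R d \<Longrightarrow> \<exists>q\<in>homog R (d - e). r \<ominus> \<tau> r = \<alpha> \<otimes> q"
  shows "\<exists>D b deg. invariant_dual_basis R \<tau> D b deg"
proof -
  note [simp] = ring_hom_closed[OF \<tau>] ring_hom_add[OF \<tau>] ring_hom_mult[OF \<tau>] ring_hom_one[OF \<tau>] \<tau>\<tau>
  have \<alpha>R: "\<alpha> \<in> carrier R" and hR: "half \<in> carrier R"
    using \<alpha> half homog_carrier by auto
  interpret \<tau>: ring_hom_cring R R \<tau>
    using \<tau> by unfold_locales
  have cancel: "p = q" if "p \<in> carrier R" "q \<in> carrier R" "\<alpha> \<otimes> p = \<alpha> \<otimes> q" for p q
  proof -
    have "\<alpha> \<otimes> (p \<ominus> q) = \<alpha> \<otimes> p \<ominus> \<alpha> \<otimes> q"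
      using that(1,2) \<alpha>R by algebra
    then have "\<alpha> \<otimes> (p \<ominus> q) = \<zero>"
      using that \<alpha>R by (simp add: a_minus_def r_neg)
    then have "p \<ominus> q = \<zero>" using integral[of \<alpha> "p \<ominus> q"] \<alpha>(2) \<alpha>R that by auto
    then show ?thesis using that diff_zero_imp_eq by blast
  qed
  have "\<forall>r\<in>carrier R. \<exists>q. q \<in> carrier R \<and> r \<ominus> \<tau> r = \<alpha> \<otimes> q"
    using div by blast
  then obtain Q where "\<forall>r\<in>carrier R. Q r \<in> carrier R \<and> r \<ominus> \<tau> r = \<alpha> \<otimes> Q r"
    by (rule bchoice[THEN exE])
  then have Q: "\<And>r. r \<in> carrier R \<Longrightarrow> Q r \<in> carrier R" "\<And>r. r \<in> carrier R \<Longrightarrow> r \<ominus> \<tau> r = \<alpha> \<otimes> Q r"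
    by blast+
  have Q_unique: "Q r = q" if "r \<in> carrier R" "q \<in> carrier R" "r \<ominus> \<tau> r = \<alpha> \<otimes> q" for r q
    using cancel[OF Q(1)[OF that(1)] that(2)] Q(2)[OF that(1)] that(3) by metis
  have Q_inv: "\<tau> (Q r) = Q r" if r: "r \<in> carrier R" for r
  proof (rule cancel)
    have "\<ominus> \<alpha> \<otimes> \<tau> (Q r) = \<tau> (r \<ominus> \<tau> r)"
      using r Q \<alpha>R \<alpha>(3) by simp
    also have "\<dots> = \<tau> r \<ominus> r" using r by (simp add: a_minus_def)
    finally have *: "\<ominus> \<alpha> \<otimes> \<tau> (Q r) = \<tau> r \<ominus> r" .
    have "\<alpha> \<otimes> \<tau> (Q r) = \<ominus> (\<ominus> \<alpha> \<otimes> \<tau> (Q r))"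
      using r Q \<alpha>R by (simp add: l_minus)
    also have "\<dots> = r \<ominus> \<tau> r"
      unfolding * using r ring_hom_closed[OF \<tau> r] by algebra
    finally show "\<alpha> \<otimes> \<tau> (Q r) = \<alpha> \<otimes> Q r" using Q r by simp
  qed (use Q r in auto)
  have Q_add: "Q (r \<oplus> s) = Q r \<oplus> Q s" if r: "r \<in> carrier R" and s: "s \<in> carrier R" for r s
  proof (rule Q_unique)
    have "r \<oplus> s \<ominus> (\<tau> r \<oplus> \<tau> s) = (r \<ominus> \<tau> r) \<oplus> (s \<ominus> \<tau> s)"
      using r s ring_hom_closed[OF \<tau> r] ring_hom_closed[OF \<tau> s] by algebra
    also have "\<dots> = \<alpha> \<otimes> (Q r \<oplus> Q s)"
      using r s Q \<alpha>R by (simp add: r_distr)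
    finally show "r \<oplus> s \<ominus> \<tau> (r \<oplus> s) = \<alpha> \<otimes> (Q r \<oplus> Q s)" using r s by simp
  qed (use r s Q in auto)
  have Q_linear: "Q (c \<otimes> r) = c \<otimes> Q r" if c: "c \<in> carrier R" "\<tau> c = c" and r: "r \<in> carrier R" for c r
  proof (rule Q_unique)
    have "c \<otimes> r \<ominus> c \<otimes> \<tau> r = c \<otimes> (r \<ominus> \<tau> r)"
      using c(1) r ring_hom_closed[OF \<tau> r] by algebra
    also have "\<dots> = \<alpha> \<otimes> (c \<otimes> Q r)"
      using c r Q \<alpha>R by (simp add: m_lcomm)
    finally show "c \<otimes> r \<ominus> \<tau> (c \<otimes> r) = \<alpha> \<otimes> (c \<otimes> Q r)" using c r by simp
  qed (use c r Q in auto)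
  have Q_homog: "Q r \<in> homog R (d - e)" if r: "r \<in> homog R d" for r d
  proof -
    obtain q where q: "q \<in> homog R (d - e)" "r \<ominus> \<tau> r = \<alpha> \<otimes> q"
      using div_homog[OF r] by blast
    then have "Q r = q"
      using Q_unique[OF homog_carrier[OF r] homog_carrier[OF q(1)] q(2)] by blast
    then show ?thesis using q(1) by simp
  qed
  define D where "D = (\<lambda>i r. half \<otimes> (if i then Q r else r \<oplus> \<tau> r))"
  define b where "b = (\<lambda>i. if i then \<alpha> else \<one>)"
  define deg where "deg = (\<lambda>i. if i then e else 0)"
  have expand: "r = D False r \<otimes> b False \<oplus> D True r \<otimes> b True" if r: "r \<in> carrier R" for r
  proof -
    have "half \<otimes> (r \<oplus> \<tau> r) \<oplus> half \<otimes> (r \<ominus> \<tau> r) = (half \<oplus> half) \<otimes> r"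
      using r hR ring_hom_closed[OF \<tau> r] by algebra
    also have "\<dots> = r" using half(2) r by simp
    finally have "r = half \<otimes> (r \<oplus> \<tau> r) \<oplus> half \<otimes> (\<alpha> \<otimes> Q r)"
      using Q(2)[OF r] by simp
    also have "half \<otimes> (\<alpha> \<otimes> Q r) = half \<otimes> Q r \<otimes> \<alpha>"
      using r Q \<alpha>R hR by (simp add: m_ac)
    finally show ?thesis using r hR by (simp add: D_def b_def)
  qed
  have D_fixed: "D i r \<in> carrier R" "\<tau> (D i r) = D i r" if "r \<in> carrier R" for i r
    using that Q hR half(3) by (auto simp: D_def Q_inv a_comm)
  have D_add: "D i (r \<oplus> s) = D i r \<oplus> D i s" if r: "r \<in> carrier R" and s: "s \<in> carrier R" for i r s
  proof -
    have "half \<otimes> (r \<oplus> s \<oplus> (\<tau> r \<oplus> \<tau> s)) = half \<otimes> (r \<oplus> \<tau> r) \<oplus> half \<otimes> (s \<oplus> \<tau> s)"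
      using r s hR ring_hom_closed[OF \<tau> r] ring_hom_closed[OF \<tau> s] by algebra
    then show ?thesis
      using r s Q hR by (simp add: D_def Q_add r_distr)
  qed
  have D_linear: "D i (c \<otimes> r) = c \<otimes> D i r"
    if c: "c \<in> carrier R" "\<tau> c = c" and r: "r \<in> carrier R" for i c r
  proof -
    have "half \<otimes> (c \<otimes> r \<oplus> c \<otimes> \<tau> r) = c \<otimes> (half \<otimes> (r \<oplus> \<tau> r))"
      using c(1) r hR ring_hom_closed[OF \<tau> r] by algebra
    then show ?thesis
      using c r Q hR by (simp add: D_def Q_linear m_lcomm)
  qed
  have D_homog: "D i r \<in> homog R (d - deg i)" if r: "r \<in> homog R d" for i r d
    using mult_homog[OF half(1) Q_homog[OF r]] mult_homog[OF half(1) add_homog[OF r \<tau>_homog[OF r]]]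
    by (simp add: D_def deg_def)
  have b_homog: "b i \<in> homog R (deg i)" for i
    using \<alpha>(1) one_homog by (simp add: b_def deg_def)
  show ?thesis
    unfolding invariant_dual_basis_def
    by (intro exI[of _ D] exI[of _ b] exI[of _ deg] allI conjI ballI impI D_fixed D_add D_linear
        D_homog b_homog; (assumption | erule expand))
qed

end

section \<open>Reflexivity of Hom between Bott-Samelson bimodules\<close>

lemma two_neq_zero:
  assumes "CHAR('k::field) \<noteq> 2" shows "(2 :: 'k) \<noteq> 0"
proof
  assume "(2 :: 'k) = 0"
  then have "of_nat 2 = (0 :: 'k)" by simp
  then have "CHAR('k) dvd 2" by (simp only: of_nat_eq_0_iff_char_dvd)
  then have "CHAR('k) \<le> 2" by (rule dvd_imp_le) simp
  moreover have "CHAR('k) \<noteq> 0" using \<open>CHAR('k) dvd 2\<close> by (metis dvd_0_left_iff zero_neq_numeral)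
  moreover have "CHAR('k) \<noteq> Suc 0" by simp
  ultimately show False using assms by simp
qed

lemma reflections_closed:
  assumes "coxeter_system W S" "t \<in> reflections W S"
  shows "t \<in> carrier W"
proof -
  interpret group W using assms(1) by (simp add: coxeter_system_def)
  have "S \<subseteq> carrier W" using assms(1) by (simp add: coxeter_system_def)
  then show ?thesis using assms(2) by (auto simp: reflections_def)
qed

text \<open>The hypotheses concern the ring before localization, where divisibility by the root is a matter
  of polynomials; they survive the passage to fractions.\<close>

lemma (in homog_localization) reflection_dual_basis_localization:
  assumes f: "f \<in> ring_hom A A" and fS: "\<And>s. s \<in> S \<Longrightarrow> f s \<in> S"
    and ff: "\<And>a. a \<in> carrier A \<Longrightarrow> f (f a) = a" and f_homog: "\<And>a d. a \<in> homog A d \<Longrightarrow> f a \<in> homog A d"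
    and \<alpha>: "\<alpha> \<in> homog A e" "\<alpha> \<noteq> \<zero>" "f \<alpha> = \<ominus> \<alpha>"
    and half: "half \<in> homog A 0" "half \<oplus> half = \<one>" "f half = half"
    and div: "\<And>a. a \<in> carrier A \<Longrightarrow> \<exists>q\<in>carrier A. a \<ominus> f a = \<alpha> \<otimes> q"
    and div_homog: "\<And>a d. a \<in> homog A d \<Longrightarrow> \<exists>q\<in>homog A (d - e). a \<ominus> f a = \<alpha> \<otimes> q"
    and zero: "\<zero> \<notin> S" and \<tau>: "\<tau> = localization_map A S f"
  shows "\<exists>D b deg. invariant_dual_basis L \<tau> D b deg"
  unfolding \<tau>
proof (rule graded_coefficients.reflection_dual_basis[OF L_graded_coefficients])
  have \<alpha>A: "\<alpha> \<in> carrier A" and halfA: "half \<in> carrier A"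
    using \<alpha> half homog_carrier by auto
  have f_one: "f \<one> = \<one>" using f by (rule ring_hom_one)
  note map = localization_map_frac[OF f fS]
  show "localization_map A S f \<in> ring_hom L L"
    by (rule localization_map_hom[OF f fS])
  show "localization_map A S f (localization_map A S f r) = r" if "r \<in> carrier L" for r
    by (rule localization_map_inverse[OF f fS f fS ff that])
  show "localization_map A S f r \<in> homog L d" if "r \<in> homog L d" for r d
    by (rule localization_map_homog[OF f fS f_homog that])
  show "fr \<alpha> \<one> \<in> homog L e"
    using L_homogI[OF \<alpha>(1) S_one one_homog] by simp
  show "fr \<alpha> \<one> \<noteq> \<zero>\<^bsub>L\<^esub>"
    using frac_zero_iff[OF zero \<alpha>A S_one] \<alpha>(2) by simp
  show "localization_map A S f (fr \<alpha> \<one>) = \<ominus>\<^bsub>L\<^esub> fr \<alpha> \<one>"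
    using \<alpha>A by (simp add: map \<alpha>(3) f_one L_a_inv)
  show "fr half \<one> \<in> homog L 0"
    using L_homogI[OF half(1) S_one one_homog] by simp
  show "fr half \<one> \<oplus>\<^bsub>L\<^esub> fr half \<one> = \<one>\<^bsub>L\<^esub>"
    using L_add_same[OF halfA halfA S_one] by (simp add: half(2) L_one)
  show "localization_map A S f (fr half \<one>) = fr half \<one>"
    using halfA by (simp add: map half(3) f_one)
  show "\<exists>q\<in>carrier L. r \<ominus>\<^bsub>L\<^esub> localization_map A S f r = fr \<alpha> \<one> \<otimes>\<^bsub>L\<^esub> q" if "r \<in> carrier L" for r
    by (rule localization_map_divisible[OF f fS \<alpha>A div that])
  show "\<exists>q\<in>homog L (d - e). r \<ominus>\<^bsub>L\<^esub> localization_map A S f r = fr \<alpha> \<one> \<otimes>\<^bsub>L\<^esub> q" if "r \<in> homog L d" for r d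
    by (rule localization_map_divisible_homog[OF f fS \<alpha>A div_homog f_homog that])
qed

theorem theorem4p2p6:
  fixes W :: "('w, 'b) monoid_scheme" and S :: "'w set"
    and scale :: "'k::field \<Rightarrow> 'v::ab_group_add \<Rightarrow> 'v"
    and \<rho> :: "'w \<Rightarrow> 'v \<Rightarrow> 'v"
    and root_of :: "'w \<Rightarrow> 'v" and coroot_of :: "'w \<Rightarrow> 'v \<Rightarrow> 'k"
    and \<sigma> :: "('v multiset \<Rightarrow>\<^sub>0 'k) set set"
    and ts ts' :: "'w list" and x y z w :: 'w
  assumes "coxeter_system W S"
    and "CHAR('k) \<noteq> 2"
    and "\<exists>B. finite_dimensional_vector_space scale B"
    and "faithful_action W UNIV \<rho>"
    and "\<And>g. g \<in> carrier W \<Longrightarrow> Vector_Spaces.linear scale scale (\<rho> g)"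
    and "\<And>s. s \<in> S \<Longrightarrow> \<exists>a c. reflection_with scale (\<rho> s) a c"
    and "\<And>t. t \<in> reflections W S \<Longrightarrow> reflection_with scale (\<rho> t) (root_of t) (coroot_of t)"
    and GKM: "\<And>t t' c. \<lbrakk>t \<in> reflections W S; t' \<in> reflections W S; root_of t' = scale c (root_of t)\<rbrakk>
                \<Longrightarrow> t = t'"
    and "submonoid \<sigma> (sym_alg scale)"
    and "\<And>a. a \<in> \<sigma> \<Longrightarrow> \<exists>d. a \<in> homog (sym_alg scale) d"
    and "\<And>g a. \<lbrakk>g \<in> carrier W; a \<in> \<sigma>\<rbrakk> \<Longrightarrow> sym_map scale (\<rho> g) a \<in> \<sigma>"
    and "\<And>t a. \<lbrakk>t \<in> reflections W S; a \<in> \<sigma>\<rbrakk>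
           \<Longrightarrow> \<not> sym_vec scale (root_of t) divides\<^bsub>sym_alg scale\<^esub> a"
    and "set ts \<subseteq> reflections W S" and "set ts' \<subseteq> reflections W S"
    and "x \<in> carrier W" and "y \<in> carrier W" and "z \<in> carrier W" and "w \<in> carrier W"
  shows
    "reflexive (loc_sym scale \<sigma>)
       (hom_bimodule (loc_sym scale \<sigma>)
         (twisted_bott_samelson (loc_sym scale \<sigma>) (loc_sym_act scale \<sigma> \<rho>) x ts y)
         (twisted_bott_samelson (loc_sym scale \<sigma>) (loc_sym_act scale \<sigma> \<rho>) z ts' w)) \<and>
     reflexive (loc_sym scale \<sigma>)
       (right_module (hom_bimodule (loc_sym scale \<sigma>)
         (twisted_bott_samelson (loc_sym scale \<sigma>) (loc_sym_act scale \<sigma> \<rho>) x ts y)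
         (twisted_bott_samelson (loc_sym scale \<sigma>) (loc_sym_act scale \<sigma> \<rho>) z ts' w)))"
proof -
  obtain B where fd: "finite_dimensional_vector_space scale B"
    using assms(3) by (rule exE)
  interpret fd: finite_dimensional_vector_space scale B by (rule fd)
  interpret Sy: symmetric_algebra scale
    by (intro symmetric_algebra.intro fd.vector_space_axioms)
  interpret A: graded_coefficients "sym_alg scale"
    by (rule Sy.Sym_graded_coefficients[OF fd])
  interpret Lo: homog_localization "sym_alg scale" \<sigma>
    by (intro homog_localization.intro homog_localization_axioms.intro
        A.graded_coefficients_axioms assms(9,10))
  let ?R = "loc_sym scale \<sigma>" and ?act = "loc_sym_act scale \<sigma> \<rho>"
  let ?T = "reflections W S"
  interpret R: graded_coefficients ?R
    unfolding loc_sym_def by (rule Lo.L_graded_coefficients)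
  interpret W: group W using assms(1) by (simp add: coxeter_system_def)
  interpret action: group_action W UNIV \<rho>
    using assms(4) by (rule faithful_action.axioms(1))
  have \<rho>_inv: "\<rho> g (\<rho> (inv\<^bsub>W\<^esub> g) v) = v" "\<rho> (inv\<^bsub>W\<^esub> g) (\<rho> g v) = v" if g: "g \<in> carrier W" for g v
  proof -
    have "\<rho> \<one>\<^bsub>W\<^esub> v = v"
      using fun_cong[OF action.id_eq_one, of v] by simp
    then have "\<rho> (g \<otimes>\<^bsub>W\<^esub> inv\<^bsub>W\<^esub> g) v = v" "\<rho> (inv\<^bsub>W\<^esub> g \<otimes>\<^bsub>W\<^esub> g) v = v"
      using g by simp_all
    then show "\<rho> g (\<rho> (inv\<^bsub>W\<^esub> g) v) = v" "\<rho> (inv\<^bsub>W\<^esub> g) (\<rho> g v) = v"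
      using g action.composition_rule[of v g "inv\<^bsub>W\<^esub> g"] action.composition_rule[of v "inv\<^bsub>W\<^esub> g" g]
      by simp_all
  qed
  have act_def: "?act g = localization_map (sym_alg scale) \<sigma> (sym_map scale (\<rho> g))" for g
    by (simp add: loc_sym_act_def)
  have sym_hom: "sym_map scale (\<rho> g) \<in> ring_hom (sym_alg scale) (sym_alg scale)"
    if "g \<in> carrier W" for g
    by (rule Sy.sym_map_hom[OF assms(5)[OF that]])
  have twisted: "biprojective ?R (twisted ?R ?act g) {()}" if g: "g \<in> carrier W" for g
  proof (rule R.twisted_biprojective[where \<psi> = "?act (inv\<^bsub>W\<^esub> g)"])
    have g': "inv\<^bsub>W\<^esub> g \<in> carrier W" using g by simp
    show "?act g \<in> ring_hom ?R ?R"
      unfolding act_def loc_sym_def by (rule Lo.localization_map_hom[OF sym_hom[OF g] assms(11)[OF g]])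
    show "?act (inv\<^bsub>W\<^esub> g) \<in> ring_hom ?R ?R"
      unfolding act_def loc_sym_def by (rule Lo.localization_map_hom[OF sym_hom[OF g'] assms(11)[OF g']])
    show "?act g (?act (inv\<^bsub>W\<^esub> g) r) = r" if "r \<in> carrier ?R" for r
      unfolding act_def
      by (rule Lo.localization_map_inverse[OF sym_hom[OF g] assms(11)[OF g] sym_hom[OF g'] assms(11)[OF g']])
        (use that g g' in \<open>auto simp: loc_sym_def Sy.sym_map_comp assms(5) \<rho>_inv\<close>)
    show "?act (inv\<^bsub>W\<^esub> g) (?act g r) = r" if "r \<in> carrier ?R" for r
      unfolding act_def
      by (rule Lo.localization_map_inverse[OF sym_hom[OF g'] assms(11)[OF g'] sym_hom[OF g] assms(11)[OF g]])
        (use that g g' in \<open>auto simp: loc_sym_def Sy.sym_map_comp assms(5) \<rho>_inv\<close>)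
    show "?act g r \<in> homog ?R d" if "r \<in> homog ?R d" for r d
      using Lo.localization_map_homog[OF sym_hom[OF g] assms(11)[OF g] Sy.sym_map_homog[OF assms(5)[OF g]]] that
      unfolding act_def loc_sym_def by blast
    show "?act (inv\<^bsub>W\<^esub> g) r \<in> homog ?R d" if "r \<in> homog ?R d" for r d
      using Lo.localization_map_homog[OF sym_hom[OF g'] assms(11)[OF g'] Sy.sym_map_homog[OF assms(5)[OF g']]] that
      unfolding act_def loc_sym_def by blast
  qed
  have "\<forall>t\<in>?T. \<exists>D b deg. invariant_dual_basis ?R (?act t) D b deg"
  proof
    fix t assume t: "t \<in> ?T"
    let ?a = "root_of t" and ?c = "coroot_of t" and ?A = "sym_alg scale"
    have tW: "t \<in> carrier W" using reflections_closed[OF assms(1) t] .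
    have c: "Vector_Spaces.linear scale (*) ?c" "?c ?a = 2" and \<rho>t: "\<rho> t v = v - scale (?c v) ?a" for v
      using assms(7)[OF t] by (auto simp: reflection_with_def)
    interpret c: Vector_Spaces.linear scale "(*)" ?c by (rule c(1))
    have two: "(2 :: 'k) \<noteq> 0" by (rule two_neq_zero[OF assms(2)])
    then have a: "?a \<noteq> 0" using c(2) c.zero by auto
    have lin: "Vector_Spaces.linear scale scale (\<rho> t)" using assms(5)[OF tW] .
    have refl2: "\<rho> t (\<rho> t v) = v" for v
    proof -
      have "?c (\<rho> t v) = - ?c v"
        by (simp add: \<rho>t c.diff c.scale c(2))
      then have "\<rho> t (\<rho> t v) = \<rho> t v - scale (- ?c v) ?a"
        using \<rho>t by metis
      then show ?thesis by (simp add: \<rho>t fd.scale_minus_left)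
    qed
    have "scale 2 ?a = ?a + ?a"
      using fd.scale_left_distrib[of 1 1 ?a] by simp
    then have root: "\<rho> t ?a = - ?a"
      by (simp add: \<rho>t c(2))
    \<comment> \<open>The constant one half, which exists because the characteristic is not two.\<close>
    let ?h = "sym_class scale (Poly_Mapping.single 0 (1 / 2))"
    show "\<exists>D b deg. invariant_dual_basis ?R (?act t) D b deg"
      unfolding loc_sym_def
    proof (rule Lo.reflection_dual_basis_localization[where f = "sym_map scale (\<rho> t)"
          and \<alpha> = "sym_vec scale ?a" and e = 2 and half = ?h])
      show "sym_map scale (\<rho> t) \<in> ring_hom ?A ?A" by (rule sym_hom[OF tW])
      show "sym_map scale (\<rho> t) s \<in> \<sigma>" if "s \<in> \<sigma>" for s using assms(11)[OF tW that] .
      show "sym_map scale (\<rho> t) (sym_map scale (\<rho> t) x) = x" if "x \<in> carrier ?A" for x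
        by (rule Sy.sym_map_comp[OF lin lin refl2 that])
      show "sym_map scale (\<rho> t) x \<in> homog ?A d" if "x \<in> homog ?A d" for x d
        by (rule Sy.sym_map_homog[OF lin that])
      show "sym_vec scale ?a \<in> homog ?A 2" by (rule Sy.sym_vec_homog)
      show "sym_vec scale ?a \<noteq> \<zero>\<^bsub>?A\<^esub>" by (rule Sy.sym_vec_nonzero[OF fd a])
      show "sym_map scale (\<rho> t) (sym_vec scale ?a) = \<ominus>\<^bsub>?A\<^esub> sym_vec scale ?a"
        by (simp add: Sy.sym_map_vec[OF lin] root Sy.sym_vec_uminus)
      show "?h \<in> homog ?A 0" by (auto simp: Sy.Sym_homog)
      show "?h \<oplus>\<^bsub>?A\<^esub> ?h = \<one>\<^bsub>?A\<^esub>"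
        using two by (simp add: Sy.Sym_add Sy.Sym_one single_add[symmetric])
      show "sym_map scale (\<rho> t) ?h = ?h"
        by (simp add: Sy.sym_map_cl[OF lin] poly_map_single)
      show "\<exists>q\<in>carrier ?A. x \<ominus>\<^bsub>?A\<^esub> sym_map scale (\<rho> t) x = sym_vec scale ?a \<otimes>\<^bsub>?A\<^esub> q"
        if "x \<in> carrier ?A" for x
        by (rule Sy.sym_map_reflection_divisible(1)[OF lin \<rho>t that])
      show "\<exists>q\<in>homog ?A (d - 2). x \<ominus>\<^bsub>?A\<^esub> sym_map scale (\<rho> t) x = sym_vec scale ?a \<otimes>\<^bsub>?A\<^esub> q"
        if "x \<in> homog ?A d" for x d
        by (rule Sy.sym_map_reflection_divisible(2)[OF lin \<rho>t that])
      \<comment> \<open>The root divides zero, so zero is excluded from the multiplicative set.\<close>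
      show "\<zero>\<^bsub>?A\<^esub> \<notin> \<sigma>"
      proof
        assume "\<zero>\<^bsub>?A\<^esub> \<in> \<sigma>"
        moreover have "sym_vec scale ?a divides\<^bsub>?A\<^esub> \<zero>\<^bsub>?A\<^esub>"
          using Sy.sym_vec_homog[of ?a] A.homog_carrier
          by (auto simp: factor_def intro!: bexI[of _ "\<zero>\<^bsub>?A\<^esub>"])
        ultimately show False using assms(12)[OF t] by blast
      qed
      show "?act t = localization_map ?A \<sigma> (sym_map scale (\<rho> t))" by (rule act_def)
    qed
  qed
  then obtain D b deg where D: "\<forall>t\<in>?T. invariant_dual_basis ?R (?act t) (D t) (b t) (deg t)"
    by metis
  interpret idb: invariant_dual_bases ?R ?act ?T D b deg
    by (intro invariant_dual_bases.intro invariant_dual_bases_axioms.intro R.graded_coefficients_axioms)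
      (use D in blast)
  have "biprojective ?R (twisted_bott_samelson ?R ?act x ts y) (({()} \<times> {es :: bool list. length es = length ts}) \<times> {()})"
    unfolding twisted_bott_samelson_def
    by (intro tensor_biprojective twisted idb.bott_samelson_biprojective assms)
  moreover have "biprojective ?R (twisted_bott_samelson ?R ?act z ts' w) (({()} \<times> {es :: bool list. length es = length ts'}) \<times> {()})"
    unfolding twisted_bott_samelson_def
    by (intro tensor_biprojective twisted idb.bott_samelson_biprojective assms)
  ultimately show ?thesis
    using hom_bimodule_reflexive by blast
qed

end
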